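(* Let $n\ge1$ and let $\Lambda^{(0,\bullet)}_q$ be the quantum exterior algebra associated to the tangent space $T^{(0,1)}$ of $\mathcal O_q(\mathrm{SU}_{n+1})$, whose top degree component is $\Lambda^{(0,|\Delta^+|)}_q$. For any linear isomorphism $\iota:\Lambda^{(0,|\Delta^+|)}_q\to\mathbb C$ (extended by zero to the homogeneous components of other degrees), the bilinear map $$B:\Lambda^{(0,\bullet)}_q\otimes\Lambda^{(0,\bullet)}_q\to\mathbb C,\qquad v\otimes w\mapsto\iota(v\wedge w),$$ gives $\Lambda^{(0,\bullet)}_q$ the structure of a Frobenius algebra.
   Context: A Frobenius algebra is an associative algebra $R$ equipped with a non-degenerate bilinear map $B:R\times R\to\mathbb C$ satisfying $B(ab,c)=B(a,bc)$ for all $a,b,c\in R$. All algebras are over $\mathbb C$. Fix $q\in\mathbb R$, $q\ne-1,0,1$; $[a,b]_c:=ab-c\,ba$. $\Delta^+=\{\alpha_{ij}=\varepsilon_i-\varepsilon_j\mid1\le i<j\le n+1\}$. $U_q(\mathfrak{sl}_{n+1})$ is the standard Drinfeld--Jimbo algebra with generators $E_i,F_i,K_i^{\pm1}$, $i=1,\dots,n$ ($K_iE_j=q^{a_{ij}}E_jK_i$, $K_iF_j=q^{-a_{ij}}F_jK_i$, $E_iF_j-F_jE_i=\delta_{ij}\frac{K_i-K_i^{-1}}{q-q^{-1}}$, $K_i$'s commuting and invertible, quantum Serre relations), and coproduct $\Delta(K_i)=K_i\otimes K_i$, $\Delta(E_i)=E_i\otimes K_i+1\otimes E_i$, $\Delta(F_i)=F_i\otimes1+K_i^{-1}\otimes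 F_i$. $A:=\mathcal O_q(\mathrm{SU}_{n+1})$ is the Hopf algebra of matrix coefficients of the finite-dimensional type-1 representations of $U_q(\mathfrak{sl}_{n+1})$. It is generated by $u_{ij}$, $i,j=1,\dots,n+1$, with $\Delta(u_{ij})=\sum_au_{ia}\otimes u_{aj}$, $\varepsilon(u_{ij})=\delta_{ij}$; the evaluation pairing satisfies $\langle E_i,u_{i+1,i}\rangle=1$, $\langle F_i,u_{i,i+1}\rangle=1$, $\langle K_j^{\pm1},u_{ii}\rangle=q^{\pm(\delta_{j+1,i}-\delta_{ij})}$, all other pairings of generators being zero. For $1\le i<j\le n+1$ put $E_{ji}:=[E_{j-1},[E_{j-2},[\cdots[E_{i+1},E_i]_{q^{-1}}\cdots]_{q^{-1}}]_{q^{-1}}$ (with $E_{i+1,i}=E_i$), and $T^{(0,1)}:=\mathrm{span}_{\mathbb C}\{E_{ji}\}$. Put $A^+=\ker\varepsilon$, $a^+:=a-\varepsilon(a)1$, $I:=\{x\in A^+\mid\langle X,x\rangle=0\ \forall X\in T^{(0,1)}\}$, and $\Lambda^{(0,1)}_q:=A^+/I$. With $I^{(2)}:=\{[x_{(1)}^+]\otimes[x_{(2)}^+]\mid x\in I\}$, the quantum exterior algebra is the $\mathbb Z_{\ge0}$-graded algebra $\Lambda^{(0,\bullet)}_q:=\mathcal T(\Lambda^{(0,1)}_q)/\langle I^{(2)}\rangle$, with multiplication $\wedge$. Its component of degree $|\Delta^+|$ is one-dimensional and all components of higher degree vanish. *)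

theory Defs
  imports
    "HOL-Library.Poly_Mapping"
    "HOL-Library.Product_Plus"
    "HOL-Algebra.QuotRing"
    "Jordan_Normal_Form.VS_Connect"
begin

section \<open>Algebras over the complex numbers\<close>

text \<open>
  HOL-Algebra's locale \<open>algebra\<close> requires commutative multiplication, so associative algebras are
  rendered as \<^type>\<open>module\<close> records over \<^term>\<open>class_ring :: complex ring\<close>.
\<close>

locale complex_algebra = ring R + Module.module "class_ring :: complex ring" R
  for R :: "(complex, 'a) module" (structure) +
  assumes smult_mult_left:
      "\<lbrakk>x \<in> carrier R; y \<in> carrier R\<rbrakk> \<Longrightarrow> (c \<odot> x) \<otimes> y = c \<odot> (x \<otimes> y)"
    and smult_mult_right:
      "\<lbrakk>x \<in> carrier R; y \<in> carrier R\<rbrakk> \<Longrightarrow> x \<otimes> (c \<odot> y) = c \<odot> (x \<otimes> y)"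

locale frobenius_algebra = complex_algebra R
  for R :: "(complex, 'a) module" (structure) and B :: "'a \<Rightarrow> 'a \<Rightarrow> complex" +
  assumes form_add_left:
      "\<lbrakk>x \<in> carrier R; y \<in> carrier R; z \<in> carrier R\<rbrakk> \<Longrightarrow> B (x \<oplus> y) z = B x z + B y z"
    and form_smult_left:
      "\<lbrakk>x \<in> carrier R; y \<in> carrier R\<rbrakk> \<Longrightarrow> B (c \<odot> x) y = c * B x y"
    and form_add_right:
      "\<lbrakk>x \<in> carrier R; y \<in> carrier R; z \<in> carrier R\<rbrakk> \<Longrightarrow> B x (y \<oplus> z) = B x y + B x z"
    and form_smult_right:
      "\<lbrakk>x \<in> carrier R; y \<in> carrier R\<rbrakk> \<Longrightarrow> B x (c \<odot> y) = c * B x y"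
    and form_assoc:
      "\<lbrakk>x \<in> carrier R; y \<in> carrier R; z \<in> carrier R\<rbrakk> \<Longrightarrow> B (x \<otimes> y) z = B x (y \<otimes> z)"
    and nondegenerate_left:
      "\<lbrakk>x \<in> carrier R; \<And>y. y \<in> carrier R \<Longrightarrow> B x y = 0\<rbrakk> \<Longrightarrow> x = \<zero>"
    and nondegenerate_right:
      "\<lbrakk>y \<in> carrier R; \<And>x. x \<in> carrier R \<Longrightarrow> B x y = 0\<rbrakk> \<Longrightarrow> y = \<zero>"

abbreviation cspan :: "(complex, 'a) module \<Rightarrow> 'a set \<Rightarrow> 'a set" where
  "cspan \<equiv> LinearCombinations.module.span class_ring"

definition complex_line :: "(complex, complex) module" where
  "complex_line = \<lparr>carrier = UNIV, mult = (*), one = 1, zero = 0, add = (+), smult = (*)\<rparr>"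

definition linear_iso :: "(complex, 'a) module \<Rightarrow> (complex, 'b) module \<Rightarrow> ('a \<Rightarrow> 'b) set" where
  "linear_iso M N = {f \<in> LinearCombinations.module_hom class_ring M N. bij_betw f (carrier M) (carrier N)}"

text \<open>
  Quotient by a subspace \<open>N\<close>, with cosets as elements.  Multiplication and unit are meaningful only
  if \<open>N\<close> is a two-sided ideal; for the quotient of a mere vector space they are ignored.
\<close>
definition quot_alg :: "(complex, 'a) module \<Rightarrow> 'a set \<Rightarrow> (complex, 'a set) module" where
  "quot_alg M N =
    \<lparr>carrier = a_rcosets\<^bsub>M\<^esub> N, mult = rcoset_mult M N, one = N +>\<^bsub>M\<^esub> \<one>\<^bsub>M\<^esub>,
     zero = N, add = set_add M, smult = (\<lambda>c A. \<Union>a\<in>A. N +>\<^bsub>M\<^esub> (c \<odot>\<^bsub>M\<^esub> a))\<rparr>"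

definition qcomm :: "(complex, 'a) module \<Rightarrow> complex \<Rightarrow> 'a \<Rightarrow> 'a \<Rightarrow> 'a" where
  "qcomm M c a b = a \<otimes>\<^bsub>M\<^esub> b \<ominus>\<^bsub>M\<^esub> c \<odot>\<^bsub>M\<^esub> (b \<otimes>\<^bsub>M\<^esub> a)"


section \<open>Free algebras and tensor algebras\<close>

text \<open>
  The free monoid, written additively because \<open>'k \<Rightarrow>\<^sub>0 complex\<close> carries the convolution product
  with respect to addition of keys; hence \<open>'g free_word \<Rightarrow>\<^sub>0 complex\<close> is the algebra of
  noncommutative polynomials in indeterminates from \<open>'g\<close>.
\<close>
datatype 'g free_word = Word (letters: "'g list")

instantiation free_word :: (type) monoid_add
begin
definition zero_free_word :: "'a free_word" where "zero_free_word = Word []"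
definition plus_free_word :: "'a free_word \<Rightarrow> 'a free_word \<Rightarrow> 'a free_word" where
  "plus_free_word v w = Word (letters v @ letters w)"
instance
  by standard (simp_all add: zero_free_word_def plus_free_word_def)
end

type_synonym 'g ncpoly = "'g free_word \<Rightarrow>\<^sub>0 complex"

definition scalar :: "complex \<Rightarrow> ('k::zero \<Rightarrow>\<^sub>0 complex)" where
  "scalar c = Poly_Mapping.single 0 c"

definition indet :: "'g \<Rightarrow> 'g ncpoly" where
  "indet g = Poly_Mapping.single (Word [g]) 1"

definition free_algebra :: "'g set \<Rightarrow> (complex, 'g ncpoly) module" where
  "free_algebra S =
    \<lparr>carrier = {p. \<forall>w\<in>Poly_Mapping.keys p. set (letters w) \<subseteq> S},
     mult = (*), one = 1, zero = 0, add = (+), smult = (\<lambda>c p. scalar c * p)\<rparr>"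

definition homogeneous :: "'g set \<Rightarrow> nat \<Rightarrow> 'g ncpoly set" where
  "homogeneous S k =
    {p \<in> carrier (free_algebra S). \<forall>w\<in>Poly_Mapping.keys p. length (letters w) = k}"

text \<open>
  The tensor algebra of \<open>V\<close> is the free algebra on the underlying set of \<open>V\<close>, modulo the ideal
  making the inclusion of \<open>V\<close> linear.
\<close>
definition tensor_ideal :: "(complex, 'v) module \<Rightarrow> 'v ncpoly set" where
  "tensor_ideal V = Idl\<^bsub>free_algebra (carrier V)\<^esub>
    ({indet (x \<oplus>\<^bsub>V\<^esub> y) - indet x - indet y | x y. x \<in> carrier V \<and> y \<in> carrier V} \<union>
     {indet (c \<odot>\<^bsub>V\<^esub> x) - scalar c * indet x | c x. x \<in> carrier V})"

definition tensor_algebra :: "(complex, 'v) module \<Rightarrow> (complex, 'v ncpoly set) module" where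
  "tensor_algebra V = quot_alg (free_algebra (carrier V)) (tensor_ideal V)"

definition tensor_incl :: "(complex, 'v) module \<Rightarrow> 'v \<Rightarrow> 'v ncpoly set" where
  "tensor_incl V x = tensor_ideal V +>\<^bsub>free_algebra (carrier V)\<^esub> indet x"

definition tensor_power :: "(complex, 'v) module \<Rightarrow> nat \<Rightarrow> 'v ncpoly set set" where
  "tensor_power V k =
    (\<lambda>p. tensor_ideal V +>\<^bsub>free_algebra (carrier V)\<^esub> p) ` homogeneous (carrier V) k"


section \<open>The Drinfeld--Jimbo algebra of type A\<close>

datatype uq_gen = gE nat | gF nat | gK nat | gKinv nat

definition uq_gens :: "nat \<Rightarrow> uq_gen set" where
  "uq_gens n = gE ` {1..n} \<union> gF ` {1..n} \<union> gK ` {1..n} \<union> gKinv ` {1..n}"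

definition cartan :: "nat \<Rightarrow> nat \<Rightarrow> int" where
  "cartan i j = (if i = j then 2 else if i = Suc j \<or> j = Suc i then -1 else 0)"

definition serre :: "real \<Rightarrow> 'g \<Rightarrow> 'g \<Rightarrow> 'g ncpoly" where
  "serre q x y = indet x * indet x * indet y
     - scalar (of_real (q + inverse q)) * indet x * indet y * indet x
     + indet y * indet x * indet x"

definition uq_relations :: "nat \<Rightarrow> real \<Rightarrow> uq_gen ncpoly set" where
  "uq_relations n q =
     (\<Union>i\<in>{1..n}. {indet (gK i) * indet (gKinv i) - 1, indet (gKinv i) * indet (gK i) - 1}) \<union>
     (\<Union>i\<in>{1..n}. \<Union>j\<in>{1..n}.
        {indet (gK i) * indet (gK j) - indet (gK j) * indet (gK i),
         indet (gK i) * indet (gE j)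
           - scalar (of_real (q powi cartan i j)) * indet (gE j) * indet (gK i),
         indet (gK i) * indet (gF j)
           - scalar (of_real (q powi (- cartan i j))) * indet (gF j) * indet (gK i),
         indet (gE i) * indet (gF j) - indet (gF j) * indet (gE i)
           - (if i = j
              then scalar (of_real (inverse (q - inverse q))) * (indet (gK i) - indet (gKinv i))
              else 0)}) \<union>
     (\<Union>i\<in>{1..n}. \<Union>j\<in>{j\<in>{1..n}. cartan i j = -1}.
        {serre q (gE i) (gE j), serre q (gF i) (gF j)}) \<union>
     (\<Union>i\<in>{1..n}. \<Union>j\<in>{j\<in>{1..n}. cartan i j = 0}.
        {indet (gE i) * indet (gE j) - indet (gE j) * indet (gE i),
         indet (gF i) * indet (gF j) - indet (gF j) * indet (gF i)})"

type_synonym uq = "uq_gen ncpoly set"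

definition uq_ideal :: "nat \<Rightarrow> real \<Rightarrow> uq_gen ncpoly set" where
  "uq_ideal n q = Idl\<^bsub>free_algebra (uq_gens n)\<^esub> (uq_relations n q)"

definition Uq :: "nat \<Rightarrow> real \<Rightarrow> (complex, uq) module" where
  "Uq n q = quot_alg (free_algebra (uq_gens n)) (uq_ideal n q)"

definition uq_class :: "nat \<Rightarrow> real \<Rightarrow> uq_gen ncpoly \<Rightarrow> uq" where
  "uq_class n q p = uq_ideal n q +>\<^bsub>free_algebra (uq_gens n)\<^esub> p"

text \<open>
  Coproduct and counit on words in the generators, extended multiplicatively and linearly.  The
  polynomials on pairs of words model the tensor square of the free algebra.
\<close>
fun gen_coprod :: "uq_gen \<Rightarrow> (uq_gen free_word \<times> uq_gen free_word) \<Rightarrow>\<^sub>0 complex" where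
  "gen_coprod (gE i) =
     Poly_Mapping.single (Word [gE i], Word [gK i]) 1 + Poly_Mapping.single (0, Word [gE i]) 1"
| "gen_coprod (gF i) =
     Poly_Mapping.single (Word [gF i], 0) 1 + Poly_Mapping.single (Word [gKinv i], Word [gF i]) 1"
| "gen_coprod (gK i) = Poly_Mapping.single (Word [gK i], Word [gK i]) 1"
| "gen_coprod (gKinv i) = Poly_Mapping.single (Word [gKinv i], Word [gKinv i]) 1"

definition free_coprod ::
    "uq_gen ncpoly \<Rightarrow> (uq_gen free_word \<times> uq_gen free_word) \<Rightarrow>\<^sub>0 complex" where
  "free_coprod p = (\<Sum>w\<in>Poly_Mapping.keys p.
     scalar (Poly_Mapping.lookup p w) * prod_list (map gen_coprod (letters w)))"

fun gen_counit :: "uq_gen \<Rightarrow> complex" where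
  "gen_counit (gE i) = 0"
| "gen_counit (gF i) = 0"
| "gen_counit (gK i) = 1"
| "gen_counit (gKinv i) = 1"

definition free_counit :: "uq_gen ncpoly \<Rightarrow> complex" where
  "free_counit p = (\<Sum>w\<in>Poly_Mapping.keys p.
     Poly_Mapping.lookup p w * prod_list (map gen_counit (letters w)))"


section \<open>The quantum coordinate algebra\<close>

text \<open>
  A finite-dimensional representation is an algebra homomorphism into a matrix algebra.  It is of
  type 1 if it has a basis of weight vectors (the columns of \<open>P\<close>) on which every \<open>gK i\<close> acts by
  integer powers of \<open>q\<close>.
\<close>
definition type1_rep :: "nat \<Rightarrow> real \<Rightarrow> nat \<Rightarrow> (uq \<Rightarrow> complex mat) \<Rightarrow> bool" where
  "type1_rep n q d \<rho> \<longleftrightarrow>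
     \<rho> \<in> Ring.ring_hom (Uq n q) (module_mat TYPE(complex) d d) \<inter>
         LinearCombinations.module_hom class_ring (Uq n q) (module_mat TYPE(complex) d d) \<and>
     (\<exists>P Q. \<forall>i\<in>{1..n}. \<exists>wt :: nat \<Rightarrow> int.
        similar_mat_wit (\<rho> (uq_class n q (indet (gK i))))
          (mat_diag d (\<lambda>a. of_real (q powi wt a))) P Q)"

text \<open>
  Functionals on \<open>Uq n q\<close> are functions vanishing outside its carrier, so that equality of
  functions is equality of functionals and the vector space operations are pointwise.
\<close>
definition matrix_coeff ::
    "nat \<Rightarrow> real \<Rightarrow> (uq \<Rightarrow> complex mat) \<Rightarrow> complex vec \<Rightarrow> complex vec \<Rightarrow> uq \<Rightarrow> complex" where
  "matrix_coeff n q \<rho> \<phi> v =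
     (\<lambda>X. if X \<in> carrier (Uq n q) then \<phi> \<bullet> (\<rho> X *\<^sub>v v) else 0)"

definition Oq_carrier :: "nat \<Rightarrow> real \<Rightarrow> (uq \<Rightarrow> complex) set" where
  "Oq_carrier n q = {matrix_coeff n q \<rho> \<phi> v | d \<rho> \<phi> v.
     type1_rep n q d \<rho> \<and> \<phi> \<in> carrier_vec d \<and> v \<in> carrier_vec d}"

text \<open>
  The product is dual to the coproduct of \<open>Uq n q\<close> and the unit is its counit; since the relations
  span a Hopf ideal, the chosen representative of a class does not matter.
\<close>
definition Oq_mult ::
    "nat \<Rightarrow> real \<Rightarrow> (uq \<Rightarrow> complex) \<Rightarrow> (uq \<Rightarrow> complex) \<Rightarrow> uq \<Rightarrow> complex" where
  "Oq_mult n q f g = (\<lambda>X. if X \<in> carrier (Uq n q) then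
     (let D = free_coprod (SOME p. p \<in> X) in
      \<Sum>(u, v)\<in>Poly_Mapping.keys D. Poly_Mapping.lookup D (u, v) *
        f (uq_class n q (Poly_Mapping.single u 1)) * g (uq_class n q (Poly_Mapping.single v 1)))
     else 0)"

definition Oq_one :: "nat \<Rightarrow> real \<Rightarrow> uq \<Rightarrow> complex" where
  "Oq_one n q = (\<lambda>X. if X \<in> carrier (Uq n q) then free_counit (SOME p. p \<in> X) else 0)"

definition Oq :: "nat \<Rightarrow> real \<Rightarrow> (complex, uq \<Rightarrow> complex) module" where
  "Oq n q =
    \<lparr>carrier = Oq_carrier n q, mult = Oq_mult n q, one = Oq_one n q,
     zero = (\<lambda>_. 0), add = (\<lambda>f g X. f X + g X), smult = (\<lambda>c f X. c * f X)\<rparr>"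

definition Oq_counit :: "nat \<Rightarrow> real \<Rightarrow> (uq \<Rightarrow> complex) \<Rightarrow> complex" where
  "Oq_counit n q f = f \<one>\<^bsub>Uq n q\<^esub>"

text \<open>
  \<open>is_Oq_coprod n q x m a b\<close> says that the coproduct of \<open>x\<close> is the sum of the tensors of \<open>a k\<close> and
  \<open>b k\<close> for \<open>k < m\<close>: the coproduct is dual to the product of \<open>Uq n q\<close>, and a tensor of functionals
  is determined by its values on pairs.
\<close>
definition is_Oq_coprod ::
    "nat \<Rightarrow> real \<Rightarrow> (uq \<Rightarrow> complex) \<Rightarrow> nat \<Rightarrow> (nat \<Rightarrow> uq \<Rightarrow> complex) \<Rightarrow> (nat \<Rightarrow> uq \<Rightarrow> complex) \<Rightarrow> bool" where
  "is_Oq_coprod n q x m a b \<longleftrightarrow>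
     (\<forall>k<m. a k \<in> carrier (Oq n q) \<and> b k \<in> carrier (Oq n q)) \<and>
     (\<forall>X\<in>carrier (Uq n q). \<forall>Y\<in>carrier (Uq n q).
        x (X \<otimes>\<^bsub>Uq n q\<^esub> Y) = (\<Sum>k<m. a k X * b k Y))"

definition Oq_plus :: "nat \<Rightarrow> real \<Rightarrow> (uq \<Rightarrow> complex) \<Rightarrow> uq \<Rightarrow> complex" where
  "Oq_plus n q a = a \<ominus>\<^bsub>Oq n q\<^esub> Oq_counit n q a \<odot>\<^bsub>Oq n q\<^esub> \<one>\<^bsub>Oq n q\<^esub>"

text \<open>Only the vector space structure of this record is used.\<close>
definition Oq_aug :: "nat \<Rightarrow> real \<Rightarrow> (complex, uq \<Rightarrow> complex) module" where
  "Oq_aug n q = (Oq n q)\<lparr>carrier := {a \<in> carrier (Oq n q). Oq_counit n q a = 0}\<rparr>"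


section \<open>The tangent space and the quantum exterior algebra\<close>

definition pos_roots :: "nat \<Rightarrow> (nat \<Rightarrow> int) set" where
  "pos_roots n = {(\<lambda>k. of_bool (k = i) - of_bool (k = j)) | i j. 1 \<le> i \<and> i < j \<and> j \<le> n + 1}"

text \<open>\<open>root_vector n q i k\<close> is the root vector with indices \<open>j = i + k + 1\<close> and \<open>i\<close>.\<close>
fun root_vector :: "nat \<Rightarrow> real \<Rightarrow> nat \<Rightarrow> nat \<Rightarrow> uq" where
  "root_vector n q i 0 = uq_class n q (indet (gE i))"
| "root_vector n q i (Suc k) =
     qcomm (Uq n q) (of_real (inverse q))
       (uq_class n q (indet (gE (i + Suc k)))) (root_vector n q i k)"

definition tangent_space :: "nat \<Rightarrow> real \<Rightarrow> uq set" where
  "tangent_space n q =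
     cspan (Uq n q) {root_vector n q i (j - i - 1) | i j. 1 \<le> i \<and> i < j \<and> j \<le> n + 1}"

definition calculus_ideal :: "nat \<Rightarrow> real \<Rightarrow> (uq \<Rightarrow> complex) set" where
  "calculus_ideal n q = {x \<in> carrier (Oq_aug n q). \<forall>X\<in>tangent_space n q. x X = 0}"

type_synonym one_form = "(uq \<Rightarrow> complex) set"

definition one_forms :: "nat \<Rightarrow> real \<Rightarrow> (complex, one_form) module" where
  "one_forms n q = quot_alg (Oq_aug n q) (calculus_ideal n q)"

definition one_form_class :: "nat \<Rightarrow> real \<Rightarrow> (uq \<Rightarrow> complex) \<Rightarrow> one_form" where
  "one_form_class n q a = calculus_ideal n q +>\<^bsub>Oq_aug n q\<^esub> a"

definition quadratic_relations :: "nat \<Rightarrow> real \<Rightarrow> one_form ncpoly set set" where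
  "quadratic_relations n q =
     {\<Oplus>\<^bsub>tensor_algebra (one_forms n q)\<^esub>k\<in>{..<m}.
        tensor_incl (one_forms n q) (one_form_class n q (Oq_plus n q (a k)))
          \<otimes>\<^bsub>tensor_algebra (one_forms n q)\<^esub>
        tensor_incl (one_forms n q) (one_form_class n q (Oq_plus n q (b k)))
      | x m a b. x \<in> calculus_ideal n q \<and> is_Oq_coprod n q x m a b}"

type_synonym form = "one_form ncpoly set set"

definition exterior_ideal :: "nat \<Rightarrow> real \<Rightarrow> one_form ncpoly set set" where
  "exterior_ideal n q = Idl\<^bsub>tensor_algebra (one_forms n q)\<^esub> (quadratic_relations n q)"

definition exterior_algebra :: "nat \<Rightarrow> real \<Rightarrow> (complex, form) module" where
  "exterior_algebra n q = quot_alg (tensor_algebra (one_forms n q)) (exterior_ideal n q)"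

definition exterior_power :: "nat \<Rightarrow> real \<Rightarrow> nat \<Rightarrow> form set" where
  "exterior_power n q k =
     (\<lambda>t. exterior_ideal n q +>\<^bsub>tensor_algebra (one_forms n q)\<^esub> t) ` tensor_power (one_forms n q) k"

definition exterior_power_space :: "nat \<Rightarrow> real \<Rightarrow> nat \<Rightarrow> (complex, form) module" where
  "exterior_power_space n q k = (exterior_algebra n q)\<lparr>carrier := exterior_power n q k\<rparr>"

text \<open>
  The homogeneous component of \<open>x\<close> of degree \<open>k\<close>; it is unique because \<open>exterior_ideal\<close> is
  generated by homogeneous elements.
\<close>
definition degree_part :: "nat \<Rightarrow> real \<Rightarrow> nat \<Rightarrow> form \<Rightarrow> form" where
  "degree_part n q k x = (THE y. y \<in> exterior_power n q k \<and>
     (\<exists>z\<in>cspan (exterior_algebra n q) (\<Union>l\<in>- {k}. exterior_power n q l).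
        x = y \<oplus>\<^bsub>exterior_algebra n q\<^esub> z))"

definition extend_by_zero :: "nat \<Rightarrow> real \<Rightarrow> nat \<Rightarrow> (form \<Rightarrow> complex) \<Rightarrow> form \<Rightarrow> complex" where
  "extend_by_zero n q k \<iota> x = \<iota> (degree_part n q k x)"

end

theory Submission
  imports Defs
begin

text \<open>
  Write \<open>\<omega> \<alpha>\<close> for the one-forms dual to the root vectors \<open>E \<alpha>\<close>, where \<open>\<alpha> = (j, i)\<close> runs over the positive
  roots.  The exterior algebra is spanned by the products of these forms over the sets \<open>A\<close> of roots, each
  root occurring at most once and in a fixed order, and multiplication by the product over the
  complement of \<open>A\<close> reads off the coefficient at \<open>A\<close>, as long as \<open>A\<close> is chosen suitably.  That these
  products are linearly independent is not an input: the isomorphism \<open>\<iota>\<close> says that the top component is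
  nonzero, and the relations then do the rest.

  The relations come from the following observation.  If \<open>x\<close> lies in the calculus ideal, then
  expanding the one-forms in its coproduct turns the defining relation into
  \<open>\<Sum> x (E \<alpha> \<otimes> E \<beta>) \<omega> \<alpha> \<and> \<omega> \<beta> = 0\<close> (lemma \<open>quadratic_relation\<close>).  So it suffices to know enough functionals
  that vanish at \<open>1\<close> and at the root vectors, together with their values at products of two root
  vectors.  Matrix coefficients of the square of the vector representation are enough.  The one that
  leads from \<open>v b \<otimes> v d\<close> to \<open>v a \<otimes> v c\<close>, where \<open>d \<le> b < a\<close> and \<open>d < c\<close>, gives
  (lemma \<open>commutation_relation\<close>)
  \<open>u \<omega> (a, b) \<omega> (c, d) + v \<omega> (c, d) \<omega> (a, b) + [a < c] (q - inverse q) \<omega> (c, b) \<omega> (a, d) = 0\<close>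
  with explicit nonzero \<open>u\<close> and \<open>v\<close>.  Hence the square of each form vanishes, and two different forms
  can be exchanged up to a nonzero factor and a correction.  The correction replaces two nested index
  intervals by two crossing ones, which strictly decreases the sum of the squares of their lengths.

  This sum, extended to words, is the weight that controls the straightening.  Modulo words of smaller
  weight, letters can be permuted up to nonzero factors (\<open>similar_mset\<close>), and a word with a repeated
  letter vanishes (\<open>repeated_lower\<close>).  Let \<open>H\<close> be the weight of a word that contains every root once.
  Under \<open>\<iota>\<close>, words of top degree with a repeated letter and weight at most \<open>H\<close> vanish, because only words
  of the same kind and of smaller weight can appear when they are rewritten (\<open>ev_repeated\<close>).  Words that
  contain every root once do not vanish, since otherwise \<open>\<iota>\<close> would be zero (\<open>ev_full\<close>).  If an element
  is nonzero, choose among the sets \<open>A\<close> with nonzero coefficient one of maximal weight and multiply by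
  the complementary word: every other term yields a word of the wrong degree, or one with a repeated
  letter and weight at most \<open>H\<close> (\<open>ev_non_complement\<close>), so the result is nonzero (\<open>nondegenerate\<close>).

  All computations take place in the free algebra on the set of one-forms, modulo the kernel of the
  projection to the exterior algebra.  This kernel is homogeneous (\<open>graded_part_relation\<close>), which makes
  the homogeneous components of a form, and with them the extension of \<open>\<iota>\<close> by zero, well defined
  (\<open>degree_part_form_of\<close>).
\<close>

section \<open>Quotients of complex algebras\<close>

locale subspace_quotient =
  fixes M :: "(complex, 'a) module" (structure) and N :: "'a set"
  assumes module_M: "Module.module (class_ring :: complex ring) M"
    and N_subset: "N \<subseteq> carrier M"
    and N_zero: "\<zero> \<in> N"
    and N_add: "\<lbrakk>x \<in> N; y \<in> N\<rbrakk> \<Longrightarrow> x \<oplus> y \<in> N"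
    and N_smult: "x \<in> N \<Longrightarrow> c \<odot> x \<in> N"
begin

interpretation Module.module "class_ring :: complex ring" M by (rule module_M)

lemma smult_carrier: "x \<in> carrier M \<Longrightarrow> c \<odot> x \<in> carrier M"
  by (simp add: smult_closed)

lemma abelian_subgroup_N: "abelian_subgroup N M"
proof (rule abelian_subgroupI3)
  show "additive_subgroup N M"
  proof (rule additive_subgroupI, rule M.add.subgroupI)
    show "N \<subseteq> carrier M" by (rule N_subset)
    show "N \<noteq> {}" using N_zero by auto
    fix x assume "x \<in> N"
    then have "\<ominus> x = (-1) \<odot> x"
      using smult_minus_1[of x] N_subset by (auto simp: class_ring_simps)
    then show "\<ominus> x \<in> N" using N_smult[OF \<open>x \<in> N\<close>, of "-1"] by simp
  next
    fix x y assume "x \<in> N" "y \<in> N" then show "x \<oplus> y \<in> N" using N_add by simp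
  qed
  show "abelian_group M" ..
qed

interpretation N: abelian_subgroup N M by (rule abelian_subgroup_N)

lemma quot_carrier: "carrier (quot_alg M N) = (\<lambda>x. N +> x) ` carrier M"
  by (auto simp: quot_alg_def A_RCOSETS_def')

lemma coset_in_quot: "x \<in> carrier M \<Longrightarrow> N +> x \<in> carrier (quot_alg M N)"
  by (simp add: quot_carrier)

lemma coset_self: "x \<in> carrier M \<Longrightarrow> x \<in> N +> x"
  by (rule N.a_rcos_self)

lemma in_cosetD:
  assumes "x \<in> carrier M" "y \<in> N +> x"
  shows "y \<in> carrier M" "y \<ominus> x \<in> N"
  using N.a_elemrcos_carrier[OF assms] N.a_rcos_module[of x y] assms by (auto simp: a_minus_def)

lemma coset_eq_iff:
  assumes "x \<in> carrier M" "y \<in> carrier M"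
  shows "N +> x = N +> y \<longleftrightarrow> x \<ominus> y \<in> N"
  using assms N.a_rcos_module[of y x] N.a_repr_independence'[of x y] N.a_rcos_self[of x]
  by (auto simp: a_minus_def)

lemma coset_zero: "N +> \<zero> = N"
  by (rule N.a_rcos_const[OF N_zero])

lemma coset_eq_zero_iff: "x \<in> carrier M \<Longrightarrow> N +> x = N \<longleftrightarrow> x \<in> N"
  by (metis N.a_rcos_self N.a_rcos_const)

lemma quot_zero: "\<zero>\<^bsub>quot_alg M N\<^esub> = N"
  by (simp add: quot_alg_def)

lemma quot_add:
  "\<lbrakk>x \<in> carrier M; y \<in> carrier M\<rbrakk> \<Longrightarrow> (N +> x) \<oplus>\<^bsub>quot_alg M N\<^esub> (N +> y) = N +> (x \<oplus> y)"
  by (simp add: quot_alg_def N.a_rcos_sum)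

text \<open>
  The scalar action on cosets is a union over all representatives; the members of this union coincide
  because \<open>N\<close> is closed under scalars.
\<close>
lemma quot_smult:
  assumes "x \<in> carrier M"
  shows "c \<odot>\<^bsub>quot_alg M N\<^esub> (N +> x) = N +> (c \<odot> x)"
proof -
  have "N +> (c \<odot> a) = N +> (c \<odot> x)" if "a \<in> N +> x" for a
  proof -
    have a: "a \<in> carrier M" using that assms N.a_elemrcos_carrier by blast
    then have "a \<ominus> x \<in> N" using that N.a_rcos_module[OF assms a] by (simp add: a_minus_def)
    then have "c \<odot> (a \<ominus> x) \<in> N" by (rule N_smult)
    also have "c \<odot> (a \<ominus> x) = c \<odot> a \<ominus> c \<odot> x"
      using assms a smult_r_distr[of c a "\<ominus> x"] smult_r_minus[of c x] by (simp add: a_minus_def)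
    finally show ?thesis using a assms by (subst coset_eq_iff) (auto simp: smult_carrier)
  qed
  moreover have "x \<in> N +> x" using assms by (rule N.a_rcos_self)
  ultimately have "(\<Union>a\<in>N +> x. N +> (c \<odot> a)) = N +> (c \<odot> x)"
    by (intro SUP_eq_const) blast+
  then show ?thesis by (simp add: quot_alg_def)
qed

lemma module_quot: "Module.module (class_ring :: complex ring) (quot_alg M N)"
proof (rule moduleI)
  show "cring (class_ring :: complex ring)" ..
  show "abelian_group (quot_alg M N)"
  proof (rule abelian_groupI)
    fix X assume "X \<in> carrier (quot_alg M N)"
    then obtain x where x: "x \<in> carrier M" "X = N +> x" by (auto simp: quot_carrier)
    show "\<exists>Y\<in>carrier (quot_alg M N). Y \<oplus>\<^bsub>quot_alg M N\<^esub> X = \<zero>\<^bsub>quot_alg M N\<^esub>"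
      by (rule bexI[of _ "N +> (\<ominus> x)"]) (use x in \<open>auto simp: quot_add quot_zero coset_zero M.l_neg coset_in_quot\<close>)
  next
    fix X assume "X \<in> carrier (quot_alg M N)"
    then obtain x where x: "x \<in> carrier M" "X = N +> x" by (auto simp: quot_carrier)
    then show "\<zero>\<^bsub>quot_alg M N\<^esub> \<oplus>\<^bsub>quot_alg M N\<^esub> X = X"
      using quot_add[of \<zero> x] by (simp add: quot_zero coset_zero)
  next
    show "\<zero>\<^bsub>quot_alg M N\<^esub> \<in> carrier (quot_alg M N)"
      using coset_in_quot[of \<zero>] by (simp add: quot_zero coset_zero)
  qed (clarsimp simp: quot_carrier quot_add M.a_ac)+
qed (clarsimp simp: quot_carrier quot_add quot_smult smult_carrier smult_r_distr smult_one[simplified]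
     smult_l_distr[simplified] smult_assoc1[simplified])+

lemma quot_uminus:
  assumes "x \<in> carrier M"
  shows "\<ominus>\<^bsub>quot_alg M N\<^esub> (N +> x) = N +> (\<ominus> x)"
proof -
  interpret Q: Module.module "class_ring :: complex ring" "quot_alg M N" by (rule module_quot)
  have "(N +> (\<ominus> x)) \<oplus>\<^bsub>quot_alg M N\<^esub> (N +> x) = \<zero>\<^bsub>quot_alg M N\<^esub>"
    using assms by (simp add: quot_add quot_zero coset_zero M.l_neg)
  then show ?thesis
    using assms by (intro Q.minus_equality) (auto simp: coset_in_quot)
qed

lemma quot_minus:
  "\<lbrakk>x \<in> carrier M; y \<in> carrier M\<rbrakk> \<Longrightarrow> (N +> x) \<ominus>\<^bsub>quot_alg M N\<^esub> (N +> y) = N +> (x \<ominus> y)"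
  unfolding a_minus_def by (simp add: quot_uminus quot_add)

lemma quot_finsum:
  assumes "\<And>i. i \<in> A \<Longrightarrow> f i \<in> carrier M"
  shows "(\<Oplus>\<^bsub>quot_alg M N\<^esub>i\<in>A. N +> f i) = N +> (\<Oplus>i\<in>A. f i)"
proof -
  interpret Q: Module.module "class_ring :: complex ring" "quot_alg M N" by (rule module_quot)
  show ?thesis
    using assms
  proof (induction A rule: infinite_finite_induct)
    case (infinite A)
    then show ?case by (simp add: coset_zero quot_zero)
  next
    case empty
    then show ?case by (simp add: coset_zero quot_zero)
  next
    case (insert a A)
    have "(\<Oplus>\<^bsub>quot_alg M N\<^esub>i\<in>insert a A. N +> f i) = (N +> f a) \<oplus>\<^bsub>quot_alg M N\<^esub> (\<Oplus>\<^bsub>quot_alg M N\<^esub>i\<in>A. N +> f i)"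
      using insert by (intro Q.M.finsum_insert) (auto intro!: coset_in_quot)
    also have "\<dots> = N +> (f a \<oplus> (\<Oplus>i\<in>A. f i))"
      using insert by (simp add: quot_add)
    also have "f a \<oplus> (\<Oplus>i\<in>A. f i) = (\<Oplus>i\<in>insert a A. f i)"
      using insert by (intro M.finsum_insert[symmetric]) auto
    finally show ?case .
  qed
qed

end

locale algebra_quotient =
  fixes M :: "(complex, 'a) module" (structure) and N :: "'a set"
  assumes algebra_M: "complex_algebra M" and ideal_N: "ideal N M"
begin

interpretation complex_algebra M by (rule algebra_M)
interpretation ideal N M by (rule ideal_N)

text \<open>
  In a unital algebra \<open>c \<odot> x = (c \<odot> \<one>) \<otimes> x\<close>, so two-sided ideals are subspaces.
\<close>
lemma ideal_smult:
  assumes "x \<in> N" shows "c \<odot> x \<in> N"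
proof -
  have x: "x \<in> carrier M" using assms by simp
  have "c \<odot> x = (c \<odot> \<one>) \<otimes> x" using x by (simp add: smult_mult_left)
  also have "\<dots> \<in> N" using assms by (intro I_l_closed) (auto intro: smult_closed[simplified])
  finally show ?thesis .
qed

sublocale Q: subspace_quotient M N
  by unfold_locales (auto simp: ideal_smult)

lemma quot_mult:
  "\<lbrakk>x \<in> carrier M; y \<in> carrier M\<rbrakk> \<Longrightarrow> (N +> x) \<otimes>\<^bsub>quot_alg M N\<^esub> (N +> y) = N +> (x \<otimes> y)"
  by (simp add: quot_alg_def rcoset_mult_add)

lemma quot_one: "\<one>\<^bsub>quot_alg M N\<^esub> = N +> \<one>"
  by (simp add: quot_alg_def)

lemma complex_algebra_quot: "complex_algebra (quot_alg M N)"
proof -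
  interpret Qm: Module.module "class_ring :: complex ring" "quot_alg M N" by (rule Q.module_quot)
  have ring_M: "ring M" ..
  note assoc = monoid.m_assoc[OF ring.is_monoid[OF ring_M]]
    and distr = ring.ring_simprules(13,23)[OF ring_M]
  have "ring (quot_alg M N)"
  proof (rule ringI)
    show "abelian_group (quot_alg M N)" ..
    show "Group.monoid (quot_alg M N)"
      by (rule monoidI) (clarsimp simp: Q.quot_carrier quot_mult quot_one assoc)+
  qed (clarsimp simp: Q.quot_carrier quot_mult Q.quot_add distr)+
  then interpret Qr: ring "quot_alg M N" .
  show ?thesis
    by unfold_locales (clarsimp simp: Q.quot_carrier quot_mult Q.quot_smult Q.smult_carrier
        smult_mult_left smult_mult_right)+
qed

end

section \<open>Noncommutative polynomials\<close>

lemma poly_mapping_sum_single: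
  fixes p :: "'k \<Rightarrow>\<^sub>0 complex"
  shows "p = (\<Sum>w\<in>Poly_Mapping.keys p. Poly_Mapping.single w (Poly_Mapping.lookup p w))"
  by (rule poly_mapping_eqI)
    (auto simp: lookup_sum lookup_single when_def sum.delta' in_keys_iff)

lemma poly_mapping_induct_single:
  fixes p :: "'k \<Rightarrow>\<^sub>0 complex"
  assumes "P 0"
    and "\<And>w c. w \<in> Poly_Mapping.keys p \<Longrightarrow> P (Poly_Mapping.single w c)"
    and "\<And>p q. \<lbrakk>P p; P q\<rbrakk> \<Longrightarrow> P (p + q)"
  shows "P p"
proof -
  have "P (\<Sum>w\<in>A. Poly_Mapping.single w (Poly_Mapping.lookup p w))" if "A \<subseteq> Poly_Mapping.keys p" for A
    using finite_subset[OF that finite_keys] that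
    by (induction A rule: finite_induct) (auto intro: assms)
  then show ?thesis by (metis poly_mapping_sum_single subset_refl)
qed

lemma scalar_mult_single: "scalar c * Poly_Mapping.single w a = Poly_Mapping.single w (c * a)"
  and single_mult_scalar: "Poly_Mapping.single w a * scalar c = Poly_Mapping.single w (c * a)"
  for w :: "'k :: monoid_add"
  by (simp_all add: scalar_def mult_single mult.commute)

lemma lookup_scalar_mult:
  fixes p :: "('k :: monoid_add) \<Rightarrow>\<^sub>0 complex"
  shows "Poly_Mapping.lookup (scalar c * p) w = c * Poly_Mapping.lookup p w"
  by (rule poly_mapping_induct_single[of _ p])
    (auto simp: scalar_mult_single lookup_single when_def distrib_left lookup_add)

lemma scalar_commute:
  fixes p :: "('k :: monoid_add) \<Rightarrow>\<^sub>0 complex"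
  shows "p * scalar c = scalar c * p"
  by (rule poly_mapping_induct_single[of _ p])
    (auto simp: scalar_mult_single single_mult_scalar distrib_left distrib_right)

lemma mult_scalar_left_commute:
  fixes p :: "('k :: monoid_add) \<Rightarrow>\<^sub>0 complex"
  shows "p * (scalar c * r) = scalar c * (p * r)"
  by (metis mult.assoc scalar_commute)

lemma scalar_simps [simp]:
  "scalar 0 = 0" "scalar 1 = 1" "scalar (a + b) = scalar a + scalar b"
  "scalar (a - b) = scalar a - scalar b" "scalar (- a) = - scalar a"
  by (simp_all add: scalar_def single_add single_diff single_uminus)

lemma scalar_mult: "scalar (a * b) = scalar a * (scalar b :: ('k :: monoid_add) \<Rightarrow>\<^sub>0 complex)"
  by (simp add: scalar_def mult_single)

interpretation poly_space: vector_space "\<lambda>c (p :: ('k :: monoid_add) \<Rightarrow>\<^sub>0 complex). scalar c * p"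
  by unfold_locales (simp_all add: algebra_simps scalar_mult)

definition linear_extension :: "('k \<Rightarrow> complex) \<Rightarrow> ('k \<Rightarrow>\<^sub>0 complex) \<Rightarrow> complex" where
  "linear_extension g p = (\<Sum>w\<in>Poly_Mapping.keys p. Poly_Mapping.lookup p w * g w)"

lemma linear_extension_superset:
  assumes "finite A" "Poly_Mapping.keys p \<subseteq> A"
  shows "linear_extension g p = (\<Sum>w\<in>A. Poly_Mapping.lookup p w * g w)"
  unfolding linear_extension_def using assms
  by (intro sum.mono_neutral_left) (auto simp: in_keys_iff)

lemma linear_extension_zero [simp]: "linear_extension g 0 = 0"
  by (simp add: linear_extension_def)

lemma linear_extension_single [simp]: "linear_extension g (Poly_Mapping.single w c) = c * g w"
  by (simp add: linear_extension_def)

lemma linear_extension_add [simp]: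
  "linear_extension g (p + p') = linear_extension g p + linear_extension g p'"
proof -
  let ?A = "Poly_Mapping.keys p \<union> Poly_Mapping.keys p'"
  have "linear_extension g (p + p') = (\<Sum>w\<in>?A. Poly_Mapping.lookup (p + p') w * g w)"
    by (rule linear_extension_superset) (auto simp: keys_add)
  also have "\<dots> = (\<Sum>w\<in>?A. Poly_Mapping.lookup p w * g w) + (\<Sum>w\<in>?A. Poly_Mapping.lookup p' w * g w)"
    by (simp add: lookup_add distrib_right sum.distrib)
  also have "\<dots> = linear_extension g p + linear_extension g p'"
    by (subst (1 2) linear_extension_superset[where A = ?A]) auto
  finally show ?thesis .
qed

lemma linear_extension_scalar [simp]:
  fixes p :: "('k :: monoid_add) \<Rightarrow>\<^sub>0 complex"
  shows "linear_extension g (scalar c * p) = c * linear_extension g p"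
proof -
  have "Poly_Mapping.keys (scalar c * p) \<subseteq> Poly_Mapping.keys p"
    by (auto simp: in_keys_iff lookup_scalar_mult)
  then have "linear_extension g (scalar c * p)
      = (\<Sum>w\<in>Poly_Mapping.keys p. Poly_Mapping.lookup (scalar c * p) w * g w)"
    by (intro linear_extension_superset) auto
  then show ?thesis
    by (simp add: linear_extension_def lookup_scalar_mult sum_distrib_left mult.assoc)
qed

lemma linear_extension_uminus [simp]: "linear_extension g (- p) = - linear_extension g p"
  using linear_extension_add[of g p "- p"] by (simp add: eq_neg_iff_add_eq_0 add.commute del: linear_extension_add)

lemma linear_extension_diff [simp]:
  "linear_extension g (p - p') = linear_extension g p - linear_extension g p'"
  using linear_extension_add[of g p "- p'"] by simp

abbreviation polys :: "'g set \<Rightarrow> 'g ncpoly set" where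
  "polys S \<equiv> carrier (free_algebra S)"

lemma polys_iff: "p \<in> polys S \<longleftrightarrow> (\<forall>w\<in>Poly_Mapping.keys p. set (letters w) \<subseteq> S)"
  by (simp add: free_algebra_def)

lemma free_algebra_simps [simp]:
  "mult (free_algebra S) = (*)" "one (free_algebra S) = 1" "zero (free_algebra S) = 0"
  "add (free_algebra S) = (+)" "smult (free_algebra S) = (\<lambda>c p. scalar c * p)"
  by (simp_all add: free_algebra_def)

lemma letters_plus [simp]: "letters (v + w) = letters v @ letters w"
  and letters_zero [simp]: "letters 0 = []"
  by (simp_all add: plus_free_word_def zero_free_word_def)

lemma polys_single: "set (letters w) \<subseteq> S \<Longrightarrow> Poly_Mapping.single w c \<in> polys S"
  by (simp add: polys_iff)

lemma polys_closed [simp, intro]: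
  "0 \<in> polys S" "1 \<in> polys S" "scalar c \<in> polys S"
  "g \<in> S \<Longrightarrow> indet g \<in> polys S"
  "\<lbrakk>p \<in> polys S; p' \<in> polys S\<rbrakk> \<Longrightarrow> p + p' \<in> polys S"
  "\<lbrakk>p \<in> polys S; p' \<in> polys S\<rbrakk> \<Longrightarrow> p * p' \<in> polys S"
  "p \<in> polys S \<Longrightarrow> - p \<in> polys S"
  "\<lbrakk>p \<in> polys S; p' \<in> polys S\<rbrakk> \<Longrightarrow> p - p' \<in> polys S"
proof -
  show add: "p + p' \<in> polys S" if "p \<in> polys S" "p' \<in> polys S" for p p' :: "'a ncpoly"
    using that keys_add[of p p'] unfolding polys_iff by blast
  show uminus: "- p \<in> polys S" if "p \<in> polys S" for p :: "'a ncpoly"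
    using that unfolding polys_iff by (simp add: in_keys_iff)
  show "p - p' \<in> polys S" if "p \<in> polys S" "p' \<in> polys S" for p p' :: "'a ncpoly"
    using add[OF that(1) uminus[OF that(2)]] by simp
  show "p * p' \<in> polys S" if "p \<in> polys S" "p' \<in> polys S" for p p' :: "'a ncpoly"
  proof -
    have "set (letters w) \<subseteq> S" if w: "w \<in> Poly_Mapping.keys (p * p')" for w
    proof -
      obtain a b where "w = a + b" "a \<in> Poly_Mapping.keys p" "b \<in> Poly_Mapping.keys p'"
        using keys_mult[of p p'] w by blast
      then show ?thesis using \<open>p \<in> polys S\<close> \<open>p' \<in> polys S\<close> unfolding polys_iff by auto
    qed
    then show ?thesis by (simp add: polys_iff)
  qed
qed (auto simp: polys_iff scalar_def indet_def)

lemma polys_sum: "(\<And>i. i \<in> A \<Longrightarrow> f i \<in> polys S) \<Longrightarrow> (\<Sum>i\<in>A. f i) \<in> polys S"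
  by (induction A rule: infinite_finite_induct) auto

lemma polys_prod_list: "(\<And>p. p \<in> set ps \<Longrightarrow> p \<in> polys S) \<Longrightarrow> prod_list ps \<in> polys S"
  by (induction ps) auto

lemma polys_induct [consumes 1, case_names zero single add]:
  assumes "p \<in> polys S"
    and "P 0"
    and "\<And>w c. set (letters w) \<subseteq> S \<Longrightarrow> P (Poly_Mapping.single w c)"
    and "\<And>p q. \<lbrakk>P p; P q\<rbrakk> \<Longrightarrow> P (p + q)"
  shows "P p"
  by (rule poly_mapping_induct_single) (use assms in \<open>auto simp: polys_iff\<close>)

lemma complex_algebra_free: "complex_algebra (free_algebra S)"
proof -
  have group: "abelian_group (free_algebra S)"
  proof (rule abelian_groupI)
    fix p assume "p \<in> polys S"
    then show "\<exists>p'\<in>polys S. p' \<oplus>\<^bsub>free_algebra S\<^esub> p = \<zero>\<^bsub>free_algebra S\<^esub>"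
      by (intro bexI[of _ "- p"]) auto
  qed (auto simp: algebra_simps)
  have "ring (free_algebra S)"
    by (rule ringI[OF group]) (auto intro!: monoidI simp: algebra_simps)
  moreover have "Module.module (class_ring :: complex ring) (free_algebra S)"
  proof (rule moduleI[OF _ group])
    show "cring (class_ring :: complex ring)" ..
  qed (simp_all add: distrib_left distrib_right)
  ultimately show ?thesis
    by (intro complex_algebra.intro complex_algebra_axioms.intro)
      (simp_all add: mult.assoc[symmetric] scalar_commute del: poly_space.scale_scale)
qed

lemma free_a_inv:
  assumes "p \<in> polys S" shows "\<ominus>\<^bsub>free_algebra S\<^esub> p = - p"
proof -
  interpret complex_algebra "free_algebra S" by (rule complex_algebra_free)
  show ?thesis using assms by (intro minus_equality) auto
qed

lemma free_a_minus:
  "\<lbrakk>p \<in> polys S; p' \<in> polys S\<rbrakk> \<Longrightarrow> p \<ominus>\<^bsub>free_algebra S\<^esub> p' = p - p'"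
  by (simp add: a_minus_def free_a_inv)

lemma idealI_free:
  assumes "J \<subseteq> polys S" "0 \<in> J" "\<And>p p'. \<lbrakk>p \<in> J; p' \<in> J\<rbrakk> \<Longrightarrow> p + p' \<in> J"
    and "\<And>p r. \<lbrakk>p \<in> J; r \<in> polys S\<rbrakk> \<Longrightarrow> r * p \<in> J"
    and "\<And>p r. \<lbrakk>p \<in> J; r \<in> polys S\<rbrakk> \<Longrightarrow> p * r \<in> J"
  shows "ideal J (free_algebra S)"
proof -
  interpret complex_algebra "free_algebra S" by (rule complex_algebra_free)
  show ?thesis
  proof (rule idealI)
    show "ring (free_algebra S)" ..
    show "subgroup J (add_monoid (free_algebra S))"
    proof (rule group.subgroupI[OF abelian_group.a_group])
      show "abelian_group (free_algebra S)" ..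
      fix p assume p: "p \<in> J"
      then have "p \<in> polys S" using assms(1) by blast
      then have "inv\<^bsub>add_monoid (free_algebra S)\<^esub> p = - p"
        by (rule free_a_inv[unfolded a_inv_def])
      moreover have "- p \<in> J" using assms(4)[OF p, of "- 1"] by simp
      ultimately show "inv\<^bsub>add_monoid (free_algebra S)\<^esub> p \<in> J" by (simp only:)
    qed (use assms in auto)
  qed (use assms in auto)
qed

section \<open>Actions of the Drinfeld--Jimbo algebra on functions\<close>

text \<open>
  Representations are built from operators on functions and only afterwards turned into matrices,
  because an identity between such operators can be checked pointwise.  A word acts by the composite of
  its letters, the rightmost letter first.
\<close>
definition evaluate ::
    "('g \<Rightarrow> ('i \<Rightarrow> complex) \<Rightarrow> 'i \<Rightarrow> complex) \<Rightarrow> 'g ncpoly \<Rightarrow> ('i \<Rightarrow> complex) \<Rightarrow> 'i \<Rightarrow> complex" where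
  "evaluate G p f x = linear_extension (\<lambda>w. foldr G (letters w) f x) p"

lemma evaluate_add: "evaluate G (p + p') f = (\<lambda>x. evaluate G p f x + evaluate G p' f x)"
  and evaluate_diff: "evaluate G (p - p') f = (\<lambda>x. evaluate G p f x - evaluate G p' f x)"
  and evaluate_zero: "evaluate G 0 f = (\<lambda>x. 0)"
  and evaluate_indet: "evaluate G (indet g) f = G g f"
  and evaluate_one: "evaluate G 1 f = f"
  and evaluate_single: "evaluate G (Poly_Mapping.single w c) f = (\<lambda>x. c * foldr G (letters w) f x)"
  and evaluate_scalar_mult: "evaluate G (scalar c * p) f = (\<lambda>x. c * evaluate G p f x)"
  by (auto simp: evaluate_def indet_def simp flip: single_one)

lemma evaluate_scalar: "evaluate G (scalar c) f = (\<lambda>x. c * f x)"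
  using evaluate_scalar_mult[of G c 1 f] by (simp add: evaluate_one)

definition delta :: "'i \<Rightarrow> 'i \<Rightarrow> complex" where
  "delta y x = (if x = y then 1 else 0)"

definition linear_operator :: "(('i \<Rightarrow> complex) \<Rightarrow> 'j \<Rightarrow> complex) \<Rightarrow> bool" where
  "linear_operator T \<longleftrightarrow> (\<forall>f f'. T (\<lambda>x. f x + f' x) = (\<lambda>x. T f x + T f' x)) \<and>
     (\<forall>c f. T (\<lambda>x. c * f x) = (\<lambda>x. c * T f x))"

lemma linear_operatorD:
  assumes "linear_operator T"
  shows "T (\<lambda>x. f x + f' x) = (\<lambda>x. T f x + T f' x)"
    and "T (\<lambda>x. c * f x) = (\<lambda>x. c * T f x)"
    and "T (\<lambda>x. 0) = (\<lambda>x. 0)"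
proof -
  show "T (\<lambda>x. f x + f' x) = (\<lambda>x. T f x + T f' x)" "T (\<lambda>x. c * f x) = (\<lambda>x. c * T f x)" for c
    using assms by (auto simp: linear_operator_def)
  from this(2)[of 0] show "T (\<lambda>x. 0) = (\<lambda>x. 0)" by simp
qed

lemma linear_operator_sum:
  assumes "linear_operator T"
  shows "T (\<lambda>x. \<Sum>i\<in>A. f i x) = (\<lambda>x. \<Sum>i\<in>A. T (f i) x)"
  by (induction A rule: infinite_finite_induct) (auto simp: linear_operatorD[OF assms])

lemma linear_operator_expand:
  assumes "linear_operator T" "finite A" "\<And>x. x \<notin> A \<Longrightarrow> f x = 0"
  shows "T f x = (\<Sum>y\<in>A. f y * T (delta y) x)"
proof -
  have "f = (\<lambda>x. \<Sum>y\<in>A. f y * delta y x)"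
    using assms(2,3) by (auto simp: delta_def fun_eq_iff sum.delta' if_distrib cong: if_cong)
  then have "T f = T (\<lambda>x. \<Sum>y\<in>A. f y * delta y x)" by simp
  then show ?thesis
    by (simp add: linear_operator_sum[OF assms(1)] linear_operatorD(2)[OF assms(1)])
qed

definition operator_mat :: "'i list \<Rightarrow> (('i \<Rightarrow> complex) \<Rightarrow> 'i \<Rightarrow> complex) \<Rightarrow> complex mat" where
  "operator_mat I T = mat (length I) (length I) (\<lambda>(r, s). T (delta (I ! s)) (I ! r))"

lemma operator_mat_carrier [simp]: "operator_mat I T \<in> carrier_mat (length I) (length I)"
  by (simp add: operator_mat_def)

text \<open>
  The support condition on \<open>T'\<close> says that the functions supported on \<open>I\<close> are invariant; without it the
  matrix product would miss intermediate points outside \<open>I\<close>.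
\<close>
lemma operator_mat_comp:
  assumes "linear_operator T" "distinct I"
    and "\<And>x y. \<lbrakk>y \<in> set I; x \<notin> set I\<rbrakk> \<Longrightarrow> T' (delta y) x = 0"
  shows "operator_mat I (\<lambda>f. T (T' f)) = operator_mat I T * operator_mat I T'"
proof (rule eq_matI)
  fix r s assume "r < dim_row (operator_mat I T * operator_mat I T')"
    and "s < dim_col (operator_mat I T * operator_mat I T')"
  then have rs: "r < length I" "s < length I" by (simp_all add: operator_mat_def)
  have "T (T' (delta (I ! s))) (I ! r) = (\<Sum>y\<in>set I. T' (delta (I ! s)) y * T (delta y) (I ! r))"
    using rs assms by (intro linear_operator_expand) auto
  also have "\<dots> = (\<Sum>t = 0..<length I. T' (delta (I ! s)) (I ! t) * T (delta (I ! t)) (I ! r))"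
    using bij_betw_nth[OF assms(2) refl refl]
    by (simp add: sum.reindex_bij_betw[of "(!) I" "{..<length I}" "set I", symmetric] atLeast0LessThan)
  finally show "operator_mat I (\<lambda>f. T (T' f)) $$ (r, s) = (operator_mat I T * operator_mat I T') $$ (r, s)"
    using rs by (simp add: operator_mat_def scalar_prod_def mult.commute)
qed (simp_all add: operator_mat_def)

locale linear_action =
  fixes G :: "'g \<Rightarrow> ('i \<Rightarrow> complex) \<Rightarrow> 'i \<Rightarrow> complex"
  assumes linear_gen: "linear_operator (G g)"
begin

lemma linear_foldr: "linear_operator (foldr G gs)"
  by (induction gs)
    (auto simp: linear_operator_def linear_operatorD(1,2)[OF linear_gen])

lemma linear_evaluate: "linear_operator (evaluate G p)"
  unfolding linear_operator_def evaluate_def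
  by (rule poly_mapping_induct_single[of _ p])
    (auto simp: fun_eq_iff linear_operatorD(1,2)[OF linear_foldr] algebra_simps)

text \<open>
  Both sides are linear in \<open>p\<close> and in \<open>p'\<close>, and for words the claim is that \<open>foldr\<close> turns
  concatenation into composition.
\<close>
lemma evaluate_mult: "evaluate G (p * p') f = evaluate G p (evaluate G p' f)"
proof -
  have *: "evaluate G (Poly_Mapping.single w c * p') f = evaluate G (Poly_Mapping.single w c) (evaluate G p' f)"
    for w c
    by (rule poly_mapping_induct_single[of _ p'])
      (simp_all add: evaluate_zero evaluate_add evaluate_single mult_single distrib_left
        linear_operatorD[OF linear_foldr] fun_eq_iff)
  show ?thesis
    by (rule poly_mapping_induct_single[of _ p])
      (simp_all add: * evaluate_zero evaluate_add distrib_right)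
qed

lemmas evaluate_simps = evaluate_mult evaluate_add evaluate_diff evaluate_zero evaluate_indet
  evaluate_one evaluate_scalar

end

lemma uq_algebra_quotient: "algebra_quotient (free_algebra (uq_gens n)) (uq_ideal n q)"
  and uq_relations_subset_ideal: "uq_relations n q \<subseteq> uq_ideal n q"
proof -
  have ring_free: "ring (free_algebra (uq_gens n))"
    by (rule complex_algebra.axioms(1)[OF complex_algebra_free])
  have "g i \<in> uq_gens n" if "i \<in> {1..n}" "g = gE \<or> g = gF \<or> g = gK \<or> g = gKinv" for g i
    using that by (auto simp: uq_gens_def)
  then have sub: "uq_relations n q \<subseteq> polys (uq_gens n)"
    unfolding uq_relations_def serre_def by auto
  have "ideal (uq_ideal n q) (free_algebra (uq_gens n))"
    unfolding uq_ideal_def by (rule ring.genideal_ideal[OF ring_free sub])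
  then show "algebra_quotient (free_algebra (uq_gens n)) (uq_ideal n q)"
    by (intro algebra_quotient.intro complex_algebra_free)
  show "uq_relations n q \<subseteq> uq_ideal n q"
    unfolding uq_ideal_def by (rule ring.genideal_self[OF ring_free sub])
qed

interpretation uq: algebra_quotient "free_algebra (uq_gens n)" "uq_ideal n q"
  rewrites "quot_alg (free_algebra (uq_gens n)) (uq_ideal n q) = Uq n q"
    and "uq_ideal n q +>\<^bsub>free_algebra (uq_gens n)\<^esub> p = uq_class n q p"
  for n q
  by (rule uq_algebra_quotient) (simp_all add: Uq_def uq_class_def)

text \<open>
  Whatever representative of a class is chosen, it differs from a given one by an element of the ideal.
\<close>
lemma uq_class_some:
  assumes "p \<in> polys (uq_gens n)"
  shows "(SOME p'. p' \<in> uq_class n q p) \<in> polys (uq_gens n)"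
    and "(SOME p'. p' \<in> uq_class n q p) - p \<in> uq_ideal n q"
proof -
  have "p \<in> uq_class n q p" using assms by (rule uq.Q.coset_self)
  then have *: "(SOME p'. p' \<in> uq_class n q p) \<in> uq_class n q p" by (rule someI)
  show c: "(SOME p'. p' \<in> uq_class n q p) \<in> polys (uq_gens n)"
    using uq.Q.in_cosetD(1)[OF assms *] .
  show "(SOME p'. p' \<in> uq_class n q p) - p \<in> uq_ideal n q"
    using uq.Q.in_cosetD(2)[OF assms *] free_a_minus[OF c assms] by simp
qed

text \<open>
  The functions supported on \<open>I\<close> form the finite-dimensional representation.  The relations are
  required on all functions, so that they can be verified without reference to \<open>I\<close>.
\<close>
locale uq_action = linear_action G for G :: "uq_gen \<Rightarrow> ('i \<Rightarrow> complex) \<Rightarrow> 'i \<Rightarrow> complex" +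
  fixes n :: nat and q :: real and I :: "'i list"
  assumes distinct_I: "distinct I"
    and supported_gen: "\<lbrakk>g \<in> uq_gens n; \<And>y. y \<notin> set I \<Longrightarrow> f y = 0; x \<notin> set I\<rbrakk> \<Longrightarrow> G g f x = 0"
    and kills_relations: "r \<in> uq_relations n q \<Longrightarrow> evaluate G r f = (\<lambda>x. 0)"
    and K_diagonal: "i \<in> {1..n} \<Longrightarrow> \<exists>wt :: 'i \<Rightarrow> int. \<forall>f x. G (gK i) f x = of_real (q powi wt x) * f x"
begin

lemma kills_ideal:
  assumes "p \<in> uq_ideal n q" shows "evaluate G p f = (\<lambda>x. 0)"
proof -
  let ?J = "{p \<in> polys (uq_gens n). \<forall>f. evaluate G p f = (\<lambda>x. 0)}"
  have "ideal ?J (free_algebra (uq_gens n))"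
    by (rule idealI_free)
      (auto simp: evaluate_simps linear_operatorD[OF linear_evaluate])
  moreover have "uq_relations n q \<subseteq> ?J"
    using uq_relations_subset_ideal uq.Q.N_subset kills_relations by blast
  ultimately have "uq_ideal n q \<subseteq> ?J"
    unfolding uq_ideal_def
    by (intro ring.genideal_minimal complex_algebra.axioms(1)[OF complex_algebra_free])
  then show ?thesis using assms by blast
qed

lemma supported_evaluate:
  assumes "p \<in> polys (uq_gens n)" "\<And>y. y \<notin> set I \<Longrightarrow> f y = 0" "x \<notin> set I"
  shows "evaluate G p f x = 0"
  using assms(1)
proof (induction p rule: polys_induct)
  case (single w c)
  have "\<forall>x. x \<notin> set I \<longrightarrow> foldr G gs f x = 0" if "set gs \<subseteq> uq_gens n" for gs
    using that by (induction gs) (auto intro!: supported_gen assms(2))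
  from this[OF single] show ?case using assms(3) by (simp add: evaluate_single)
qed (auto simp: evaluate_zero evaluate_add)

definition act :: "uq \<Rightarrow> ('i \<Rightarrow> complex) \<Rightarrow> 'i \<Rightarrow> complex" where
  "act X = evaluate G (SOME p. p \<in> X)"

lemma act_class:
  assumes "p \<in> polys (uq_gens n)" shows "act (uq_class n q p) = evaluate G p"
proof
  fix f
  have "evaluate G ((SOME p'. p' \<in> uq_class n q p) - p) f = (\<lambda>x. 0)"
    by (rule kills_ideal[OF uq_class_some(2)[OF assms]])
  then show "act (uq_class n q p) f = evaluate G p f"
    by (simp add: act_def evaluate_diff fun_eq_iff)
qed

lemma linear_act: "linear_operator (act X)"
  unfolding act_def by (rule linear_evaluate)

lemma act_supported:
  assumes "X \<in> carrier (Uq n q)" "\<And>y. y \<notin> set I \<Longrightarrow> f y = 0" "x \<notin> set I"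
  shows "act X f x = 0"
proof -
  obtain p where "p \<in> polys (uq_gens n)" "X = uq_class n q p"
    using assms(1) by (auto simp: uq.Q.quot_carrier)
  then show ?thesis using supported_evaluate[of p f x] assms(2,3) by (simp add: act_class)
qed

lemma act_mult:
  "\<lbrakk>X \<in> carrier (Uq n q); Y \<in> carrier (Uq n q)\<rbrakk> \<Longrightarrow> act (X \<otimes>\<^bsub>Uq n q\<^esub> Y) f = act X (act Y f)"
  and act_add:
  "\<lbrakk>X \<in> carrier (Uq n q); Y \<in> carrier (Uq n q)\<rbrakk> \<Longrightarrow> act (X \<oplus>\<^bsub>Uq n q\<^esub> Y) f = (\<lambda>x. act X f x + act Y f x)"
  and act_smult: "X \<in> carrier (Uq n q) \<Longrightarrow> act (c \<odot>\<^bsub>Uq n q\<^esub> X) f = (\<lambda>x. c * act X f x)"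
  and act_one: "act \<one>\<^bsub>Uq n q\<^esub> f = f"
  by (auto simp: uq.Q.quot_carrier act_class uq.quot_mult uq.Q.quot_add uq.Q.quot_smult uq.quot_one
      evaluate_simps)

definition rep :: "uq \<Rightarrow> complex mat" where
  "rep X = operator_mat I (act X)"

lemma type1_rep_rep: "type1_rep n q (length I) rep"
  unfolding type1_rep_def
proof (intro conjI IntI)
  show "rep \<in> Ring.ring_hom (Uq n q) (module_mat TYPE(complex) (length I) (length I))"
  proof (rule ring_hom_memI)
    fix X Y assume XY: "X \<in> carrier (Uq n q)" "Y \<in> carrier (Uq n q)"
    have "act (X \<otimes>\<^bsub>Uq n q\<^esub> Y) = (\<lambda>f. act X (act Y f))"
      using XY by (simp add: fun_eq_iff act_mult)
    then show "rep (X \<otimes>\<^bsub>Uq n q\<^esub> Y) = rep X \<otimes>\<^bsub>module_mat TYPE(complex) (length I) (length I)\<^esub> rep Y"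
      unfolding rep_def using XY
      by (simp add: module_mat_simps, intro operator_mat_comp linear_act distinct_I)
        (auto intro!: act_supported simp: delta_def)
    show "rep (X \<oplus>\<^bsub>Uq n q\<^esub> Y) = rep X \<oplus>\<^bsub>module_mat TYPE(complex) (length I) (length I)\<^esub> rep Y"
      unfolding rep_def using XY
      by (auto simp: module_mat_simps operator_mat_def act_add intro!: eq_matI)
  next
    show "rep \<one>\<^bsub>Uq n q\<^esub> = \<one>\<^bsub>module_mat TYPE(complex) (length I) (length I)\<^esub>"
      unfolding rep_def using distinct_I
      by (auto simp: module_mat_simps operator_mat_def act_one delta_def nth_eq_iff_index_eq intro!: eq_matI)
  qed (simp add: rep_def module_mat_simps)
  show "rep \<in> LinearCombinations.module_hom class_ring (Uq n q) (module_mat TYPE(complex) (length I) (length I))"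
    unfolding LinearCombinations.module_hom_def
    by (auto simp: rep_def module_mat_simps operator_mat_def act_add act_smult intro!: eq_matI)
  show "\<exists>P Q. \<forall>i\<in>{1..n}. \<exists>wt :: nat \<Rightarrow> int.
        similar_mat_wit (rep (uq_class n q (indet (gK i))))
          (mat_diag (length I) (\<lambda>a. of_real (q powi wt a))) P Q"
  \<comment> \<open>The basis of point functions is already a weight basis.\<close>
  proof (rule exI[of _ "1\<^sub>m (length I)"], rule exI[of _ "1\<^sub>m (length I)"], rule ballI)
    fix i assume i: "i \<in> {1..n}"
    then obtain wt :: "'i \<Rightarrow> int" where wt: "\<And>f x. G (gK i) f x = of_real (q powi wt x) * f x"
      using K_diagonal by blast
    have "gK i \<in> uq_gens n" using i by (simp add: uq_gens_def)
    then have "act (uq_class n q (indet (gK i))) = G (gK i)"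
      by (simp add: act_class evaluate_indet fun_eq_iff)
    then have "rep (uq_class n q (indet (gK i))) =
        mat_diag (length I) (\<lambda>a. of_real (q powi wt (I ! a)))"
      unfolding rep_def using distinct_I
      by (auto simp: operator_mat_def mat_diag_def wt delta_def nth_eq_iff_index_eq intro!: eq_matI)
    then show "\<exists>wt :: nat \<Rightarrow> int. similar_mat_wit (rep (uq_class n q (indet (gK i))))
          (mat_diag (length I) (\<lambda>a. of_real (q powi wt a))) (1\<^sub>m (length I)) (1\<^sub>m (length I))"
      by (intro exI[of _ "\<lambda>a. wt (I ! a)"]) (simp add: similar_mat_wit_refl)
  qed
qed

definition coeff :: "'i \<Rightarrow> 'i \<Rightarrow> uq \<Rightarrow> complex" where
  "coeff x y X = (if X \<in> carrier (Uq n q) then act X (delta y) x else 0)"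

lemma coeff_in_Oq:
  assumes "x \<in> set I" "y \<in> set I"
  shows "coeff x y \<in> carrier (Oq n q)"
proof -
  obtain r s where rs: "r < length I" "s < length I" "I ! r = x" "I ! s = y"
    using assms by (auto simp: in_set_conv_nth)
  have "coeff x y = matrix_coeff n q rep (unit_vec (length I) r) (unit_vec (length I) s)"
    using rs by (auto simp: fun_eq_iff coeff_def matrix_coeff_def rep_def operator_mat_def
        scalar_prod_left_unit mult_mat_vec_def row_def scalar_prod_right_unit)
  then show ?thesis
    unfolding Oq_def Oq_carrier_def using type1_rep_rep by fastforce
qed

end

section \<open>The trivial action and the square of the vector representation\<close>

definition trivial_action :: "uq_gen \<Rightarrow> (unit \<Rightarrow> complex) \<Rightarrow> unit \<Rightarrow> complex" where
  "trivial_action g f = (\<lambda>x. gen_counit g * f x)"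

lemma linear_trivial: "linear_action trivial_action"
  by unfold_locales (auto simp: linear_operator_def trivial_action_def algebra_simps)

lemma trivial_uq_action: "uq_action trivial_action n q [()]"
proof -
  interpret linear_action trivial_action by (rule linear_trivial)
  show ?thesis
  proof unfold_locales
    fix r :: "uq_gen ncpoly" and f assume "r \<in> uq_relations n q"
    then show "evaluate trivial_action r f = (\<lambda>x. 0)"
      by (auto simp: uq_relations_def serre_def evaluate_simps trivial_action_def)
  next
    fix i assume "i \<in> {1..n}"
    show "\<exists>wt. \<forall>f x. trivial_action (gK i) f x = of_real (q powi wt x) * f x"
      by (rule exI[of _ "\<lambda>_. 0"]) (simp add: trivial_action_def)
  qed auto
qed

text \<open>
  The eigenvalue of \<open>gK i\<close> on the basis vector \<open>v a\<close> of the vector representation, in which \<open>gE i\<close> maps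
  \<open>v i\<close> to \<open>v (Suc i)\<close>.
\<close>
definition weight_factor :: "real \<Rightarrow> nat \<Rightarrow> nat \<Rightarrow> complex" where
  "weight_factor q i a = (if a = Suc i then of_real q else if a = i then inverse (of_real q) else 1)"

text \<open>
  A function \<open>f\<close> stands for the tensor \<open>\<Sum> f (a, c) v a \<otimes> v c\<close>, and a generator acts through its coproduct.
  The indices range over all natural numbers, which avoids boundary cases in the verification of the
  relations.
\<close>
fun square_action :: "real \<Rightarrow> uq_gen \<Rightarrow> (nat \<times> nat \<Rightarrow> complex) \<Rightarrow> nat \<times> nat \<Rightarrow> complex" where
  "square_action q (gE i) f (a, c) =
     (if a = Suc i then weight_factor q i c * f (i, c) else 0) + (if c = Suc i then f (a, i) else 0)"
| "square_action q (gF i) f (a, c) =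
     (if a = i then f (Suc i, c) else 0) +
     (if c = i then inverse (weight_factor q i a) * f (a, Suc i) else 0)"
| "square_action q (gK i) f (a, c) = weight_factor q i a * weight_factor q i c * f (a, c)"
| "square_action q (gKinv i) f (a, c) =
     inverse (weight_factor q i a) * inverse (weight_factor q i c) * f (a, c)"

lemma linear_square: "linear_action (square_action q)"
proof
  fix g show "linear_operator (square_action q g)"
    by (cases g) (auto simp: linear_operator_def fun_eq_iff algebra_simps)
qed

definition square_index :: "nat \<Rightarrow> (nat \<times> nat) list" where
  "square_index n = List.product [1..<n + 2] [1..<n + 2]"

lemma set_square_index: "set (square_index n) = {1..n + 1} \<times> {1..n + 1}"
  by (auto simp: square_index_def)

context
  fixes q :: real
  assumes q: "q \<noteq> 0" "q \<noteq> 1" "q \<noteq> -1"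
begin

interpretation linear_action "square_action q" by (rule linear_square)

text \<open>
  For \<open>i = j\<close> the commutator and its prescribed value are diagonal.  The least immediate entries are those
  where both legs are \<open>v i\<close> or both are \<open>v (Suc i)\<close>: up to sign, they amount to
  \<open>(q^2 - q^-2) / (q - q^-1) = q + q^-1\<close>.
\<close>
lemma square_EF:
  "evaluate (square_action q) (indet (gE i) * indet (gF j) - indet (gF j) * indet (gE i)
     - (if i = j
        then scalar (of_real (inverse (q - inverse q))) * (indet (gK i) - indet (gKinv i))
        else 0)) f = (\<lambda>x. 0)"
proof
  fix x :: "nat \<times> nat" obtain a c where x: "x = (a, c)" by (cases x)
  define Q R D where "Q = complex_of_real q" "R = complex_of_real (inverse q)"
    "D = complex_of_real (inverse (q - inverse q))"
  have "q - inverse q \<noteq> 0"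
    using q by (metis eq_iff_diff_eq_0 right_inverse square_eq_1_iff)
  then have "inverse (q - inverse q) * (q - inverse q) = 1" by simp
  then have D: "D * (Q - R) = 1" by (metis Q_R_D_def of_real_1 of_real_diff of_real_mult)
  have QR: "Q * R = 1" "R * Q = 1" using q by (simp_all add: Q_R_D_def flip: of_real_mult)
  have DQQ: "D * (Q * Q - R * R) = Q + R"
  proof -
    have "D * (Q * Q - R * R) = (D * (Q - R)) * (Q + R)" by (simp add: algebra_simps)
    then show ?thesis by (simp add: D)
  qed
  have DZ: "D * (Q * z - R * z) = z" "D * (R * z - Q * z) = - z"
      "D * (Q * Q * z - R * R * z) = Q * z + R * z" "D * (R * R * z - Q * Q * z) = - (Q * z + R * z)" for z
    using D DQQ by (metis (no_types, opaque_lifting) left_diff_distrib distrib_right mult.assoc mult_1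
        minus_diff_eq mult_minus_right mult_minus_left)+
  have QRz: "Q * (R * z) = z" "R * (Q * z) = z" for z using QR by (metis mult.assoc mult_1)+
  have wf: "weight_factor q i b = (if b = Suc i then Q else if b = i then R else 1)"
     "inverse Q = R" "inverse R = Q" for b i
    using q by (simp_all add: weight_factor_def Q_R_D_def)
  show "evaluate (square_action q) (indet (gE i) * indet (gF j) - indet (gF j) * indet (gE i)
     - (if i = j
        then scalar (of_real (inverse (q - inverse q))) * (indet (gK i) - indet (gKinv i))
        else 0)) f x = 0"
  proof (cases "i = j")
    case True
    then show ?thesis
      unfolding x Q_R_D_def(3)[symmetric]
      by (cases "a = i"; cases "a = Suc i"; cases "c = i"; cases "c = Suc i")
        (simp_all add: evaluate_simps wf QR QRz DZ distrib_left)
  next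
    case False
    then show ?thesis
      by (auto simp: x evaluate_simps weight_factor_def)
  qed
qed

lemma square_KE:
  "evaluate (square_action q) (indet (gK i) * indet (gE j)
     - scalar (of_real (q powi cartan i j)) * indet (gE j) * indet (gK i)) f = (\<lambda>x. 0)"
  and square_KF:
  "evaluate (square_action q) (indet (gK i) * indet (gF j)
     - scalar (of_real (q powi (- cartan i j))) * indet (gF j) * indet (gK i)) f = (\<lambda>x. 0)"
proof -
  define Q where "Q = complex_of_real q"
  have Q: "Q \<noteq> 0" using q by (simp add: Q_def)
  have shift: "weight_factor q i (Suc j) = of_real (q powi cartan i j) * weight_factor q i j"
    using q by (auto simp: weight_factor_def cartan_def power_int_minus power2_eq_square)
  have shift': "weight_factor q i j = of_real (q powi (- cartan i j)) * weight_factor q i (Suc j)"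
    using q by (simp add: shift power_int_minus)
  show "evaluate (square_action q) (indet (gK i) * indet (gE j)
     - scalar (of_real (q powi cartan i j)) * indet (gE j) * indet (gK i)) f = (\<lambda>x. 0)"
    by (auto simp: fun_eq_iff evaluate_simps shift algebra_simps)
  show "evaluate (square_action q) (indet (gK i) * indet (gF j)
     - scalar (of_real (q powi (- cartan i j))) * indet (gF j) * indet (gK i)) f = (\<lambda>x. 0)"
    by (auto simp: fun_eq_iff evaluate_simps shift' algebra_simps)
qed

lemma consecutive_cases:
  obtains "a = k" | "a = Suc k" | "a = Suc (Suc k)" | "a \<noteq> k" "a \<noteq> Suc k" "a \<noteq> Suc (Suc k)"
  by blast

text \<open>
  With \<open>k\<close> the smaller of the two indices, the generators involve only the basis vectors \<open>v k\<close>,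
  \<open>v (k + 1)\<close> and \<open>v (k + 2)\<close>, so each tensor leg has to be compared with these three only.
\<close>
lemma square_serre:
  assumes "i = Suc j \<or> j = Suc i"
  shows "evaluate (square_action q) (serre q (gE i) (gE j)) f = (\<lambda>x. 0)"
    and "evaluate (square_action q) (serre q (gF i) (gF j)) f = (\<lambda>x. 0)"
proof -
  define k where "k = min i j"
  define Q R where "Q = complex_of_real q" "R = inverse (complex_of_real q)"
  have QR: "Q * R = 1" "R * Q = 1" "\<And>z. Q * (R * z) = z" "\<And>z. R * (Q * z) = z"
    using q by (simp_all add: Q_R_def)
  have wf: "weight_factor q i b = (if b = Suc i then Q else if b = i then R else 1)"
     "inverse Q = R" "inverse R = Q" for b i
    using q by (simp_all add: weight_factor_def Q_R_def)
  have qq: "complex_of_real (q + inverse q) = Q + R" by (simp add: Q_R_def)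
  have ij: "i = Suc k \<and> j = k \<or> i = k \<and> j = Suc k" using assms by (auto simp: k_def)
  have "evaluate (square_action q) (serre q (gE i) (gE j)) f (a, c) = 0" for a c
    using ij unfolding serre_def qq
    by (elim disjE conjE; hypsubst; cases rule: consecutive_cases[of a k]; cases rule: consecutive_cases[of c k])
      (simp_all add: evaluate_simps wf,
       simp_all only: QR distrib_left distrib_right mult_1_left mult_1_right,
       simp_all add: QR)
  moreover have "evaluate (square_action q) (serre q (gF i) (gF j)) f (a, c) = 0" for a c
    using ij unfolding serre_def qq
    by (elim disjE conjE; hypsubst; cases rule: consecutive_cases[of a k]; cases rule: consecutive_cases[of c k])
      (simp_all add: evaluate_simps wf,
       simp_all only: QR distrib_left distrib_right mult_1_left mult_1_right,
       simp_all add: QR)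
  ultimately show "evaluate (square_action q) (serre q (gE i) (gE j)) f = (\<lambda>x. 0)"
    and "evaluate (square_action q) (serre q (gF i) (gF j)) f = (\<lambda>x. 0)"
    by auto
qed

lemma square_far:
  assumes "cartan i j = 0"
  shows "evaluate (square_action q) (indet (gE i) * indet (gE j) - indet (gE j) * indet (gE i)) f = (\<lambda>x. 0)"
    and "evaluate (square_action q) (indet (gF i) * indet (gF j) - indet (gF j) * indet (gF i)) f = (\<lambda>x. 0)"
proof -
  have "i \<noteq> j" "i \<noteq> Suc j" "j \<noteq> Suc i" using assms by (auto simp: cartan_def split: if_splits)
  then show "evaluate (square_action q) (indet (gE i) * indet (gE j) - indet (gE j) * indet (gE i)) f = (\<lambda>x. 0)"
    and "evaluate (square_action q) (indet (gF i) * indet (gF j) - indet (gF j) * indet (gF i)) f = (\<lambda>x. 0)"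
    by (auto simp: fun_eq_iff evaluate_simps weight_factor_def)
qed

lemma square_K:
  "evaluate (square_action q) (indet (gK i) * indet (gKinv i) - 1) f = (\<lambda>x. 0)"
  "evaluate (square_action q) (indet (gKinv i) * indet (gK i) - 1) f = (\<lambda>x. 0)"
  "evaluate (square_action q) (indet (gK i) * indet (gK j) - indet (gK j) * indet (gK i)) f = (\<lambda>x. 0)"
  using q by (auto simp: fun_eq_iff evaluate_simps weight_factor_def field_simps)

lemma square_uq_action: "uq_action (square_action q) n q (square_index n)"
proof unfold_locales
  show "distinct (square_index n)" by (simp add: square_index_def distinct_product)
next
  fix g and f :: "nat \<times> nat \<Rightarrow> complex" and x :: "nat \<times> nat"
  assume g: "g \<in> uq_gens n" and f: "\<And>y. y \<notin> set (square_index n) \<Longrightarrow> f y = 0"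
    and x: "x \<notin> set (square_index n)"
  obtain a c where x': "x = (a, c)" by (cases x)
  show "square_action q g f x = 0"
    using g x f unfolding x'
    by (cases g) (auto simp: uq_gens_def set_square_index)
next
  fix r :: "uq_gen ncpoly" and f :: "nat \<times> nat \<Rightarrow> complex" assume "r \<in> uq_relations n q"
  then show "evaluate (square_action q) r f = (\<lambda>x. 0)"
    unfolding uq_relations_def
    by (elim UnE UN_E insertE emptyE)
      (simp_all only: square_K square_KE square_KF square_EF square_far,
       auto simp: square_far square_serre cartan_def split: if_splits)
next
  fix i assume "i \<in> {1..n}"
  have "weight_factor q i a = of_real (q powi (of_bool (a = Suc i) - of_bool (a = i)))" for a
    by (auto simp: weight_factor_def power_int_minus)
  then have "\<forall>f x. square_action q (gK i) f x = of_real (q powi ((of_bool (fst x = Suc i) - of_bool (fst x = i))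
      + (of_bool (snd x = Suc i) - of_bool (snd x = i)))) * f x"
    using q by (auto simp: power_int_add)
  then show "\<exists>wt. \<forall>f x. square_action q (gK i) f x = of_real (q powi wt x) * f x"
    by (rule exI[of _ "\<lambda>x. (of_bool (fst x = Suc i) - of_bool (fst x = i))
      + (of_bool (snd x = Suc i) - of_bool (snd x = i))"])
qed

end

section \<open>The coordinate algebra as a space of functionals\<close>

lemma module_homD:
  assumes "h \<in> LinearCombinations.module_hom class_ring M (module_mat TYPE(complex) d d)"
  shows "X \<in> carrier M \<Longrightarrow> h X \<in> carrier_mat d d"
    and "\<lbrakk>X \<in> carrier M; Y \<in> carrier M\<rbrakk> \<Longrightarrow> h (X \<oplus>\<^bsub>M\<^esub> Y) = h X + h Y"
    and "X \<in> carrier M \<Longrightarrow> h (c \<odot>\<^bsub>M\<^esub> X) = c \<cdot>\<^sub>m h X"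
  using assms by (auto simp: LinearCombinations.module_hom_def module_mat_simps)

lemma type1_repD:
  assumes "type1_rep n q d \<rho>"
  shows "X \<in> carrier (Uq n q) \<Longrightarrow> \<rho> X \<in> carrier_mat d d"
    and "\<lbrakk>X \<in> carrier (Uq n q); Y \<in> carrier (Uq n q)\<rbrakk> \<Longrightarrow> \<rho> (X \<oplus>\<^bsub>Uq n q\<^esub> Y) = \<rho> X + \<rho> Y"
    and "X \<in> carrier (Uq n q) \<Longrightarrow> \<rho> (c \<odot>\<^bsub>Uq n q\<^esub> X) = c \<cdot>\<^sub>m \<rho> X"
    and "\<lbrakk>X \<in> carrier (Uq n q); Y \<in> carrier (Uq n q)\<rbrakk> \<Longrightarrow> \<rho> (X \<otimes>\<^bsub>Uq n q\<^esub> Y) = \<rho> X * \<rho> Y"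
    and "\<rho> \<one>\<^bsub>Uq n q\<^esub> = 1\<^sub>m d"
proof -
  have h: "\<rho> \<in> LinearCombinations.module_hom class_ring (Uq n q) (module_mat TYPE(complex) d d)"
    and r: "\<rho> \<in> Ring.ring_hom (Uq n q) (module_mat TYPE(complex) d d)"
    using assms by (auto simp: type1_rep_def)
  show "X \<in> carrier (Uq n q) \<Longrightarrow> \<rho> X \<in> carrier_mat d d"
    and "\<lbrakk>X \<in> carrier (Uq n q); Y \<in> carrier (Uq n q)\<rbrakk> \<Longrightarrow> \<rho> (X \<oplus>\<^bsub>Uq n q\<^esub> Y) = \<rho> X + \<rho> Y"
    and "X \<in> carrier (Uq n q) \<Longrightarrow> \<rho> (c \<odot>\<^bsub>Uq n q\<^esub> X) = c \<cdot>\<^sub>m \<rho> X"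
    by (rule module_homD[OF h]; assumption)+
  show "\<lbrakk>X \<in> carrier (Uq n q); Y \<in> carrier (Uq n q)\<rbrakk> \<Longrightarrow> \<rho> (X \<otimes>\<^bsub>Uq n q\<^esub> Y) = \<rho> X * \<rho> Y"
    and "\<rho> \<one>\<^bsub>Uq n q\<^esub> = 1\<^sub>m d"
    using ring_hom_mult[OF r] ring_hom_one[OF r] by (auto simp: module_mat_simps)
qed

definition block_sum :: "complex mat \<Rightarrow> complex mat \<Rightarrow> complex mat" where
  "block_sum A B = four_block_mat A (0\<^sub>m (dim_row A) (dim_col B)) (0\<^sub>m (dim_row B) (dim_col A)) B"

lemma block_sum_simps:
  assumes "A \<in> carrier_mat d d" "A' \<in> carrier_mat d d" "B \<in> carrier_mat e e" "B' \<in> carrier_mat e e"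
  shows "block_sum A B \<in> carrier_mat (d + e) (d + e)"
    and "block_sum A B + block_sum A' B' = block_sum (A + A') (B + B')"
    and "c \<cdot>\<^sub>m block_sum A B = block_sum (c \<cdot>\<^sub>m A) (c \<cdot>\<^sub>m B)"
    and "block_sum A B * block_sum A' B' = block_sum (A * A') (B * B')"
    and "block_sum (1\<^sub>m d) (1\<^sub>m e) = 1\<^sub>m (d + e)"
proof -
  note [simp] = carrier_matD[OF assms(1)] carrier_matD[OF assms(2)]
    carrier_matD[OF assms(3)] carrier_matD[OF assms(4)]
  show "block_sum A B \<in> carrier_mat (d + e) (d + e)"
    unfolding block_sum_def using assms by (intro four_block_carrier_mat)
  show "block_sum A B + block_sum A' B' = block_sum (A + A') (B + B')"
    "c \<cdot>\<^sub>m block_sum A B = block_sum (c \<cdot>\<^sub>m A) (c \<cdot>\<^sub>m B)"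
    "block_sum (1\<^sub>m d) (1\<^sub>m e) = 1\<^sub>m (d + e)"
    unfolding block_sum_def by (auto intro!: eq_matI)
  have "block_sum A B * block_sum A' B' = four_block_mat (A * A' + 0\<^sub>m d e * 0\<^sub>m e d)
      (A * 0\<^sub>m d e + 0\<^sub>m d e * B') (0\<^sub>m e d * A' + B * 0\<^sub>m e d) (0\<^sub>m e d * 0\<^sub>m d e + B * B')"
    unfolding block_sum_def using assms
    by (simp add: mult_four_block_mat[where ?nr1.0 = d and ?n1.0 = d and ?n2.0 = e and ?nr2.0 = e and ?nc1.0 = d and ?nc2.0 = e])
  also have "\<dots> = block_sum (A * A') (B * B')"
    unfolding block_sum_def using assms
    by (intro cong_four_block_mat) (simp_all add: left_mult_zero_mat[of _ d] right_mult_zero_mat[of _ d d]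
      left_mult_zero_mat[of _ e] right_mult_zero_mat[of _ e e] right_add_zero_mat[of _ d d] left_add_zero_mat[of _ e e])
  finally show "block_sum A B * block_sum A' B' = block_sum (A * A') (B * B')" .
qed

text \<open>
  Direct sums of representations are what makes the set of matrix coefficients closed under addition.
\<close>
lemma type1_rep_block_sum:
  assumes "type1_rep n q d \<rho>" "type1_rep n q e \<sigma>"
  shows "type1_rep n q (d + e) (\<lambda>X. block_sum (\<rho> X) (\<sigma> X))"
  unfolding type1_rep_def
proof (intro conjI IntI)
  note r = type1_repD[OF assms(1)] and s = type1_repD[OF assms(2)]
  have *: "block_sum (\<rho> X) (\<sigma> X) \<in> carrier_mat (d + e) (d + e)"
    "c \<cdot>\<^sub>m block_sum (\<rho> X) (\<sigma> X) = block_sum (c \<cdot>\<^sub>m \<rho> X) (c \<cdot>\<^sub>m \<sigma> X)"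
    if "X \<in> carrier (Uq n q)" for X c
    using block_sum_simps(1,3)[OF r(1) r(1) s(1) s(1)] that by blast+
  have **: "block_sum (\<rho> X) (\<sigma> X) + block_sum (\<rho> Y) (\<sigma> Y) = block_sum (\<rho> X + \<rho> Y) (\<sigma> X + \<sigma> Y)"
    "block_sum (\<rho> X) (\<sigma> X) * block_sum (\<rho> Y) (\<sigma> Y) = block_sum (\<rho> X * \<rho> Y) (\<sigma> X * \<sigma> Y)"
    if "X \<in> carrier (Uq n q)" "Y \<in> carrier (Uq n q)" for X Y
    using block_sum_simps(2,4)[OF r(1) r(1) s(1) s(1)] that by blast+
  show "(\<lambda>X. block_sum (\<rho> X) (\<sigma> X)) \<in> Ring.ring_hom (Uq n q) (module_mat TYPE(complex) (d + e) (d + e))"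
    using * ** r s block_sum_simps(5)[OF one_carrier_mat one_carrier_mat one_carrier_mat one_carrier_mat]
    by (intro ring_hom_memI) (auto simp: module_mat_simps)
  show "(\<lambda>X. block_sum (\<rho> X) (\<sigma> X))
      \<in> LinearCombinations.module_hom class_ring (Uq n q) (module_mat TYPE(complex) (d + e) (d + e))"
    unfolding LinearCombinations.module_hom_def using * ** r s by (auto simp: module_mat_simps)
  from assms obtain P Q P' Q' where
    P: "\<forall>i\<in>{1..n}. \<exists>wt :: nat \<Rightarrow> int. similar_mat_wit (\<rho> (uq_class n q (indet (gK i))))
          (mat_diag d (\<lambda>a. of_real (q powi wt a))) P Q"
    and P': "\<forall>i\<in>{1..n}. \<exists>wt :: nat \<Rightarrow> int. similar_mat_wit (\<sigma> (uq_class n q (indet (gK i))))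
          (mat_diag e (\<lambda>a. of_real (q powi wt a))) P' Q'"
    unfolding type1_rep_def by blast
  show "\<exists>P Q. \<forall>i\<in>{1..n}. \<exists>wt :: nat \<Rightarrow> int.
      similar_mat_wit (block_sum (\<rho> (uq_class n q (indet (gK i)))) (\<sigma> (uq_class n q (indet (gK i)))))
        (mat_diag (d + e) (\<lambda>a. of_real (q powi wt a))) P Q"
  proof (rule exI[of _ "four_block_mat P (0\<^sub>m d e) (0\<^sub>m e d) P'"],
      rule exI[of _ "four_block_mat Q (0\<^sub>m d e) (0\<^sub>m e d) Q'"], rule ballI)
    fix i assume i: "i \<in> {1..n}"
    let ?K = "uq_class n q (indet (gK i))"
    from i P P' obtain wt wt' :: "nat \<Rightarrow> int" where
      wt: "similar_mat_wit (\<rho> ?K) (mat_diag d (\<lambda>a. of_real (q powi wt a))) P Q"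
      and wt': "similar_mat_wit (\<sigma> ?K) (mat_diag e (\<lambda>a. of_real (q powi wt' a))) P' Q'"
      by blast
    have K: "?K \<in> carrier (Uq n q)"
      using i by (intro uq.Q.coset_in_quot) (auto simp: uq_gens_def)
    note c = r(1)[OF K] s(1)[OF K]
    note PQ = similar_mat_witD2[OF c(1) wt] similar_mat_witD2[OF c(2) wt']
    have "similar_mat_wit (four_block_mat (\<rho> ?K) (0\<^sub>m d e) (0\<^sub>m e d) (\<sigma> ?K))
       (four_block_mat (mat_diag d (\<lambda>a. of_real (q powi wt a))) (0\<^sub>m d e) (0\<^sub>m e d)
          (mat_diag e (\<lambda>a. of_real (q powi wt' a))))
       (four_block_mat P (0\<^sub>m d e) (0\<^sub>m e d) P') (four_block_mat Q (0\<^sub>m d e) (0\<^sub>m e d) Q')"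
      by (rule similar_mat_wit_four_block[OF wt wt']) (use c PQ in auto)
    moreover have "four_block_mat (\<rho> ?K) (0\<^sub>m d e) (0\<^sub>m e d) (\<sigma> ?K) = block_sum (\<rho> ?K) (\<sigma> ?K)"
      using c by (simp add: block_sum_def)
    moreover have "four_block_mat (mat_diag d (\<lambda>a. of_real (q powi wt a))) (0\<^sub>m d e) (0\<^sub>m e d)
          (mat_diag e (\<lambda>a. of_real (q powi wt' a)))
        = mat_diag (d + e) (\<lambda>a. complex_of_real (q powi (if a < d then wt a else wt' (a - d))))"
      by (rule eq_matI) (auto simp: mat_diag_def)
    ultimately have "similar_mat_wit (block_sum (\<rho> ?K) (\<sigma> ?K))
        (mat_diag (d + e) (\<lambda>a. of_real (q powi (if a < d then wt a else wt' (a - d)))))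
        (four_block_mat P (0\<^sub>m d e) (0\<^sub>m e d) P') (four_block_mat Q (0\<^sub>m d e) (0\<^sub>m e d) Q')"
      by (simp only:)
    then show "\<exists>wt :: nat \<Rightarrow> int.
      similar_mat_wit (block_sum (\<rho> ?K) (\<sigma> ?K)) (mat_diag (d + e) (\<lambda>a. of_real (q powi wt a)))
        (four_block_mat P (0\<^sub>m d e) (0\<^sub>m e d) P') (four_block_mat Q (0\<^sub>m d e) (0\<^sub>m e d) Q')"
      by (rule exI[of _ "\<lambda>a. if a < d then wt a else wt' (a - d)"])
  qed
qed

lemma Oq_simps [simp]:
  "carrier (Oq n q) = Oq_carrier n q" "zero (Oq n q) = (\<lambda>_. 0)" "add (Oq n q) = (\<lambda>f g X. f X + g X)"
  "smult (Oq n q) = (\<lambda>c f X. c * f X)" "one (Oq n q) = Oq_one n q"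
  by (simp_all add: Oq_def)

lemma Oq_carrierE:
  assumes "f \<in> Oq_carrier n q"
  obtains d \<rho> \<phi> v where "type1_rep n q d \<rho>" "\<phi> \<in> carrier_vec d" "v \<in> carrier_vec d"
    "f = matrix_coeff n q \<rho> \<phi> v"
  using assms unfolding Oq_carrier_def by blast

lemma Oq_carrierI:
  "\<lbrakk>type1_rep n q d \<rho>; \<phi> \<in> carrier_vec d; v \<in> carrier_vec d\<rbrakk> \<Longrightarrow> matrix_coeff n q \<rho> \<phi> v \<in> Oq_carrier n q"
  unfolding Oq_carrier_def by blast

lemma Oq_add_closed:
  assumes "f \<in> Oq_carrier n q" "g \<in> Oq_carrier n q"
  shows "(\<lambda>X. f X + g X) \<in> Oq_carrier n q"
proof -
  obtain d \<rho> \<phi> v where f: "type1_rep n q d \<rho>" "\<phi> \<in> carrier_vec d" "v \<in> carrier_vec d"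
    "f = matrix_coeff n q \<rho> \<phi> v" using assms(1) by (rule Oq_carrierE)
  obtain e \<sigma> \<psi> w where g: "type1_rep n q e \<sigma>" "\<psi> \<in> carrier_vec e" "w \<in> carrier_vec e"
    "g = matrix_coeff n q \<sigma> \<psi> w" using assms(2) by (rule Oq_carrierE)
  have "(\<phi> @\<^sub>v \<psi>) \<bullet> (block_sum (\<rho> X) (\<sigma> X) *\<^sub>v (v @\<^sub>v w)) = \<phi> \<bullet> (\<rho> X *\<^sub>v v) + \<psi> \<bullet> (\<sigma> X *\<^sub>v w)"
    if X: "X \<in> carrier (Uq n q)" for X
  proof -
    note c = type1_repD(1)[OF f(1) X] type1_repD(1)[OF g(1) X]
    have "block_sum (\<rho> X) (\<sigma> X) *\<^sub>v (v @\<^sub>v w) =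
        (\<rho> X *\<^sub>v v + 0\<^sub>m d e *\<^sub>v w) @\<^sub>v (0\<^sub>m e d *\<^sub>v v + \<sigma> X *\<^sub>v w)"
      unfolding block_sum_def using c f g
      by (simp add: four_block_mat_mult_vec[where ?nr1.0 = d and ?nc1.0 = d and ?nr2.0 = e and ?nc2.0 = e])
    also have "\<rho> X *\<^sub>v v + 0\<^sub>m d e *\<^sub>v w = \<rho> X *\<^sub>v v"
      using c f g by (intro eq_vecI) auto
    also have "0\<^sub>m e d *\<^sub>v v + \<sigma> X *\<^sub>v w = \<sigma> X *\<^sub>v w"
      using c f g by (intro eq_vecI) auto
    finally show ?thesis
      using c f g by (simp add: scalar_prod_append[where ?n1.0 = d and ?n2.0 = e])
  qed
  then have "(\<lambda>X. f X + g X) = matrix_coeff n q (\<lambda>X. block_sum (\<rho> X) (\<sigma> X)) (\<phi> @\<^sub>v \<psi>) (v @\<^sub>v w)"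
    by (auto simp: f(4) g(4) matrix_coeff_def fun_eq_iff)
  also have "\<dots> \<in> Oq_carrier n q"
    using f g by (intro Oq_carrierI[OF type1_rep_block_sum]) auto
  finally show ?thesis .
qed

lemma Oq_smult_closed:
  assumes "f \<in> Oq_carrier n q" shows "(\<lambda>X. c * f X) \<in> Oq_carrier n q"
proof -
  obtain d \<rho> \<phi> v where f: "type1_rep n q d \<rho>" "\<phi> \<in> carrier_vec d" "v \<in> carrier_vec d"
    "f = matrix_coeff n q \<rho> \<phi> v" using assms by (rule Oq_carrierE)
  have "(\<lambda>X. c * f X) = matrix_coeff n q \<rho> (c \<cdot>\<^sub>v \<phi>) v"
    using f type1_repD(1)[OF f(1)]
    by (auto simp: matrix_coeff_def fun_eq_iff intro!: smult_scalar_prod_distrib[symmetric] mult_mat_vec_carrier)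
  also have "\<dots> \<in> Oq_carrier n q"
    using f by (intro Oq_carrierI) auto
  finally show ?thesis .
qed

text \<open>
  The counit is the matrix coefficient of the trivial representation.
\<close>
lemma Oq_one_in: "Oq_one n q \<in> Oq_carrier n q"
  and Oq_one_class: "p \<in> polys (uq_gens n) \<Longrightarrow> Oq_one n q (uq_class n q p) = evaluate trivial_action p (\<lambda>_. 1) ()"
proof -
  interpret uq_action trivial_action n q "[()]" by (rule trivial_uq_action)
  have counit: "free_counit p = evaluate trivial_action p (delta ()) ()" for p
  proof -
    have "foldr trivial_action gs f () = prod_list (map gen_counit gs) * f ()" for gs f
      by (induction gs) (auto simp: trivial_action_def)
    then show ?thesis
      by (simp add: free_counit_def evaluate_def linear_extension_def delta_def)
  qed
  have "Oq_one n q = coeff () ()"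
    by (auto simp: Oq_one_def coeff_def act_def counit fun_eq_iff)
  then show "Oq_one n q \<in> Oq_carrier n q" using coeff_in_Oq[of "()" "()"] by simp
  have "delta () = (\<lambda>_. 1)" by (auto simp: delta_def)
  then show "Oq_one n q (uq_class n q p) = evaluate trivial_action p (\<lambda>_. 1) ()"
    if "p \<in> polys (uq_gens n)"
    using that by (simp add: \<open>Oq_one n q = coeff () ()\<close> coeff_def act_class uq.Q.coset_in_quot)
qed

lemma Oq_zero_in: "(\<lambda>_. 0) \<in> Oq_carrier n q"
  using Oq_smult_closed[OF Oq_one_in, of 0] by simp

lemma module_Oq: "Module.module (class_ring :: complex ring) (Oq n q)"
proof (rule moduleI)
  show "cring (class_ring :: complex ring)" ..
  show "abelian_group (Oq n q)"
  proof (rule abelian_groupI)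
    fix f assume "f \<in> carrier (Oq n q)"
    then show "\<exists>g\<in>carrier (Oq n q). g \<oplus>\<^bsub>Oq n q\<^esub> f = \<zero>\<^bsub>Oq n q\<^esub>"
      using Oq_smult_closed[of f n q "- 1"] by (intro bexI[of _ "\<lambda>X. - f X"]) auto
  qed (auto simp: Oq_add_closed Oq_zero_in algebra_simps)
qed (auto simp: Oq_smult_closed algebra_simps)

lemma Oq_a_inv: "f \<in> Oq_carrier n q \<Longrightarrow> \<ominus>\<^bsub>Oq n q\<^esub> f = (\<lambda>X. - f X)"
proof -
  interpret Module.module "class_ring :: complex ring" "Oq n q" by (rule module_Oq)
  show "f \<in> Oq_carrier n q \<Longrightarrow> \<ominus>\<^bsub>Oq n q\<^esub> f = (\<lambda>X. - f X)"
    using Oq_smult_closed[of f n q "- 1"] by (intro M.minus_equality) auto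
qed

lemma Oq_linear:
  assumes "f \<in> Oq_carrier n q"
  shows "\<lbrakk>X \<in> carrier (Uq n q); Y \<in> carrier (Uq n q)\<rbrakk> \<Longrightarrow> f (X \<oplus>\<^bsub>Uq n q\<^esub> Y) = f X + f Y"
    and "X \<in> carrier (Uq n q) \<Longrightarrow> f (c \<odot>\<^bsub>Uq n q\<^esub> X) = c * f X"
proof -
  obtain d \<rho> \<phi> v where f: "type1_rep n q d \<rho>" "\<phi> \<in> carrier_vec d" "v \<in> carrier_vec d"
    "f = matrix_coeff n q \<rho> \<phi> v" using assms by (rule Oq_carrierE)
  interpret U: complex_algebra "Uq n q" by (rule uq.complex_algebra_quot)
  show "f (X \<oplus>\<^bsub>Uq n q\<^esub> Y) = f X + f Y" if X: "X \<in> carrier (Uq n q)" "Y \<in> carrier (Uq n q)"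
    using that f type1_repD(1)[OF f(1)]
    by (simp add: matrix_coeff_def type1_repD(2)[OF f(1)]
      add_mult_distrib_mat_vec[of _ d d] scalar_prod_add_distrib[of _ d] mult_mat_vec_carrier[of _ d d])
  show "f (c \<odot>\<^bsub>Uq n q\<^esub> X) = c * f X" if X: "X \<in> carrier (Uq n q)"
  proof -
    have "c \<odot>\<^bsub>Uq n q\<^esub> X \<in> carrier (Uq n q)" using X U.smult_closed by simp
    moreover have "(c \<cdot>\<^sub>m \<rho> X) *\<^sub>v v = c \<cdot>\<^sub>v (\<rho> X *\<^sub>v v)"
      using f type1_repD(1)[OF f(1) X] by (intro eq_vecI) (auto simp: scalar_prod_def sum_distrib_left mult.assoc)
    ultimately show ?thesis
      using X f type1_repD(1)[OF f(1) X]
      by (simp add: matrix_coeff_def type1_repD(3)[OF f(1)]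
        scalar_prod_smult_distrib[of _ d] mult_mat_vec_carrier[of _ d d])
  qed
qed

text \<open>
  Inserting the identity, as a sum over a basis and its dual basis, between \<open>\<rho> X\<close> and \<open>\<rho> Y\<close> splits the
  matrix coefficient at \<open>X \<otimes> Y\<close> into products of matrix coefficients.
\<close>
lemma Oq_coprod_exists:
  assumes "f \<in> Oq_carrier n q"
  obtains m a b where "is_Oq_coprod n q f m a b"
proof -
  obtain d \<rho> \<phi> v where f: "type1_rep n q d \<rho>" "\<phi> \<in> carrier_vec d" "v \<in> carrier_vec d"
    "f = matrix_coeff n q \<rho> \<phi> v" using assms by (rule Oq_carrierE)
  interpret U: complex_algebra "Uq n q" by (rule uq.complex_algebra_quot)
  have "is_Oq_coprod n q f d (\<lambda>k. matrix_coeff n q \<rho> \<phi> (unit_vec d k)) (\<lambda>k. matrix_coeff n q \<rho> (unit_vec d k) v)"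
    unfolding is_Oq_coprod_def
  proof (intro conjI allI impI ballI)
    fix X Y assume XY: "X \<in> carrier (Uq n q)" "Y \<in> carrier (Uq n q)"
    note c = type1_repD(1)[OF f(1) XY(1)] type1_repD(1)[OF f(1) XY(2)]
    have w: "\<rho> Y *\<^sub>v v \<in> carrier_vec d" using c f by (auto intro: mult_mat_vec_carrier)
    have u: "unit_vec d k \<bullet> (\<rho> Y *\<^sub>v v) = (\<rho> Y *\<^sub>v v) $ k" if "k < d" for k
      using that w by (simp add: scalar_prod_left_unit)
    have "\<rho> X *\<^sub>v (\<rho> Y *\<^sub>v v) = vec d (\<lambda>r. \<Sum>k<d. \<rho> X $$ (r, k) * (\<rho> Y *\<^sub>v v) $ k)"
      using c w by (intro eq_vecI) (auto simp: scalar_prod_def atLeast0LessThan)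
    then have "\<phi> \<bullet> (\<rho> X *\<^sub>v (\<rho> Y *\<^sub>v v)) = (\<Sum>r<d. \<phi> $ r * (\<Sum>k<d. \<rho> X $$ (r, k) * (\<rho> Y *\<^sub>v v) $ k))"
      by (simp add: scalar_prod_def atLeast0LessThan)
    also have "\<dots> = (\<Sum>k<d. (\<Sum>r<d. \<phi> $ r * \<rho> X $$ (r, k)) * (\<rho> Y *\<^sub>v v) $ k)"
      by (simp add: sum_distrib_left sum_distrib_right mult.assoc) (rule sum.swap)
    also have "\<dots> = (\<Sum>k<d. (\<phi> \<bullet> (\<rho> X *\<^sub>v unit_vec d k)) * (unit_vec d k \<bullet> (\<rho> Y *\<^sub>v v)))"
    proof (rule sum.cong[OF refl])
      fix k assume k: "k \<in> {..<d}"
      have "\<rho> X *\<^sub>v unit_vec d k = col (\<rho> X) k"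
        using c k by (intro eq_vecI) (auto simp: scalar_prod_right_unit)
      then show "(\<Sum>r<d. \<phi> $ r * \<rho> X $$ (r, k)) * (\<rho> Y *\<^sub>v v) $ k
          = (\<phi> \<bullet> (\<rho> X *\<^sub>v unit_vec d k)) * (unit_vec d k \<bullet> (\<rho> Y *\<^sub>v v))"
        using c k u[of k] by (simp add: scalar_prod_def atLeast0LessThan)
    qed
    also have "\<phi> \<bullet> (\<rho> X *\<^sub>v (\<rho> Y *\<^sub>v v)) = f (X \<otimes>\<^bsub>Uq n q\<^esub> Y)"
      using XY c f by (simp add: matrix_coeff_def type1_repD(4)[OF f(1)] assoc_mult_mat_vec[of _ d d _ d])
    finally show "f (X \<otimes>\<^bsub>Uq n q\<^esub> Y) =
        (\<Sum>k<d. matrix_coeff n q \<rho> \<phi> (unit_vec d k) X * matrix_coeff n q \<rho> (unit_vec d k) v Y)"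
      using XY by (simp add: matrix_coeff_def)
  qed (use f in \<open>auto intro!: Oq_carrierI\<close>)
  then show ?thesis using that by blast
qed

section \<open>Root vectors on the square of the vector representation\<close>

fun root_poly :: "real \<Rightarrow> nat \<Rightarrow> nat \<Rightarrow> uq_gen ncpoly" where
  "root_poly q i 0 = indet (gE i)"
| "root_poly q i (Suc k) = indet (gE (i + Suc k)) * root_poly q i k
     - scalar (of_real (inverse q)) * (root_poly q i k * indet (gE (i + Suc k)))"

lemma root_poly_closed: "\<lbrakk>1 \<le> i; i + k \<le> n\<rbrakk> \<Longrightarrow> root_poly q i k \<in> polys (uq_gens n)"
  by (induction k) (auto simp: uq_gens_def)

lemma root_vector_eq_class:
  "\<lbrakk>1 \<le> i; i + k \<le> n\<rbrakk> \<Longrightarrow> root_vector n q i k = uq_class n q (root_poly q i k)"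
proof (induction k)
  case (Suc k)
  have c: "root_poly q i k \<in> polys (uq_gens n)" "indet (gE (i + Suc k)) \<in> polys (uq_gens n)"
    using Suc.prems root_poly_closed[of i k n q] by (auto simp: uq_gens_def)
  have "root_vector n q i (Suc k) = qcomm (Uq n q) (of_real (inverse q))
       (uq_class n q (indet (gE (i + Suc k)))) (uq_class n q (root_poly q i k))"
    using Suc by simp
  also have "\<dots> = uq_class n q (indet (gE (i + Suc k)) * root_poly q i k
     \<ominus>\<^bsub>free_algebra (uq_gens n)\<^esub> scalar (of_real (inverse q)) * (root_poly q i k * indet (gE (i + Suc k))))"
    unfolding qcomm_def using c
    by (subst uq.Q.quot_minus[symmetric]) (auto simp: uq.quot_mult uq.Q.quot_smult)
  finally show ?case using c by (simp add: free_a_minus)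
qed simp

text \<open>
  The operator by which the root vector with indices \<open>(j, i)\<close> acts on the square of the vector
  representation.  Besides acting, up to a weight factor, on one of the two legs, it exchanges: for
  \<open>i < a < j\<close>, a multiple of \<open>v a \<otimes> v j\<close> occurs in the image of \<open>v i \<otimes> v a\<close>.  This reflects the mixed
  terms in the coproduct of a root vector that is not simple.
\<close>
fun root_operator :: "real \<Rightarrow> nat \<times> nat \<Rightarrow> (nat \<times> nat \<Rightarrow> complex) \<Rightarrow> nat \<times> nat \<Rightarrow> complex" where
  "root_operator q (j, i) f (a, c) =
     (if a = j then (if c = j then of_real q else if c = i then inverse (of_real q) else 1) * f (i, c) else 0) +
     (if c = j then f (a, i) + (if i < a \<and> a < j then of_real (q - inverse q) * f (i, a) else 0) else 0)"

lemma evaluate_square_root: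
  assumes q: "q \<noteq> 0"
  shows "evaluate (square_action q) (root_poly q i k) f = root_operator q (i + k + 1, i) f"
proof -
  interpret linear_action "square_action q" by (rule linear_square)
  define Q R where "Q = complex_of_real q" "R = complex_of_real (inverse q)"
  have QR: "Q * R = 1" "R * Q = 1" using q by (simp_all add: Q_R_def flip: of_real_mult)
  have QRz: "Q * (R * z) = z" "R * (Q * z) = z" for z using QR by (metis mult.assoc mult_1)+
  have QR': "complex_of_real q = Q" "complex_of_real (inverse q) = R" "inverse Q = R"
    "complex_of_real (q - inverse q) = Q - R"
    by (simp_all add: Q_R_def)
  show ?thesis
  proof (induction k arbitrary: f)
    case 0
    show ?case
      by (auto simp: fun_eq_iff evaluate_simps weight_factor_def)
  next
    case (Suc k)
    have "evaluate (square_action q) (root_poly q i (Suc k)) f (a, c) = root_operator q (i + Suc k + 1, i) f (a, c)" for a c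
    proof -
      consider "a = i" | "a = i + k + 1" | "a = i + k + 2" | "a \<noteq> i" "a \<noteq> i + k + 1" "a \<noteq> i + k + 2" "i < a \<and> a < i + k + 1"
        | "a < i" | "i + k + 2 < a" by linarith
      note a = this
      consider "c = i" | "c = i + k + 1" | "c = i + k + 2" | "c \<noteq> i" "c \<noteq> i + k + 1" "c \<noteq> i + k + 2"
         by linarith
      note c = this
      show ?thesis
        by (cases rule: a; cases rule: c)
          (simp_all add: evaluate_simps Suc weight_factor_def QR' QR QRz algebra_simps)
    qed
    then show ?case by (auto simp: fun_eq_iff)
  qed
qed

lemma evaluate_trivial_root: "evaluate trivial_action (root_poly q i k) f = (\<lambda>x. 0)"
proof -
  interpret linear_action trivial_action by (rule linear_trivial)
  show ?thesis
    by (induction k arbitrary: f) (auto simp: evaluate_simps trivial_action_def fun_eq_iff)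
qed

text \<open>
  Since \<open>d \<le> b\<close>, the exchanging term does not apply to \<open>v b \<otimes> v d\<close>.
\<close>
lemma root_operator_delta:
  assumes "i < j" "d \<le> b"
  shows "root_operator q (j, i) (delta (b, d)) (s, t) =
    (if s = j \<and> i = b \<and> t = d then (if d = b then inverse (of_real q) else 1) else 0) +
    (if t = j \<and> s = b \<and> i = d then 1 else 0)"
  using assms by (auto simp: delta_def)

text \<open>
  There are three ways in which two root vectors can lead from \<open>v b \<otimes> v d\<close> to \<open>v a \<otimes> v c\<close>: they act on
  different legs, in either order, or the first one moves the second leg from \<open>d\<close> to \<open>a\<close> and the second
  one then exchanges \<open>v b \<otimes> v a\<close> for \<open>v a \<otimes> v c\<close>.
\<close>
lemma root_operator_pair:
  assumes "i < j" "i' < j'" "b < a" "d < c" "d \<le> b"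
  shows "root_operator q (j, i) (root_operator q (j', i') (delta (b, d))) (a, c) =
    (if (j, i) = (a, b) \<and> (j', i') = (c, d) then (if c = a then of_real q else if c = b then inverse (of_real q) else 1) else 0) +
    (if (j, i) = (c, d) \<and> (j', i') = (a, b) then (if d = b then inverse (of_real q) else 1) else 0) +
    (if a < c \<and> (j, i) = (c, b) \<and> (j', i') = (a, d) then of_real (q - inverse q) else 0)"
proof -
  define g where "g = root_operator q (j', i') (delta (b, d))"
  have g: "g (i, c) = (if c = j' \<and> i = b \<and> i' = d then 1 else 0)"
    "g (a, i) = (if a = j' \<and> i' = b \<and> i = d then (if d = b then inverse (of_real q) else 1) else 0)"
    "g (i, a) = (if a = j' \<and> i = b \<and> i' = d then 1 else 0)"
    using assms by (auto simp: g_def root_operator_delta simp del: root_operator.simps)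
  have "(if a = j then (if c = j then of_real q else if c = i then inverse (of_real q) else 1) * g (i, c) else 0)
    = (if (j, i) = (a, b) \<and> (j', i') = (c, d) then (if c = a then of_real q else if c = b then inverse (of_real q) else 1) else 0)"
    unfolding g by auto
  moreover have "(if c = j then g (a, i) else 0) =
    (if (j, i) = (c, d) \<and> (j', i') = (a, b) then (if d = b then inverse (of_real q) else 1) else 0)"
    unfolding g by auto
  moreover have "(if c = j then (if i < a \<and> a < j then of_real (q - inverse q) * g (i, a) else 0) else 0) =
    (if a < c \<and> (j, i) = (c, b) \<and> (j', i') = (a, d) then of_real (q - inverse q) else 0)"
    unfolding g using assms by auto
  moreover have "root_operator q (j, i) g (a, c) =
     (if a = j then (if c = j then of_real q else if c = i then inverse (of_real q) else 1) * g (i, c) else 0) +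
     (if c = j then g (a, i) else 0) +
     (if c = j then (if i < a \<and> a < j then of_real (q - inverse q) * g (i, a) else 0) else 0)"
    unfolding root_operator.simps by (cases "c = j") (simp_all only: if_True if_False add_0_right add.assoc refl)
  ultimately show ?thesis unfolding g_def by (simp only:)
qed

definition roots :: "nat \<Rightarrow> (nat \<times> nat) set" where
  "roots n = {(j, i). 1 \<le> i \<and> i < j \<and> j \<le> n + 1}"

lemma finite_roots [simp]: "finite (roots n)"
  by (rule finite_subset[of _ "{..n + 1} \<times> {..n + 1}"]) (auto simp: roots_def)

definition root_elem :: "nat \<Rightarrow> real \<Rightarrow> nat \<times> nat \<Rightarrow> uq" where
  "root_elem n q \<alpha> = root_vector n q (snd \<alpha>) (fst \<alpha> - Suc (snd \<alpha>))"

lemma tangent_space_eq: "tangent_space n q = cspan (Uq n q) (root_elem n q ` roots n)"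
  unfolding tangent_space_def
  by (rule arg_cong[where f = "cspan (Uq n q)"]) (force simp: roots_def root_elem_def)

lemma root_elem_class:
  assumes "\<alpha> \<in> roots n"
  shows "root_elem n q \<alpha> = uq_class n q (root_poly q (snd \<alpha>) (fst \<alpha> - Suc (snd \<alpha>)))"
    and "root_poly q (snd \<alpha>) (fst \<alpha> - Suc (snd \<alpha>)) \<in> polys (uq_gens n)"
  using assms unfolding root_elem_def roots_def
  by (auto intro!: root_vector_eq_class root_poly_closed)

lemma root_elem_closed: "\<alpha> \<in> roots n \<Longrightarrow> root_elem n q \<alpha> \<in> carrier (Uq n q)"
  by (simp add: root_elem_class uq.Q.coset_in_quot)

section \<open>The first order calculus\<close>

lemma Oq_aug_simps [simp]:
  "carrier (Oq_aug n q) = {a \<in> Oq_carrier n q. a \<one>\<^bsub>Uq n q\<^esub> = 0}"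
  "zero (Oq_aug n q) = (\<lambda>_. 0)" "add (Oq_aug n q) = (\<lambda>f g X. f X + g X)"
  "smult (Oq_aug n q) = (\<lambda>c f X. c * f X)"
  by (simp_all add: Oq_aug_def Oq_counit_def)

text \<open>
  The tangent space is the span of the root vectors, and elements of the coordinate algebra are linear.
\<close>
lemma calculus_ideal_iff:
  "f \<in> calculus_ideal n q \<longleftrightarrow>
     f \<in> carrier (Oq_aug n q) \<and> (\<forall>\<alpha>\<in>roots n. f (root_elem n q \<alpha>) = 0)"
proof -
  interpret U: complex_algebra "Uq n q" by (rule uq.complex_algebra_quot)
  have sub: "root_elem n q ` roots n \<subseteq> carrier (Uq n q)"
    using root_elem_closed by auto
  have "tangent_space n q \<subseteq> {X \<in> carrier (Uq n q). f X = 0}"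
    if f: "f \<in> carrier (Oq_aug n q)" "\<forall>\<alpha>\<in>roots n. f (root_elem n q \<alpha>) = 0"
    unfolding tangent_space_eq
  proof (rule U.span_is_subset)
    have f': "f \<in> Oq_carrier n q" using f by simp
    have "f \<zero>\<^bsub>Uq n q\<^esub> = 0"
      using Oq_linear(2)[OF f' U.zero_closed, of 0] U.smult_l_null[OF U.zero_closed] by simp
    then show "submodule class_ring {X \<in> carrier (Uq n q). f X = 0} (Uq n q)"
      unfolding submodule_def using U.module_axioms uq.Q.smult_carrier
      by (auto simp: Oq_linear[OF f'])
  qed (use f sub in auto)
  moreover have "root_elem n q ` roots n \<subseteq> tangent_space n q"
    unfolding tangent_space_eq by (rule U.in_own_span[OF sub])
  ultimately show ?thesis
    unfolding calculus_ideal_def by blast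
qed

lemma one_forms_quotient: "subspace_quotient (Oq_aug n q) (calculus_ideal n q)"
proof (rule subspace_quotient.intro)
  interpret O: Module.module "class_ring :: complex ring" "Oq n q" by (rule module_Oq)
  have "submodule class_ring {a \<in> carrier (Oq n q). Oq_counit n q a = 0} (Oq n q)"
    by (auto simp: submodule_def module_Oq Oq_counit_def Oq_add_closed Oq_smult_closed Oq_zero_in)
  then show "Module.module (class_ring :: complex ring) (Oq_aug n q)"
    unfolding Oq_aug_def by (rule O.submodule_is_module)
qed (auto simp: calculus_ideal_iff Oq_add_closed Oq_smult_closed Oq_zero_in)

interpretation one_forms: subspace_quotient "Oq_aug n q" "calculus_ideal n q"
  rewrites "quot_alg (Oq_aug n q) (calculus_ideal n q) = one_forms n q"
    and "calculus_ideal n q +>\<^bsub>Oq_aug n q\<^esub> a = one_form_class n q a"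
  for n q
  by (rule one_forms_quotient) (simp_all add: one_forms_def one_form_class_def)

lemma Oq_plus_props:
  assumes "a \<in> Oq_carrier n q"
  shows "Oq_plus n q a \<in> carrier (Oq_aug n q)"
    and "\<alpha> \<in> roots n \<Longrightarrow> Oq_plus n q a (root_elem n q \<alpha>) = a (root_elem n q \<alpha>)"
proof -
  have one: "Oq_one n q \<one>\<^bsub>Uq n q\<^esub> = 1"
    by (simp add: uq.quot_one Oq_one_class evaluate_one)
  have c: "(\<lambda>X. - (Oq_counit n q a) * Oq_one n q X) \<in> Oq_carrier n q"
    by (rule Oq_smult_closed[OF Oq_one_in])
  have eq: "Oq_plus n q a = (\<lambda>X. a X - a \<one>\<^bsub>Uq n q\<^esub> * Oq_one n q X)"
    by (simp add: Oq_plus_def a_minus_def Oq_a_inv Oq_smult_closed Oq_one_in Oq_counit_def)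
  show "Oq_plus n q a \<in> carrier (Oq_aug n q)"
    using Oq_add_closed[OF assms c] by (simp add: eq one Oq_counit_def)
  show "\<alpha> \<in> roots n \<Longrightarrow> Oq_plus n q a (root_elem n q \<alpha>) = a (root_elem n q \<alpha>)"
    by (simp add: eq root_elem_class Oq_one_class evaluate_trivial_root)
qed

definition square_coeff :: "nat \<Rightarrow> real \<Rightarrow> nat \<times> nat \<Rightarrow> nat \<times> nat \<Rightarrow> uq \<Rightarrow> complex" where
  "square_coeff n q = uq_action.coeff (square_action q) n q"

context
  fixes n :: nat and q :: real
  assumes q: "q \<noteq> 0" "q \<noteq> 1" "q \<noteq> -1"
begin

interpretation sq: uq_action "square_action q" n q "square_index n"
  by (rule square_uq_action[OF q])

lemma square_coeff_in:
  "\<lbrakk>x \<in> {1..n + 1} \<times> {1..n + 1}; y \<in> {1..n + 1} \<times> {1..n + 1}\<rbrakk> \<Longrightarrow> square_coeff n q x y \<in> Oq_carrier n q"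
  using sq.coeff_in_Oq[of x y] by (simp add: square_coeff_def set_square_index)

lemma square_coeff_one: "square_coeff n q x y \<one>\<^bsub>Uq n q\<^esub> = delta y x"
proof -
  interpret U: complex_algebra "Uq n q" by (rule uq.complex_algebra_quot)
  show ?thesis by (simp add: square_coeff_def sq.coeff_def sq.act_one)
qed

lemma act_root_elem: "\<alpha> \<in> roots n \<Longrightarrow> sq.act (root_elem n q \<alpha>) f = root_operator q \<alpha> f"
  using q(1) by (auto simp: root_elem_class sq.act_class evaluate_square_root roots_def)

lemma square_coeff_root: "\<alpha> \<in> roots n \<Longrightarrow> square_coeff n q x y (root_elem n q \<alpha>) = root_operator q \<alpha> (delta y) x"
  by (simp add: square_coeff_def sq.coeff_def root_elem_closed act_root_elem)

lemma square_coeff_root_root: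
  assumes "\<alpha> \<in> roots n" "\<beta> \<in> roots n"
  shows "square_coeff n q x y (root_elem n q \<alpha> \<otimes>\<^bsub>Uq n q\<^esub> root_elem n q \<beta>)
    = root_operator q \<alpha> (root_operator q \<beta> (delta y)) x"
proof -
  interpret U: complex_algebra "Uq n q" by (rule uq.complex_algebra_quot)
  show ?thesis
    using assms by (simp add: square_coeff_def sq.coeff_def root_elem_closed sq.act_mult act_root_elem)
qed

text \<open>
  With the lowest basis vector in the first leg, the exchanging term of a root vector never applies.  What
  remains is a matrix coefficient of the vector representation, which separates the root vectors.
\<close>
definition coord :: "nat \<times> nat \<Rightarrow> uq \<Rightarrow> complex" where
  "coord \<alpha> = square_coeff n q (1, fst \<alpha>) (1, snd \<alpha>)"

lemma coord_in: "\<alpha> \<in> roots n \<Longrightarrow> coord \<alpha> \<in> carrier (Oq_aug n q)"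
  using square_coeff_in[of "(1, fst \<alpha>)" "(1, snd \<alpha>)"] square_coeff_one[of "(1, fst \<alpha>)" "(1, snd \<alpha>)"]
  by (auto simp: coord_def roots_def delta_def)

lemma coord_root:
  "\<lbrakk>\<alpha> \<in> roots n; \<beta> \<in> roots n\<rbrakk> \<Longrightarrow> coord \<alpha> (root_elem n q \<beta>) = (if \<alpha> = \<beta> then 1 else 0)"
  by (auto simp: coord_def square_coeff_root roots_def delta_def split: if_splits)

text \<open>
  A single root vector can change both legs of a tensor only by the exchanging term, which does not apply
  to \<open>v b \<otimes> v d\<close> with \<open>d \<le> b\<close>.  At the unit the coefficient vanishes because it is not diagonal.
\<close>
lemma square_coeff_in_ideal:
  assumes "(a, b) \<in> roots n" "(c, d) \<in> roots n" "d \<le> b"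
  shows "square_coeff n q (a, c) (b, d) \<in> calculus_ideal n q"
  unfolding calculus_ideal_iff
  using assms square_coeff_in[of "(a, c)" "(b, d)"]
  by (auto simp: square_coeff_one square_coeff_root roots_def delta_def)

end

section \<open>Straightening and nondegeneracy\<close>

text \<open>
  Modulo the two-sided ideal \<open>K\<close>, the algebra of polynomials is generated by the elements \<open>w \<alpha>\<close>.  They
  square to zero, and any two of them can be exchanged up to a nonzero factor and one product of smaller
  weight.
\<close>
locale straightening =
  fixes S :: "'g set" and K :: "'g ncpoly set" and R :: "'a set" and w :: "'a \<Rightarrow> 'g ncpoly"
    and h :: "'a \<Rightarrow> nat"
  assumes finite_R: "finite R"
    and w_polys: "\<alpha> \<in> R \<Longrightarrow> w \<alpha> \<in> polys S"
    and K_zero: "0 \<in> K"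
    and K_add: "\<lbrakk>p \<in> K; p' \<in> K\<rbrakk> \<Longrightarrow> p + p' \<in> K"
    and K_left: "\<lbrakk>p \<in> K; r \<in> polys S\<rbrakk> \<Longrightarrow> r * p \<in> K"
    and K_right: "\<lbrakk>p \<in> K; r \<in> polys S\<rbrakk> \<Longrightarrow> p * r \<in> K"
    and generators: "g \<in> S \<Longrightarrow> \<exists>c. indet g - (\<Sum>\<alpha>\<in>R. scalar (c \<alpha>) * w \<alpha>) \<in> K"
    and square: "\<alpha> \<in> R \<Longrightarrow> w \<alpha> * w \<alpha> \<in> K"
    and swap: "\<lbrakk>\<alpha> \<in> R; \<beta> \<in> R; \<alpha> \<noteq> \<beta>\<rbrakk> \<Longrightarrow> \<exists>c. c \<noteq> 0 \<and>
        (w \<alpha> * w \<beta> - scalar c * (w \<beta> * w \<alpha>) \<in> K \<or>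
         (\<exists>d. \<exists>\<gamma>\<in>R. \<exists>\<delta>\<in>R. h \<gamma> + h \<delta> < h \<alpha> + h \<beta> \<and>
            w \<alpha> * w \<beta> - scalar c * (w \<beta> * w \<alpha>) - scalar d * (w \<gamma> * w \<delta>) \<in> K))"
begin

abbreviation word :: "'a list \<Rightarrow> 'g ncpoly" where
  "word xs \<equiv> prod_list (map w xs)"

abbreviation weight :: "'a list \<Rightarrow> nat" where
  "weight xs \<equiv> sum_list (map h xs)"

lemma word_polys: "set xs \<subseteq> R \<Longrightarrow> word xs \<in> polys S"
  by (rule polys_prod_list) (auto intro: w_polys)

lemma K_scalar: "p \<in> K \<Longrightarrow> scalar c * p \<in> K"
  by (rule K_left) auto

text \<open>
  Including \<open>K\<close> makes membership of a difference express congruence modulo \<open>K\<close> and lower terms.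
\<close>
definition lower :: "nat \<Rightarrow> nat \<Rightarrow> 'g ncpoly set" where
  "lower k m = poly_space.span (K \<union> {word ys | ys. set ys \<subseteq> R \<and> length ys = k \<and> weight ys < m})"

lemma K_lower: "p \<in> K \<Longrightarrow> p \<in> lower k m"
  unfolding lower_def by (rule poly_space.span_base) simp

lemma word_lower: "\<lbrakk>set ys \<subseteq> R; weight ys < m\<rbrakk> \<Longrightarrow> word ys \<in> lower (length ys) m"
  unfolding lower_def by (rule poly_space.span_base) auto

lemma lower_add: "\<lbrakk>p \<in> lower k m; p' \<in> lower k m\<rbrakk> \<Longrightarrow> p + p' \<in> lower k m"
  and lower_scalar: "p \<in> lower k m \<Longrightarrow> scalar c * p \<in> lower k m"
  unfolding lower_def by (auto intro: poly_space.span_add poly_space.span_scale)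

lemma lower_induct [consumes 1, case_names K word zero add scalar]:
  assumes "p \<in> lower k m"
    and "\<And>p. p \<in> K \<Longrightarrow> P p"
    and "\<And>ys. \<lbrakk>set ys \<subseteq> R; length ys = k; weight ys < m\<rbrakk> \<Longrightarrow> P (word ys)"
    and "P 0" "\<And>p p'. \<lbrakk>P p; P p'\<rbrakk> \<Longrightarrow> P (p + p')" "\<And>c p. P p \<Longrightarrow> P (scalar c * p)"
  shows "P p"
  by (rule poly_space.span_induct[OF assms(1)[unfolded lower_def]])
    (use assms in \<open>auto intro!: poly_space.subspaceI\<close>)

lemma lower_Cons:
  assumes "x \<in> R" "p \<in> lower k m"
  shows "w x * p \<in> lower (Suc k) (h x + m)"
  using assms(2)
proof (induction rule: lower_induct)
  case (word ys)
  then show ?case using word_lower[of "x # ys" "h x + m"] assms(1) by simp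
qed (auto intro: K_lower K_left w_polys assms(1) lower_add lower_scalar K_zero
    simp: distrib_left mult_scalar_left_commute)

text \<open>
  The value of the factor \<open>c\<close> never matters; that it is nonzero makes the relation symmetric.
\<close>
definition similar :: "'a list \<Rightarrow> 'a list \<Rightarrow> bool" where
  "similar xs ys \<longleftrightarrow> mset xs = mset ys \<and> set xs \<subseteq> R \<and>
     (\<exists>c. c \<noteq> 0 \<and> word xs - scalar c * word ys \<in> lower (length xs) (weight xs))"

lemma mset_weight: "mset xs = mset ys \<Longrightarrow> weight xs = weight ys"
  by (metis mset_map sum_mset_sum_list)

lemma similar_refl: "set xs \<subseteq> R \<Longrightarrow> similar xs xs"
  unfolding similar_def by (auto intro!: exI[of _ 1] K_lower K_zero)

lemma similar_sym:
  assumes "similar xs ys" shows "similar ys xs"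
proof -
  obtain c where m: "mset xs = mset ys" "set xs \<subseteq> R" "c \<noteq> 0"
    and c: "word xs - scalar c * word ys \<in> lower (length xs) (weight xs)"
    using assms unfolding similar_def by blast
  have "scalar (- inverse c) * (word xs - scalar c * word ys) = word ys - scalar (inverse c) * word xs"
    using m(3) by (simp add: right_diff_distrib)
  then have "word ys - scalar (inverse c) * word xs \<in> lower (length ys) (weight ys)"
    using lower_scalar[OF c, of "- inverse c"] mset_weight[OF m(1)] mset_eq_length[OF m(1)] by simp
  then show ?thesis
    unfolding similar_def using m mset_eq_setD[OF m(1)] by (auto intro!: exI[of _ "inverse c"])
qed

lemma similar_trans:
  assumes "similar xs ys" "similar ys zs" shows "similar xs zs"
proof -
  obtain c where m: "mset xs = mset ys" "set xs \<subseteq> R" "c \<noteq> 0"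
    and c: "word xs - scalar c * word ys \<in> lower (length xs) (weight xs)"
    using assms(1) unfolding similar_def by blast
  obtain d where m': "mset ys = mset zs" "d \<noteq> 0"
    and d: "word ys - scalar d * word zs \<in> lower (length xs) (weight xs)"
    using assms(2) mset_weight[OF m(1)] mset_eq_length[OF m(1)] unfolding similar_def by auto
  have eq: "word xs - scalar (c * d) * word zs = (word xs - scalar c * word ys) + scalar c * (word ys - scalar d * word zs)"
    by (simp add: right_diff_distrib)
  have "word xs - scalar (c * d) * word zs \<in> lower (length xs) (weight xs)"
    unfolding eq by (rule lower_add[OF c lower_scalar[OF d]])
  then show ?thesis
    unfolding similar_def using m m' by (auto intro!: exI[of _ "c * d"])
qed

lemma similar_Cons:
  assumes "similar xs ys" "x \<in> R" shows "similar (x # xs) (x # ys)"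
proof -
  obtain c where m: "mset xs = mset ys" "set xs \<subseteq> R" "c \<noteq> 0"
    and c: "word xs - scalar c * word ys \<in> lower (length xs) (weight xs)"
    using assms(1) unfolding similar_def by blast
  have "word (x # xs) - scalar c * word (x # ys) \<in> lower (length (x # xs)) (weight (x # xs))"
    using lower_Cons[OF assms(2) c] by (simp add: right_diff_distrib mult_scalar_left_commute)
  then show ?thesis
    unfolding similar_def using m assms(2) by (auto intro!: exI[of _ c])
qed

lemma similar_swap:
  assumes "x \<in> R" "y \<in> R" "set zs \<subseteq> R"
  shows "similar (x # y # zs) (y # x # zs)"
proof (cases "x = y")
  case True
  then show ?thesis using assms similar_refl[of "y # y # zs"] by simp
next
  case False
  let ?L = "lower (length (x # y # zs)) (weight (x # y # zs))"
  obtain c where c: "c \<noteq> 0" and alt: "w x * w y - scalar c * (w y * w x) \<in> K \<or>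
         (\<exists>d. \<exists>\<gamma>\<in>R. \<exists>\<delta>\<in>R. h \<gamma> + h \<delta> < h x + h y \<and>
            w x * w y - scalar c * (w y * w x) - scalar d * (w \<gamma> * w \<delta>) \<in> K)"
    using swap[OF assms(1,2) False] by blast
  have eq: "word (x # y # zs) - scalar c * word (y # x # zs) = (w x * w y - scalar c * (w y * w x)) * word zs"
    by (simp add: left_diff_distrib mult.assoc)
  from alt have "word (x # y # zs) - scalar c * word (y # x # zs) \<in> ?L"
  proof (elim disjE exE bexE conjE)
    assume "w x * w y - scalar c * (w y * w x) \<in> K"
    then show ?thesis unfolding eq by (intro K_lower K_right word_polys assms)
  next
    fix d \<gamma> \<delta>
    assume g: "\<gamma> \<in> R" "\<delta> \<in> R" "h \<gamma> + h \<delta> < h x + h y"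
      and k: "w x * w y - scalar c * (w y * w x) - scalar d * (w \<gamma> * w \<delta>) \<in> K"
    have "(w x * w y - scalar c * (w y * w x)) * word zs =
       (w x * w y - scalar c * (w y * w x) - scalar d * (w \<gamma> * w \<delta>)) * word zs + scalar d * word (\<gamma> # \<delta> # zs)"
      by (simp add: left_diff_distrib mult.assoc)
    moreover have "word (\<gamma> # \<delta> # zs) \<in> ?L"
      using word_lower[of "\<gamma> # \<delta> # zs" "weight (x # y # zs)"] g assms by simp
    ultimately show ?thesis
      unfolding eq using K_lower[OF K_right[OF k word_polys[OF assms(3)]]]
      by (auto intro: lower_add lower_scalar)
  qed
  then show ?thesis
    unfolding similar_def using c assms by (auto intro!: exI[of _ c])
qed

lemma similar_move: "set (ys @ x # zs) \<subseteq> R \<Longrightarrow> similar (ys @ x # zs) (x # ys @ zs)"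
proof (induction ys)
  case Nil
  then show ?case using similar_refl[of "x # zs"] by simp
next
  case (Cons y ys)
  then have "similar (y # ys @ x # zs) (y # x # ys @ zs)" by (auto intro: similar_Cons)
  also have "similar (y # x # ys @ zs) (x # y # ys @ zs)" using Cons.prems by (intro similar_swap) auto
  finally (similar_trans) show ?case by simp
qed

text \<open>
  Insertion sort: the first letter of \<open>xs\<close> is moved to the front of \<open>ys\<close> by exchanges of neighbours.
\<close>
lemma similar_mset:
  assumes "mset xs = mset ys" "set xs \<subseteq> R"
  shows "similar xs ys"
  using assms
proof (induction xs arbitrary: ys)
  case Nil
  then show ?case by (auto intro: similar_refl)
next
  case (Cons x xs)
  have "x \<in> set ys" using mset_eq_setD[OF Cons.prems(1)] by auto
  then obtain us vs where ys: "ys = us @ x # vs" by (meson split_list)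
  have "similar xs (us @ vs)" using Cons ys by auto
  then have "similar (x # xs) (x # us @ vs)" using Cons.prems by (auto intro: similar_Cons)
  also have "set ys \<subseteq> R" using mset_eq_setD[OF Cons.prems(1)] Cons.prems(2) by auto
  then have "similar (x # us @ vs) ys" unfolding ys by (intro similar_sym[OF similar_move])
  finally (similar_trans) show ?case .
qed

text \<open>
  After a permutation the two equal letters are adjacent, and their product is in \<open>K\<close>.
\<close>
lemma repeated_lower:
  assumes "set xs \<subseteq> R" "\<not> distinct xs"
  shows "word xs \<in> lower (length xs) (weight xs)"
proof -
  obtain us y vs zs where xs: "xs = us @ [y] @ vs @ [y] @ zs"
    using not_distinct_decomp[OF assms(2)] by blast
  have "similar xs (y # y # us @ vs @ zs)"
    using assms(1) by (intro similar_mset) (auto simp: xs)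
  then obtain c where c: "word xs - scalar c * word (y # y # us @ vs @ zs) \<in> lower (length xs) (weight xs)"
    unfolding similar_def by blast
  have "(w y * w y) * word (us @ vs @ zs) \<in> K"
    using assms(1) by (intro K_right square word_polys) (auto simp: xs)
  then have "word (y # y # us @ vs @ zs) \<in> lower (length xs) (weight xs)"
    by (intro K_lower) (simp add: mult.assoc)
  from lower_add[OF c lower_scalar[OF this, of c]] show ?thesis by simp
qed

text \<open>
  An arbitrary order of the letters serves as the standard one.
\<close>
definition enum :: "'a set \<Rightarrow> 'a list" where
  "enum A = (SOME xs. set xs = A \<and> distinct xs)"

lemma enum_props:
  assumes "A \<subseteq> R"
  shows "set (enum A) = A" "distinct (enum A)" "length (enum A) = card A" "weight (enum A) = sum h A"
proof -
  have "\<exists>xs. set xs = A \<and> distinct xs"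
    using finite_distinct_list[OF finite_subset[OF assms finite_R]] by blast
  from someI_ex[OF this] show *: "set (enum A) = A" "distinct (enum A)"
    by (auto simp: enum_def)
  show "length (enum A) = card A" using distinct_card[OF *(2)] *(1) by simp
  show "weight (enum A) = sum h A" using sum_list_distinct_conv_sum_set[OF *(2), of h] *(1) by simp
qed

definition ordered_span :: "'g ncpoly set" where
  "ordered_span = poly_space.span (K \<union> {word (enum A) | A. A \<subseteq> R})"

lemma ordered_span_add: "\<lbrakk>p \<in> ordered_span; p' \<in> ordered_span\<rbrakk> \<Longrightarrow> p + p' \<in> ordered_span"
  and ordered_span_scalar: "p \<in> ordered_span \<Longrightarrow> scalar c * p \<in> ordered_span"
  and ordered_span_K: "p \<in> K \<Longrightarrow> p \<in> ordered_span"
  and ordered_span_enum: "A \<subseteq> R \<Longrightarrow> word (enum A) \<in> ordered_span"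
  unfolding ordered_span_def
  by (auto intro: poly_space.span_add poly_space.span_scale poly_space.span_base)

text \<open>
  By induction on the weight: a word without repetition is similar to an ordered one, and a word with a
  repetition is a combination of words of smaller weight.
\<close>
lemma word_ordered: "set xs \<subseteq> R \<Longrightarrow> word xs \<in> ordered_span"
proof (induction "weight xs" arbitrary: xs rule: less_induct)
  case less
  have low: "p \<in> ordered_span" if "p \<in> lower (length xs) (weight xs)" for p
    using that by (induction rule: lower_induct)
      (auto intro: ordered_span_K K_zero ordered_span_add ordered_span_scalar less.hyps)
  show ?case
  proof (cases "distinct xs")
    case True
    then have "mset xs = mset (enum (set xs))"
      using enum_props(1,2)[OF less.prems] by (simp add: set_eq_iff_mset_eq_distinct[symmetric])
    then obtain c where c: "word xs - scalar c * word (enum (set xs)) \<in> lower (length xs) (weight xs)"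
      using similar_mset[OF _ less.prems] unfolding similar_def by blast
    from ordered_span_add[OF low[OF c] ordered_span_scalar[OF ordered_span_enum[OF less.prems], of c]]
    show ?thesis by simp
  next
    case False
    then show ?thesis using low[OF repeated_lower[OF less.prems]] by simp
  qed
qed

text \<open>
  The letters of a monomial are expanded in the generators one after another, from right to left.
\<close>
lemma polys_word_span:
  assumes "p \<in> polys S"
  shows "p \<in> poly_space.span (K \<union> {word xs | xs. set xs \<subseteq> R})" (is "p \<in> ?W")
  using assms
proof (induction rule: polys_induct)
  case zero
  then show ?case by (rule poly_space.span_zero)
next
  case (add p q)
  then show ?case by (rule poly_space.span_add)
next
  case (single u c)
  have "Poly_Mapping.single (Word gs) 1 \<in> ?W" if "set gs \<subseteq> S" for gs
    using that
  proof (induction gs)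
    case Nil
    have "word [] \<in> ?W" by (rule poly_space.span_base) (auto intro: exI[of _ "[]"])
    then show ?case by (simp flip: zero_free_word_def)
  next
    case (Cons g gs)
    let ?u = "Poly_Mapping.single (Word gs) 1 :: 'g ncpoly"
    obtain c where c: "indet g - (\<Sum>\<alpha>\<in>R. scalar (c \<alpha>) * w \<alpha>) \<in> K"
      using generators[of g] Cons.prems by auto
    have u: "?u \<in> polys S" using Cons.prems by (intro polys_single) simp
    have left: "w \<alpha> * p \<in> ?W" if "\<alpha> \<in> R" "p \<in> ?W" for \<alpha> p
    proof (rule poly_space.span_induct[OF that(2)])
      show "poly_space.subspace {p. w \<alpha> * p \<in> ?W}"
        by (rule poly_space.subspaceI)
          (auto simp: distrib_left mult_scalar_left_commute intro: poly_space.span_zero poly_space.span_add poly_space.span_scale)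
      fix p assume "p \<in> K \<union> {word xs | xs. set xs \<subseteq> R}"
      then show "w \<alpha> * p \<in> ?W"
      proof
        assume "p \<in> K"
        then show ?thesis using that(1) by (intro poly_space.span_base UnI1 K_left w_polys)
      next
        assume "p \<in> {word xs | xs. set xs \<subseteq> R}"
        then obtain xs where "p = word xs" "set xs \<subseteq> R" by blast
        then have "w \<alpha> * p = word (\<alpha> # xs)" "set (\<alpha> # xs) \<subseteq> R" using that(1) by auto
        then show ?thesis by (intro poly_space.span_base UnI2) blast
      qed
    qed
    have "Poly_Mapping.single (Word (g # gs)) 1 = indet g * ?u"
      by (simp add: indet_def mult_single plus_free_word_def)
    also have "\<dots> = (indet g - (\<Sum>\<alpha>\<in>R. scalar (c \<alpha>) * w \<alpha>)) * ?u + (\<Sum>\<alpha>\<in>R. scalar (c \<alpha>) * (w \<alpha> * ?u))"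
      by (simp add: left_diff_distrib sum_distrib_right mult.assoc)
    also have "\<dots> \<in> ?W"
    proof (rule poly_space.span_add)
      show "(indet g - (\<Sum>\<alpha>\<in>R. scalar (c \<alpha>) * w \<alpha>)) * ?u \<in> ?W"
        by (intro poly_space.span_base UnI1 K_right c u)
      show "(\<Sum>\<alpha>\<in>R. scalar (c \<alpha>) * (w \<alpha> * ?u)) \<in> ?W"
        using Cons by (intro poly_space.span_sum poly_space.span_scale left) auto
    qed
    finally show ?case .
  qed
  from poly_space.span_scale[OF this[of "letters u"], of c] single
  show ?case by (simp add: scalar_mult_single)
qed

lemma polys_ordered:
  assumes "p \<in> polys S"
  obtains c where "p - (\<Sum>A\<in>Pow R. scalar (c A) * word (enum A)) \<in> K"
proof -
  have "p \<in> ordered_span"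
  proof (rule poly_space.span_induct[OF polys_word_span[OF assms]])
    show "poly_space.subspace {p. p \<in> ordered_span}"
      unfolding ordered_span_def by simp
  qed (auto intro: word_ordered ordered_span_K)
  then have "\<exists>c. p - (\<Sum>A\<in>Pow R. scalar (c A) * word (enum A)) \<in> K"
    unfolding ordered_span_def
  proof (rule poly_space.span_induct)
    show "poly_space.subspace {p. \<exists>c. p - (\<Sum>A\<in>Pow R. scalar (c A) * word (enum A)) \<in> K}"
    proof (rule poly_space.subspaceI; (elim CollectE exE)?; rule CollectI)
      show "\<exists>c. 0 - (\<Sum>A\<in>Pow R. scalar (c A) * word (enum A)) \<in> K"
        by (rule exI[of _ "\<lambda>_. 0"]) (simp add: K_zero)
    next
      fix p p' c c'
      assume "p - (\<Sum>A\<in>Pow R. scalar (c A) * word (enum A)) \<in> K"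
        "p' - (\<Sum>A\<in>Pow R. scalar (c' A) * word (enum A)) \<in> K"
      from K_add[OF this] show "\<exists>c. p + p' - (\<Sum>A\<in>Pow R. scalar (c A) * word (enum A)) \<in> K"
        by (intro exI[of _ "\<lambda>A. c A + c' A"]) (simp add: distrib_right sum.distrib algebra_simps)
    next
      fix a p c
      assume "p - (\<Sum>A\<in>Pow R. scalar (c A) * word (enum A)) \<in> K"
      from K_scalar[OF this, of a] show "\<exists>c. scalar a * p - (\<Sum>A\<in>Pow R. scalar (c A) * word (enum A)) \<in> K"
        by (intro exI[of _ "\<lambda>A. a * c A"]) (simp add: right_diff_distrib sum_distrib_left)
    qed
    fix p assume "p \<in> K \<union> {word (enum A) |A. A \<subseteq> R}"
    then show "\<exists>c. p - (\<Sum>A\<in>Pow R. scalar (c A) * word (enum A)) \<in> K"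
    proof
      assume "p \<in> K"
      then show ?thesis by (intro exI[of _ "\<lambda>_. 0"]) simp
    next
      assume "p \<in> {word (enum A) |A. A \<subseteq> R}"
      then obtain B where B: "p = word (enum B)" "B \<subseteq> R" by blast
      have "(\<Sum>A\<in>Pow R. scalar (if A = B then 1 else 0) * word (enum A)) = (\<Sum>A\<in>Pow R. if A = B then word (enum A) else 0)"
        by (intro sum.cong) auto
      also have "\<dots> = p" using B finite_R by simp
      finally show ?thesis by (intro exI[of _ "\<lambda>A. if A = B then 1 else 0"]) (simp add: K_zero)
    qed
  qed
  then show ?thesis using that by blast
qed

end

text \<open>
  The functional \<open>ev\<close> stands for an isomorphism from the top component to the scalars, extended by zero
  to the other degrees.
\<close>
locale straightening_functional = straightening S K R w h
  for S :: "'g set" and K and R :: "'a set" and w and h +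
  fixes ev :: "'g ncpoly \<Rightarrow> complex"
  assumes ev_add: "ev (p + p') = ev p + ev p'"
    and ev_scalar: "ev (scalar c * p) = c * ev p"
    and ev_K: "p \<in> K \<Longrightarrow> ev p = 0"
    and ev_degree: "\<lbrakk>set xs \<subseteq> R; length xs \<noteq> card R\<rbrakk> \<Longrightarrow> ev (word xs) = 0"
    and ev_nonzero: "\<exists>p\<in>polys S. ev p \<noteq> 0"
begin

lemma ev_diff: "ev (p - p') = ev p - ev p'"
  using ev_add[of p "- p'"] ev_scalar[of "- 1" p'] by simp

lemma ev_sum: "ev (\<Sum>i\<in>A. f i) = (\<Sum>i\<in>A. ev (f i))"
proof -
  have "ev 0 = 0" using ev_K[OF K_zero] .
  then show ?thesis by (induction A rule: infinite_finite_induct) (auto simp: ev_add)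
qed

lemma ev_lower:
  assumes "p \<in> lower k m"
    and "\<And>ys. \<lbrakk>set ys \<subseteq> R; length ys = k; weight ys < m\<rbrakk> \<Longrightarrow> ev (word ys) = 0"
  shows "ev p = 0"
  using assms(1)
  by (induction rule: lower_induct) (auto simp: ev_K K_zero ev_add ev_scalar assms(2))

lemma full_word:
  assumes "set xs \<subseteq> R" "length xs = card R" "distinct xs"
  shows "set xs = R" "weight xs = sum h R" "mset xs = mset (enum R)"
proof -
  show *: "set xs = R"
    using assms finite_R by (metis card_subset_eq distinct_card)
  then show "weight xs = sum h R" using assms(3) by (simp add: sum_list_distinct_conv_sum_set)
  show "mset xs = mset (enum R)"
    using * assms(3) enum_props(1,2)[of R] by (simp add: set_eq_iff_mset_eq_distinct[symmetric])
qed

text \<open>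
  By induction on the weight.  The word is a combination of words of smaller weight.  These are
  not permutations of all letters, as they would have weight \<open>sum h R\<close>; having full length, they contain
  a repetition again.
\<close>
lemma ev_repeated:
  assumes "set xs \<subseteq> R" "length xs = card R" "\<not> distinct xs" "weight xs \<le> sum h R"
  shows "ev (word xs) = 0"
  using assms
proof (induction "weight xs" arbitrary: xs rule: less_induct)
  case less
  show ?case
  proof (rule ev_lower[OF repeated_lower[OF less.prems(1,3)]])
    fix ys assume ys: "set ys \<subseteq> R" "length ys = length xs" "weight ys < weight xs"
    then have "\<not> distinct ys" using less.prems full_word(2)[of ys] by auto
    then show "ev (word ys) = 0" using ys less.prems by (intro less.hyps) auto
  qed
qed

text \<open>
  All words with every letter exactly once are similar, so if \<open>ev\<close> vanishes at one of them, then it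
  vanishes, by induction on the weight, at all words of full length, and hence everywhere.
\<close>
lemma ev_full:
  assumes "set xs \<subseteq> R" "length xs = card R" "distinct xs"
  shows "ev (word xs) \<noteq> 0"
proof
  assume 0: "ev (word xs) = 0"
  have all: "ev (word ys) = 0" if "set ys \<subseteq> R" for ys
    using that
  proof (induction "weight ys" arbitrary: ys rule: less_induct)
    case less
    have low: "ev p = 0" if "p \<in> lower (length ys) (weight ys)" for p
      using that by (rule ev_lower) (use less in auto)
    consider "length ys \<noteq> card R" | "\<not> distinct ys" | "length ys = card R" "distinct ys" by blast
    then show ?case
    proof cases
      case 1
      then show ?thesis using less.prems by (rule ev_degree[rotated])
    next
      case 2
      then show ?thesis by (rule low[OF repeated_lower[OF less.prems]])
    next
      case 3
      have "mset ys = mset xs" using full_word(3)[OF assms] full_word(3)[OF less.prems 3] by simp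
      then obtain c where "word ys - scalar c * word xs \<in> lower (length ys) (weight ys)"
        using similar_mset[OF _ less.prems] unfolding similar_def by blast
      from low[OF this] show ?thesis by (simp add: ev_diff ev_scalar 0)
    qed
  qed
  obtain p where p: "p \<in> polys S" "ev p \<noteq> 0" using ev_nonzero by blast
  have "ev p = 0"
  proof (rule poly_space.span_induct[OF polys_word_span[OF p(1)]])
    show "poly_space.subspace {p. ev p = 0}"
      by (rule poly_space.subspaceI) (auto simp: ev_K K_zero ev_add ev_scalar)
  qed (auto simp: ev_K all)
  then show False using p(2) by simp
qed

lemma ev_complement:
  assumes "A \<subseteq> R"
  shows "ev (word (enum A) * word (enum (R - A))) \<noteq> 0" "ev (word (enum (R - A)) * word (enum A)) \<noteq> 0"
proof -
  note e = enum_props[OF assms] enum_props[of "R - A", OF Diff_subset]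
  have "card A + card (R - A) = card R"
    using assms finite_R by (metis card_Diff_subset card_mono finite_subset le_add_diff_inverse)
  then have "ev (word (enum A @ enum (R - A))) \<noteq> 0" "ev (word (enum (R - A) @ enum A)) \<noteq> 0"
    using assms by (intro ev_full; auto simp: e)+
  then show "ev (word (enum A) * word (enum (R - A))) \<noteq> 0" "ev (word (enum (R - A)) * word (enum A)) \<noteq> 0"
    by simp_all
qed

text \<open>
  The word has the wrong length, or it contains a repetition because \<open>B\<close> is not the complement of \<open>R - A\<close>;
  in the latter case its weight is small enough for the lemma \<open>ev_repeated\<close>.
\<close>
lemma ev_non_complement:
  assumes "A \<subseteq> R" "B \<subseteq> R" "A \<noteq> B" "sum h B \<le> sum h A"
  shows "ev (word (enum B) * word (enum (R - A))) = 0" "ev (word (enum (R - A)) * word (enum B)) = 0"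
proof -
  note e = enum_props[OF assms(2)] enum_props[of "R - A", OF Diff_subset]
  have H: "sum h (R - A) + sum h A = sum h R"
    using sum.subset_diff[OF assms(1) finite_R, of h] by simp
  have "ev (word xs) = 0" if xs: "mset xs = mset (enum B @ enum (R - A))" for xs
  proof (cases "length xs = card R")
    case True
    have set: "set xs = B \<union> (R - A)" using mset_eq_setD[OF xs] by (simp add: e)
    have "\<not> distinct xs"
    proof
      assume d: "distinct xs"
      then have "distinct (enum B @ enum (R - A))" using xs by (metis mset_eq_imp_distinct_iff)
      then have "B \<inter> (R - A) = {}" by (simp add: e)
      moreover have "set xs = R" using True d set assms by (intro full_word(1)) auto
      ultimately show False using set assms by blast
    qed
    moreover have "weight xs = sum h B + sum h (R - A)"
      using mset_weight[OF xs] by (simp add: e)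
    ultimately show ?thesis
      using True set assms H by (intro ev_repeated) auto
  next
    case False
    have "set xs \<subseteq> R" using mset_eq_setD[OF xs] assms by (auto simp: e)
    then show ?thesis using False by (rule ev_degree)
  qed
  from this[of "enum B @ enum (R - A)"] this[of "enum (R - A) @ enum B"]
  show "ev (word (enum B) * word (enum (R - A))) = 0" "ev (word (enum (R - A)) * word (enum B)) = 0"
    by simp_all
qed

text \<open>
  If \<open>p\<close> is not in \<open>K\<close>, then some ordered word occurs in it.  Multiplying \<open>p\<close>, from either side, by the word
  complementary to one of maximal weight leaves a single term.
\<close>
theorem nondegenerate:
  assumes "p \<in> polys S"
    and "(\<forall>r\<in>polys S. ev (p * r) = 0) \<or> (\<forall>r\<in>polys S. ev (r * p) = 0)"
  shows "p \<in> K"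
proof -
  obtain c where c: "p - (\<Sum>A\<in>Pow R. scalar (c A) * word (enum A)) \<in> K"
    using polys_ordered[OF assms(1)] .
  define D where "D = {A \<in> Pow R. c A \<noteq> 0}"
  have "D = {}"
  proof (rule ccontr)
    assume "D \<noteq> {}"
    moreover have "finite D" using finite_R by (simp add: D_def)
    ultimately have "Max (sum h ` D) \<in> sum h ` D" by (intro Max_in) auto
    then obtain A where "A \<in> D" "sum h A = Max (sum h ` D)" by auto
    then have A: "A \<in> D" "\<forall>B\<in>D. sum h B \<le> sum h A"
      using \<open>finite D\<close> by (auto intro: Max_ge)
    then have AR: "A \<subseteq> R" "c A \<noteq> 0" by (auto simp: D_def)
    let ?r = "word (enum (R - A))"
    have r: "?r \<in> polys S" by (intro word_polys) (simp add: enum_props)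
    have "ev (p * ?r) = ev (\<Sum>B\<in>Pow R. scalar (c B) * (word (enum B) * ?r))"
      using ev_K[OF K_right[OF c r]] by (simp add: left_diff_distrib ev_diff sum_distrib_right mult.assoc)
    also have "\<dots> = (\<Sum>B\<in>Pow R. c B * ev (word (enum B) * ?r))"
      by (simp add: ev_sum ev_scalar)
    also have "\<dots> = (\<Sum>B\<in>Pow R. if B = A then c A * ev (word (enum A) * ?r) else 0)"
      using A AR ev_non_complement(1)[OF AR(1)] by (intro sum.cong) (auto simp: D_def)
    also have "\<dots> = c A * ev (word (enum A) * ?r)"
      using AR finite_R by simp
    finally have 1: "ev (p * ?r) \<noteq> 0" using AR ev_complement(1)[OF AR(1)] by simp
    have "ev (?r * p) = ev (\<Sum>B\<in>Pow R. scalar (c B) * (?r * word (enum B)))"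
      using ev_K[OF K_left[OF c r]]
      by (simp add: right_diff_distrib ev_diff sum_distrib_left mult_scalar_left_commute)
    also have "\<dots> = (\<Sum>B\<in>Pow R. c B * ev (?r * word (enum B)))"
      by (simp add: ev_sum ev_scalar)
    also have "\<dots> = (\<Sum>B\<in>Pow R. if B = A then c A * ev (?r * word (enum A)) else 0)"
      using A AR ev_non_complement(2)[OF AR(1)] by (intro sum.cong) (auto simp: D_def)
    also have "\<dots> = c A * ev (?r * word (enum A))"
      using AR finite_R by simp
    finally have "ev (?r * p) \<noteq> 0" using AR ev_complement(2)[OF AR(1)] by simp
    with 1 r assms(2) show False by blast
  qed
  then have "c A = 0" if "A \<in> Pow R" for A using that by (auto simp: D_def)
  then have "(\<Sum>A\<in>Pow R. scalar (c A) * word (enum A)) = 0" by (intro sum.neutral) simp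
  with c show ?thesis by simp
qed

end

section \<open>The quantum exterior algebra as a graded quotient of a free algebra\<close>

lemma (in algebra_quotient) ideal_image:
  assumes "ideal J M"
  shows "ideal ((\<lambda>x. N +> x) ` J) (quot_alg M N)"
proof -
  interpret complex_algebra M by (rule algebra_M)
  interpret J: ideal J M by (rule assms)
  interpret A: complex_algebra "quot_alg M N" by (rule complex_algebra_quot)
  show ?thesis
  proof (rule idealI)
    show "ring (quot_alg M N)" ..
    show "subgroup ((\<lambda>x. N +> x) ` J) (add_monoid (quot_alg M N))"
    proof (rule group.subgroupI[OF abelian_group.a_group])
      show "abelian_group (quot_alg M N)" ..
      show "(\<lambda>x. N +> x) ` J \<subseteq> carrier (add_monoid (quot_alg M N))"
        by (auto simp: Q.coset_in_quot)
      show "(\<lambda>x. N +> x) ` J \<noteq> {}" using J.zero_closed by blast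
      fix X assume "X \<in> (\<lambda>x. N +> x) ` J"
      then obtain x where x: "x \<in> J" "X = N +> x" by blast
      then show "inv\<^bsub>add_monoid (quot_alg M N)\<^esub> X \<in> (\<lambda>x. N +> x) ` J"
        using Q.quot_uminus[of x] unfolding a_inv_def[symmetric] by auto
    next
      fix X Y assume "X \<in> (\<lambda>x. N +> x) ` J" "Y \<in> (\<lambda>x. N +> x) ` J"
      then show "X \<otimes>\<^bsub>add_monoid (quot_alg M N)\<^esub> Y \<in> (\<lambda>x. N +> x) ` J"
        by (auto simp: Q.quot_add)
    qed
    fix X Y assume "X \<in> (\<lambda>x. N +> x) ` J" "Y \<in> carrier (quot_alg M N)"
    then obtain x y where "x \<in> J" "X = N +> x" "y \<in> carrier M" "Y = N +> y" by (auto simp: Q.quot_carrier)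
    then show "Y \<otimes>\<^bsub>quot_alg M N\<^esub> X \<in> (\<lambda>x. N +> x) ` J" "X \<otimes>\<^bsub>quot_alg M N\<^esub> Y \<in> (\<lambda>x. N +> x) ` J"
      by (auto simp: quot_mult J.I_l_closed J.I_r_closed)
  qed
qed

lemma free_finsum:
  assumes "\<And>i. i \<in> A \<Longrightarrow> f i \<in> polys S"
  shows "finsum (free_algebra S) f A = (\<Sum>i\<in>A. f i)"
proof -
  interpret Module.module "class_ring :: complex ring" "free_algebra S"
    by (rule complex_algebra.axioms(2)[OF complex_algebra_free])
  show ?thesis
    using assms
  proof (induction A rule: infinite_finite_induct)
    case (insert a A)
    then have "finsum (free_algebra S) f (insert a A) = f a \<oplus>\<^bsub>free_algebra S\<^esub> finsum (free_algebra S) f A"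
      by (intro M.finsum_insert) auto
    then show ?case using insert by simp
  qed simp_all
qed

lemma free_ideal_closed:
  assumes "ideal J (free_algebra S)"
  shows "J \<subseteq> polys S" "0 \<in> J" "\<lbrakk>p \<in> J; p' \<in> J\<rbrakk> \<Longrightarrow> p + p' \<in> J" "\<lbrakk>p \<in> J; p' \<in> J\<rbrakk> \<Longrightarrow> p - p' \<in> J"
    "\<lbrakk>p \<in> J; r \<in> polys S\<rbrakk> \<Longrightarrow> r * p \<in> J" "\<lbrakk>p \<in> J; r \<in> polys S\<rbrakk> \<Longrightarrow> p * r \<in> J"
    "(\<And>i. i \<in> A \<Longrightarrow> f i \<in> J) \<Longrightarrow> (\<Sum>i\<in>A. f i) \<in> J"
proof -
  interpret ideal J "free_algebra S" by (rule assms)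
  show "J \<subseteq> polys S" using a_subset by simp
  show 0: "0 \<in> J" using additive_subgroup.zero_closed[OF ideal.axioms(1)[OF assms]] by simp
  show add: "p + p' \<in> J" if "p \<in> J" "p' \<in> J" for p p'
    using additive_subgroup.a_closed[OF ideal.axioms(1)[OF assms] that] by simp
  show left: "r * p \<in> J" if "p \<in> J" "r \<in> polys S" for p r using I_l_closed[OF that] by simp
  show "p * r \<in> J" if "p \<in> J" "r \<in> polys S" for p r using I_r_closed[OF that] by simp
  show "p - p' \<in> J" if "p \<in> J" "p' \<in> J" for p p'
    using add[OF that(1) left[OF that(2), of "- 1"]] by simp
  show "(\<Sum>i\<in>A. f i) \<in> J" if "\<And>i. i \<in> A \<Longrightarrow> f i \<in> J"
    using that by (induction A rule: infinite_finite_induct) (auto intro: 0 add)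
qed

definition graded_part :: "nat \<Rightarrow> 'g ncpoly \<Rightarrow> 'g ncpoly" where
  "graded_part k p = (\<Sum>w\<in>{w \<in> Poly_Mapping.keys p. length (letters w) = k}.
     Poly_Mapping.single w (Poly_Mapping.lookup p w))"

lemma lookup_graded_part:
  "Poly_Mapping.lookup (graded_part k p) w = (if length (letters w) = k then Poly_Mapping.lookup p w else 0)"
  by (auto simp: graded_part_def lookup_sum lookup_single when_def sum.delta' in_keys_iff)

lemma graded_part_simps [simp]:
  "graded_part k 0 = 0"
  "graded_part k (p + p') = graded_part k p + graded_part k p'"
  "graded_part k (p - p') = graded_part k p - graded_part k p'"
  "graded_part k (scalar c * p) = scalar c * graded_part k p"
  "graded_part k (Poly_Mapping.single w c) = (if length (letters w) = k then Poly_Mapping.single w c else 0)"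
  by (auto intro!: poly_mapping_eqI
      simp: lookup_graded_part lookup_add lookup_minus lookup_scalar_mult lookup_single when_def)

lemma graded_part_sum [simp]: "graded_part k (\<Sum>i\<in>A. f i) = (\<Sum>i\<in>A. graded_part k (f i))"
  by (induction A rule: infinite_finite_induct) auto

lemma graded_part_indet [simp]: "graded_part k (indet g) = (if k = 1 then indet g else 0)"
  by (auto simp: indet_def)

lemma graded_part_mult:
  "graded_part k (p * p') = (\<Sum>i\<le>k. graded_part i p * graded_part (k - i) p')"
proof -
  have "graded_part k (Poly_Mapping.single u a * p')
      = (\<Sum>i\<le>k. graded_part i (Poly_Mapping.single u a) * graded_part (k - i) p')" for u a
  proof (rule poly_mapping_induct_single[of _ p'])
    fix v b
    have "(\<Sum>i\<le>k. graded_part i (Poly_Mapping.single u a) * graded_part (k - i) (Poly_Mapping.single v b))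
       = (\<Sum>i\<le>k. if i = length (letters u) then
            (if length (letters v) = k - i then Poly_Mapping.single u a * Poly_Mapping.single v b else 0) else 0)"
      by (intro sum.cong) auto
    also have "\<dots> = graded_part k (Poly_Mapping.single u a * Poly_Mapping.single v b)"
      by (auto simp: mult_single)
    finally show "graded_part k (Poly_Mapping.single u a * Poly_Mapping.single v b)
      = (\<Sum>i\<le>k. graded_part i (Poly_Mapping.single u a) * graded_part (k - i) (Poly_Mapping.single v b))" ..
  qed (simp_all only: graded_part_simps distrib_left sum.distrib mult_zero_right sum.neutral_const)
  note single = this
  show ?thesis
  proof (rule poly_mapping_induct_single[of _ p])
    fix w c
    show "graded_part k (Poly_Mapping.single w c * p')
      = (\<Sum>i\<le>k. graded_part i (Poly_Mapping.single w c) * graded_part (k - i) p')"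
      by (rule single)
  qed (simp_all only: graded_part_simps distrib_right sum.distrib mult_zero_left sum.neutral_const)
qed

lemma homogeneous_iff: "p \<in> homogeneous S k \<longleftrightarrow> p \<in> polys S \<and> graded_part k p = p"
proof -
  have "graded_part k p = p \<longleftrightarrow> (\<forall>w\<in>Poly_Mapping.keys p. length (letters w) = k)"
    by (auto simp: poly_mapping_eq_iff fun_eq_iff lookup_graded_part in_keys_iff)
  then show ?thesis by (simp add: homogeneous_def)
qed

lemma graded_part_polys [simp]: "p \<in> polys S \<Longrightarrow> graded_part k p \<in> polys S"
  by (auto simp: polys_iff in_keys_iff lookup_graded_part split: if_splits)

lemma graded_part_graded_part: "graded_part k (graded_part l p) = (if k = l then graded_part l p else 0)"
  by (auto intro!: poly_mapping_eqI simp: lookup_graded_part)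

lemma graded_part_homogeneous: "p \<in> polys S \<Longrightarrow> graded_part k p \<in> homogeneous S k"
  by (simp add: homogeneous_iff graded_part_graded_part)

lemma graded_part_other: "\<lbrakk>p \<in> homogeneous S l; l \<noteq> k\<rbrakk> \<Longrightarrow> graded_part k p = 0"
  by (metis graded_part_graded_part homogeneous_iff)

text \<open>
  This is the largest homogeneous ideal contained in \<open>J\<close>.  If \<open>J\<close> is generated by homogeneous elements,
  it contains these generators, so that \<open>J\<close> itself is homogeneous.
\<close>
lemma ideal_graded:
  assumes "ideal J (free_algebra S)"
  shows "ideal {p \<in> polys S. \<forall>k. graded_part k p \<in> J} (free_algebra S)"
proof (rule idealI_free)
  note closed = free_ideal_closed[OF assms]
  fix p r assume p: "p \<in> {p \<in> polys S. \<forall>k. graded_part k p \<in> J}" and r: "r \<in> polys S"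
  have "graded_part k (r * p) \<in> J" for k
    unfolding graded_part_mult using p r by (intro closed(7) closed(5)) auto
  then show "r * p \<in> {p \<in> polys S. \<forall>k. graded_part k p \<in> J}" using p r by auto
  have "graded_part k (p * r) \<in> J" for k
    unfolding graded_part_mult using p r by (intro closed(7) closed(6)) auto
  then show "p * r \<in> {p \<in> polys S. \<forall>k. graded_part k p \<in> J}" using p r by auto
qed (auto intro: free_ideal_closed(2,3)[OF assms])

lemma tensor_ideal_facts:
  assumes "Module.module (class_ring :: complex ring) V"
  shows "algebra_quotient (free_algebra (carrier V)) (tensor_ideal V)"
    and "\<lbrakk>x \<in> carrier V; y \<in> carrier V\<rbrakk> \<Longrightarrow> indet (x \<oplus>\<^bsub>V\<^esub> y) - indet x - indet y \<in> tensor_ideal V"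
    and "x \<in> carrier V \<Longrightarrow> indet (c \<odot>\<^bsub>V\<^esub> x) - scalar c * indet x \<in> tensor_ideal V"
    and "p \<in> tensor_ideal V \<Longrightarrow> graded_part k p \<in> tensor_ideal V"
proof -
  interpret V: Module.module "class_ring :: complex ring" V by (rule assms)
  let ?F = "free_algebra (carrier V)"
  let ?G = "{indet (x \<oplus>\<^bsub>V\<^esub> y) - indet x - indet y | x y. x \<in> carrier V \<and> y \<in> carrier V} \<union>
     {indet (c \<odot>\<^bsub>V\<^esub> x) - scalar c * indet x | c x. x \<in> carrier V}"
  have ring: "ring ?F" by (rule complex_algebra.axioms(1)[OF complex_algebra_free])
  have smult: "c \<odot>\<^bsub>V\<^esub> x \<in> carrier V" if "x \<in> carrier V" for c x
    using V.smult_closed[of c x] that by simp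
  have sub: "?G \<subseteq> carrier ?F" using smult by auto
  have self: "?G \<subseteq> tensor_ideal V"
    unfolding tensor_ideal_def by (rule ring.genideal_self[OF ring sub])
  have id: "ideal (tensor_ideal V) ?F"
    unfolding tensor_ideal_def by (rule ring.genideal_ideal[OF ring sub])
  then show "algebra_quotient ?F (tensor_ideal V)"
    by (intro algebra_quotient.intro complex_algebra_free)
  show "\<lbrakk>x \<in> carrier V; y \<in> carrier V\<rbrakk> \<Longrightarrow> indet (x \<oplus>\<^bsub>V\<^esub> y) - indet x - indet y \<in> tensor_ideal V"
    and "x \<in> carrier V \<Longrightarrow> indet (c \<odot>\<^bsub>V\<^esub> x) - scalar c * indet x \<in> tensor_ideal V"
    using self by auto
  note closed = free_ideal_closed[OF id]
  let ?J = "{p \<in> polys (carrier V). \<forall>k. graded_part k p \<in> tensor_ideal V}"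
  have "ideal ?J ?F"
    by (rule ideal_graded[OF id])
  moreover have "?G \<subseteq> ?J"
  proof
    fix g assume g: "g \<in> ?G"
    then have graded: "graded_part k g = g \<or> graded_part k g = 0" for k by auto
    have g': "g \<in> tensor_ideal V" "g \<in> polys (carrier V)"
      by (rule subsetD[OF self g], rule subsetD[OF sub g])
    have "graded_part k g \<in> tensor_ideal V" for k
      using graded[of k] by (elim disjE; simp only: g'(1) closed(2))
    with g'(2) show "g \<in> ?J" by (intro CollectI conjI allI)
  qed
  ultimately have "tensor_ideal V \<subseteq> ?J"
    unfolding tensor_ideal_def[of V] by (intro ring.genideal_minimal[OF ring]) (simp_all add: tensor_ideal_def)
  then show "p \<in> tensor_ideal V \<Longrightarrow> graded_part k p \<in> tensor_ideal V" by blast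
qed

abbreviation form_polys :: "nat \<Rightarrow> real \<Rightarrow> one_form ncpoly set" where
  "form_polys n q \<equiv> polys (carrier (one_forms n q))"

definition tensor_of :: "nat \<Rightarrow> real \<Rightarrow> one_form ncpoly \<Rightarrow> one_form ncpoly set" where
  "tensor_of n q p = tensor_ideal (one_forms n q) +>\<^bsub>free_algebra (carrier (one_forms n q))\<^esub> p"

lemmas module_one_forms = one_forms.module_quot

interpretation tensor: algebra_quotient
    "free_algebra (carrier (one_forms n q))" "tensor_ideal (one_forms n q)"
  rewrites "quot_alg (free_algebra (carrier (one_forms n q))) (tensor_ideal (one_forms n q)) = tensor_algebra (one_forms n q)"
    and "tensor_ideal (one_forms n q) +>\<^bsub>free_algebra (carrier (one_forms n q))\<^esub> p = tensor_of n q p"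
  for n q
  by (rule tensor_ideal_facts(1)[OF module_one_forms]) (simp_all add: tensor_algebra_def tensor_of_def)

definition quadratic_poly :: "nat \<Rightarrow> real \<Rightarrow> nat \<Rightarrow> (nat \<Rightarrow> uq \<Rightarrow> complex) \<Rightarrow> (nat \<Rightarrow> uq \<Rightarrow> complex) \<Rightarrow> one_form ncpoly" where
  "quadratic_poly n q m a b = (\<Sum>k<m. indet (one_form_class n q (Oq_plus n q (a k))) *
     indet (one_form_class n q (Oq_plus n q (b k))))"

lemma coprod_forms:
  assumes "is_Oq_coprod n q x m a b" "k < m"
  shows "one_form_class n q (Oq_plus n q (a k)) \<in> carrier (one_forms n q)"
    and "one_form_class n q (Oq_plus n q (b k)) \<in> carrier (one_forms n q)"
  using assms by (auto simp: is_Oq_coprod_def intro!: one_forms.coset_in_quot Oq_plus_props(1))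

lemma quadratic_poly_closed: "is_Oq_coprod n q x m a b \<Longrightarrow> quadratic_poly n q m a b \<in> form_polys n q"
  unfolding quadratic_poly_def by (intro polys_sum polys_closed coprod_forms) auto

lemma quadratic_relations_eq:
  "quadratic_relations n q =
     {tensor_of n q (quadratic_poly n q m a b) | x m a b. x \<in> calculus_ideal n q \<and> is_Oq_coprod n q x m a b}"
proof -
  have "(\<Oplus>\<^bsub>tensor_algebra (one_forms n q)\<^esub>k\<in>{..<m}.
        tensor_incl (one_forms n q) (one_form_class n q (Oq_plus n q (a k)))
          \<otimes>\<^bsub>tensor_algebra (one_forms n q)\<^esub>
        tensor_incl (one_forms n q) (one_form_class n q (Oq_plus n q (b k))))
     = tensor_of n q (quadratic_poly n q m a b)"
    if c: "is_Oq_coprod n q x m a b" for x m a b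
  proof -
    interpret A: Module.module "class_ring :: complex ring" "tensor_algebra (one_forms n q)"
      by (rule tensor.Q.module_quot)
    note forms = coprod_forms[OF c]
    have "(\<Oplus>\<^bsub>tensor_algebra (one_forms n q)\<^esub>k\<in>{..<m}.
        tensor_incl (one_forms n q) (one_form_class n q (Oq_plus n q (a k)))
          \<otimes>\<^bsub>tensor_algebra (one_forms n q)\<^esub>
        tensor_incl (one_forms n q) (one_form_class n q (Oq_plus n q (b k))))
      = (\<Oplus>\<^bsub>tensor_algebra (one_forms n q)\<^esub>k\<in>{..<m}. tensor_of n q
          (indet (one_form_class n q (Oq_plus n q (a k))) * indet (one_form_class n q (Oq_plus n q (b k)))))"
      using forms by (intro A.M.finsum_cong')
        (auto simp: tensor_incl_def tensor_of_def[symmetric] tensor.quot_mult intro!: tensor.Q.coset_in_quot)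
    also have "\<dots> = tensor_of n q (finsum (free_algebra (carrier (one_forms n q)))
        (\<lambda>k. indet (one_form_class n q (Oq_plus n q (a k))) * indet (one_form_class n q (Oq_plus n q (b k)))) {..<m})"
      using forms by (intro tensor.Q.quot_finsum) auto
    also have "\<dots> = tensor_of n q (quadratic_poly n q m a b)"
      unfolding quadratic_poly_def using forms by (subst free_finsum) auto
    finally show ?thesis .
  qed
  note eq = this
  show ?thesis unfolding quadratic_relations_def
    by (intro Collect_cong ex_cong1 rev_conj_cong) (auto simp only: eq)
qed

lemma exterior_ideal_facts:
  shows "algebra_quotient (tensor_algebra (one_forms n q)) (exterior_ideal n q)"
    and "quadratic_relations n q \<subseteq> exterior_ideal n q"
    and "\<lbrakk>ideal J (tensor_algebra (one_forms n q)); quadratic_relations n q \<subseteq> J\<rbrakk> \<Longrightarrow> exterior_ideal n q \<subseteq> J"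
proof -
  have ring: "ring (tensor_algebra (one_forms n q))"
    by (rule complex_algebra.axioms(1)[OF tensor.complex_algebra_quot])
  have sub: "quadratic_relations n q \<subseteq> carrier (tensor_algebra (one_forms n q))"
    unfolding quadratic_relations_eq by (auto intro!: tensor.Q.coset_in_quot quadratic_poly_closed)
  show "algebra_quotient (tensor_algebra (one_forms n q)) (exterior_ideal n q)"
    unfolding exterior_ideal_def
    by (intro algebra_quotient.intro tensor.complex_algebra_quot ring.genideal_ideal[OF ring sub])
  show "quadratic_relations n q \<subseteq> exterior_ideal n q"
    unfolding exterior_ideal_def by (rule ring.genideal_self[OF ring sub])
  show "\<lbrakk>ideal J (tensor_algebra (one_forms n q)); quadratic_relations n q \<subseteq> J\<rbrakk> \<Longrightarrow> exterior_ideal n q \<subseteq> J"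
    unfolding exterior_ideal_def by (rule ring.genideal_minimal[OF ring])
qed

definition form_of :: "nat \<Rightarrow> real \<Rightarrow> one_form ncpoly \<Rightarrow> form" where
  "form_of n q p = exterior_ideal n q +>\<^bsub>tensor_algebra (one_forms n q)\<^esub> tensor_of n q p"

interpretation exterior: algebra_quotient "tensor_algebra (one_forms n q)" "exterior_ideal n q"
  rewrites "quot_alg (tensor_algebra (one_forms n q)) (exterior_ideal n q) = exterior_algebra n q"
    and "exterior_ideal n q +>\<^bsub>tensor_algebra (one_forms n q)\<^esub> tensor_of n q p = form_of n q p"
  for n q
  by (rule exterior_ideal_facts(1)) (simp_all add: exterior_algebra_def form_of_def)

text \<open>
  The kernel of \<open>form_of\<close>: all polynomials in the one-forms that vanish in the exterior algebra.
\<close>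
definition relation_ideal :: "nat \<Rightarrow> real \<Rightarrow> one_form ncpoly set" where
  "relation_ideal n q = {p \<in> form_polys n q. tensor_of n q p \<in> exterior_ideal n q}"

lemma exterior_carrier: "carrier (exterior_algebra n q) = form_of n q ` form_polys n q"
  unfolding exterior.Q.quot_carrier tensor.Q.quot_carrier image_image
  by (simp add: form_of_def)

lemma form_of_hom:
  assumes "p \<in> form_polys n q" "p' \<in> form_polys n q"
  shows "form_of n q p \<oplus>\<^bsub>exterior_algebra n q\<^esub> form_of n q p' = form_of n q (p + p')"
    and "form_of n q p \<otimes>\<^bsub>exterior_algebra n q\<^esub> form_of n q p' = form_of n q (p * p')"
    and "c \<odot>\<^bsub>exterior_algebra n q\<^esub> form_of n q p = form_of n q (scalar c * p)"
  using assms
  by (simp_all add: form_of_def exterior.Q.quot_add[unfolded form_of_def] exterior.quot_mult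
      exterior.Q.quot_smult tensor.Q.coset_in_quot tensor.Q.quot_add tensor.quot_mult tensor.Q.quot_smult)

lemma form_of_eq_iff:
  assumes "p \<in> form_polys n q" "p' \<in> form_polys n q"
  shows "form_of n q p = form_of n q p' \<longleftrightarrow> p - p' \<in> relation_ideal n q"
  using assms exterior.Q.coset_eq_iff[of "tensor_of n q p" n q "tensor_of n q p'"]
  by (simp add: form_of_def relation_ideal_def tensor.Q.coset_in_quot tensor.Q.quot_minus free_a_minus)

lemma tensor_ideal_subset_relations: "tensor_ideal (one_forms n q) \<subseteq> relation_ideal n q"
proof
  fix p assume p: "p \<in> tensor_ideal (one_forms n q)"
  then have c: "p \<in> form_polys n q" using tensor.Q.N_subset by blast
  have "tensor_of n q p = tensor_of n q 0"
    using p c by (subst tensor.Q.coset_eq_iff) (auto simp: free_a_minus)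
  also have "\<dots> = \<zero>\<^bsub>tensor_algebra (one_forms n q)\<^esub>"
    using tensor.Q.quot_zero[of n q] tensor.Q.coset_zero[of n q] by simp
  finally show "p \<in> relation_ideal n q" using c exterior.Q.N_zero by (simp add: relation_ideal_def)
qed

lemma quadratic_poly_relation:
  "\<lbrakk>x \<in> calculus_ideal n q; is_Oq_coprod n q x m a b\<rbrakk> \<Longrightarrow> quadratic_poly n q m a b \<in> relation_ideal n q"
  using exterior_ideal_facts(2)[of n q] quadratic_poly_closed[of n q x m a b]
  unfolding relation_ideal_def quadratic_relations_eq by blast

lemma ideal_relation_ideal: "ideal (relation_ideal n q) (free_algebra (carrier (one_forms n q)))"
proof (rule idealI_free)
  interpret E: ideal "exterior_ideal n q" "tensor_algebra (one_forms n q)" by (rule exterior.ideal_N)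
  have t: "tensor_of n q p \<in> carrier (tensor_algebra (one_forms n q))" if "p \<in> form_polys n q" for p
    using that by (rule tensor.Q.coset_in_quot)
  show "0 \<in> relation_ideal n q"
    using subsetD[OF tensor_ideal_subset_relations tensor.Q.N_zero] by simp
  fix p p' assume "p \<in> relation_ideal n q" "p' \<in> relation_ideal n q"
  then show "p + p' \<in> relation_ideal n q"
    using additive_subgroup.a_closed[OF ideal.axioms(1)[OF exterior.ideal_N[of n q]], of "tensor_of n q p" "tensor_of n q p'"] by (auto simp: relation_ideal_def tensor.Q.quot_add)
next
  interpret E: ideal "exterior_ideal n q" "tensor_algebra (one_forms n q)" by (rule exterior.ideal_N)
  fix p r assume "p \<in> relation_ideal n q" and r: "r \<in> form_polys n q"
  then have p: "p \<in> form_polys n q" "tensor_of n q p \<in> exterior_ideal n q" by (auto simp: relation_ideal_def)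
  show "r * p \<in> relation_ideal n q" "p * r \<in> relation_ideal n q"
    using p r E.I_l_closed[OF p(2), of "tensor_of n q r"] E.I_r_closed[OF p(2), of "tensor_of n q r"]
    by (auto simp: relation_ideal_def tensor.quot_mult tensor.Q.coset_in_quot)
qed (auto simp: relation_ideal_def)

text \<open>
  The generators of the tensor ideal are homogeneous of degree one and the quadratic relations of degree
  two.  The polynomials all of whose components vanish in the exterior algebra form an ideal; its image
  in the tensor algebra is an ideal that contains the quadratic relations, hence contains all relations.
\<close>
lemma graded_part_relation:
  assumes "p \<in> relation_ideal n q" shows "graded_part k p \<in> relation_ideal n q"
proof -
  note closed = free_ideal_closed[OF ideal_relation_ideal]
  let ?J = "{p \<in> form_polys n q. \<forall>k. graded_part k p \<in> relation_ideal n q}"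
  have J: "ideal ?J (free_algebra (carrier (one_forms n q)))"
    by (rule ideal_graded[OF ideal_relation_ideal])
  have "exterior_ideal n q \<subseteq> tensor_of n q ` ?J"
  proof (rule exterior_ideal_facts(3)[OF tensor.ideal_image[OF J]], rule subsetI)
    fix t assume "t \<in> quadratic_relations n q"
    then obtain x m a b where t: "t = tensor_of n q (quadratic_poly n q m a b)"
      and x: "x \<in> calculus_ideal n q" "is_Oq_coprod n q x m a b"
      unfolding quadratic_relations_eq by blast
    have "graded_part k (indet g * indet g') = (if k = 2 then indet g * indet g' else 0)"
      for k and g g' :: one_form
      by (auto simp: indet_def mult_single)
    then have "graded_part k (quadratic_poly n q m a b) = (if k = 2 then quadratic_poly n q m a b else 0)" for k
      by (simp add: quadratic_poly_def)
    then have "quadratic_poly n q m a b \<in> ?J"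
      using quadratic_poly_relation[OF x] quadratic_poly_closed[OF x(2)] closed(2) by simp
    then show "t \<in> tensor_of n q ` ?J" unfolding t by blast
  qed
  then obtain p' where p': "p' \<in> ?J" "tensor_of n q p = tensor_of n q p'"
    using assms unfolding relation_ideal_def by blast
  then have "p - p' \<in> tensor_ideal (one_forms n q)"
    using assms tensor.Q.coset_eq_iff[of p n q p'] by (simp add: relation_ideal_def free_a_minus)
  then have "graded_part k p - graded_part k p' \<in> relation_ideal n q"
    using tensor_ideal_facts(4)[OF module_one_forms] tensor_ideal_subset_relations by fastforce
  from closed(3)[OF this, of "graded_part k p'"] p'(1) show ?thesis by simp
qed

lemma exterior_power_eq: "exterior_power n q k = form_of n q ` homogeneous (carrier (one_forms n q)) k"
  unfolding exterior_power_def tensor_power_def image_image by (simp add: form_of_def tensor_of_def)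

text \<open>
  Homogeneity of the relations makes the decomposition into components unique, so the definite
  description in \<open>degree_part\<close> denotes the component.
\<close>
lemma degree_part_form_of:
  assumes p: "p \<in> form_polys n q"
  shows "degree_part n q k (form_of n q p) = form_of n q (graded_part k p)"
proof -
  interpret E: complex_algebra "exterior_algebra n q" by (rule exterior.complex_algebra_quot)
  note closed = free_ideal_closed[OF ideal_relation_ideal]
  let ?U = "\<Union>l\<in>- {k}. exterior_power n q l"
  let ?N = "form_of n q ` {r \<in> form_polys n q. graded_part k r \<in> relation_ideal n q}"
  have U: "?U \<subseteq> carrier (exterior_algebra n q)"
    by (auto simp: exterior_power_eq exterior_carrier homogeneous_iff)
  have span_sub: "submodule class_ring (cspan (exterior_algebra n q) ?U) (exterior_algebra n q)"
    by (rule E.span_is_submodule[OF U])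
  have "cspan (exterior_algebra n q) ?U \<subseteq> ?N"
  proof (rule E.span_is_subset)
    show "?U \<subseteq> ?N"
    proof
      fix X assume "X \<in> ?U"
      then obtain l r where "l \<noteq> k" "r \<in> homogeneous (carrier (one_forms n q)) l" "X = form_of n q r"
        by (auto simp: exterior_power_eq)
      moreover from this have "graded_part k r = 0" by (intro graded_part_other)
      ultimately show "X \<in> ?N"
        using closed(2) by (auto simp: homogeneous_iff intro!: imageI)
    qed
    show "submodule class_ring ?N (exterior_algebra n q)"
    proof (rule submodule.intro)
      show "Module.module (class_ring :: complex ring) (exterior_algebra n q)" ..
      show "?N \<subseteq> carrier (exterior_algebra n q)" by (auto simp: exterior_carrier)
      have "\<zero>\<^bsub>exterior_algebra n q\<^esub> = form_of n q 0"
        using E.smult_l_null[of "form_of n q 0"] form_of_hom(3)[of 0 n q 0 0]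
        by (simp add: exterior_carrier)
      then show "\<zero>\<^bsub>exterior_algebra n q\<^esub> \<in> ?N" using closed(2) by auto
    next
      fix v v' assume "v \<in> ?N" "v' \<in> ?N"
      then show "v \<oplus>\<^bsub>exterior_algebra n q\<^esub> v' \<in> ?N"
        by (auto simp: form_of_hom intro!: imageI closed(3))
    next
      fix c v assume "v \<in> ?N"
      then show "c \<odot>\<^bsub>exterior_algebra n q\<^esub> v \<in> ?N"
        by (auto simp: form_of_hom(3)[OF _ polys_closed(1)] intro!: imageI closed(5))
    qed
  qed
  then have unique: "y = form_of n q (graded_part k p)"
    if y: "y \<in> exterior_power n q k" and z: "z \<in> cspan (exterior_algebra n q) ?U"
      and eq: "form_of n q p = y \<oplus>\<^bsub>exterior_algebra n q\<^esub> z" for y z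
  proof -
    obtain g where g: "g \<in> homogeneous (carrier (one_forms n q)) k" "y = form_of n q g"
      using y by (auto simp: exterior_power_eq)
    then have g': "g \<in> form_polys n q" "graded_part k g = g" by (auto simp: homogeneous_iff)
    obtain r where r: "r \<in> form_polys n q" "graded_part k r \<in> relation_ideal n q" "z = form_of n q r"
      using z \<open>cspan (exterior_algebra n q) ?U \<subseteq> ?N\<close> by blast
    have "p - (g + r) \<in> relation_ideal n q"
      using eq g g' r p by (simp add: form_of_hom form_of_eq_iff)
    from graded_part_relation[OF this, of k] have "graded_part k p - g - graded_part k r \<in> relation_ideal n q"
      using g' by (simp add: diff_diff_eq)
    from closed(3)[OF this r(2)] have "graded_part k p - g \<in> relation_ideal n q" by simp
    then have "form_of n q (graded_part k p) = form_of n q g"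
      using p g' by (simp add: form_of_eq_iff)
    then show ?thesis by (simp add: g)
  qed
  have zero_form: "\<zero>\<^bsub>exterior_algebra n q\<^esub> = form_of n q 0"
    using E.smult_l_null[of "form_of n q 0"] form_of_hom(3)[of 0 n q 0 0]
    by (simp add: exterior_carrier)
  have "p \<in> form_polys n q \<and> form_of n q (p - graded_part k p) \<in> cspan (exterior_algebra n q) ?U"
    using p
  proof (induction p rule: polys_induct)
    case zero
    then show ?case using submodule.zero_closed[OF span_sub] zero_form by simp
  next
    case (single w c)
    show ?case
    proof (cases "length (letters w) = k")
      case True
      then show ?thesis using submodule.zero_closed[OF span_sub] zero_form single by (simp add: polys_single)
    next
      case False
      then have "form_of n q (Poly_Mapping.single w c) \<in> ?U"
        using single by (auto simp: exterior_power_eq homogeneous_iff polys_single intro!: imageI)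
      then show ?thesis using E.in_own_span[OF U] False single by (auto simp: polys_single)
    qed
  next
    case (add p p')
    have "form_of n q (p + p' - graded_part k (p + p')) =
        form_of n q (p - graded_part k p) \<oplus>\<^bsub>exterior_algebra n q\<^esub> form_of n q (p' - graded_part k p')"
      using add by (simp add: form_of_hom algebra_simps)
    then show ?case using add submodule.m_closed[OF span_sub] by simp
  qed
  then have "form_of n q (p - graded_part k p) \<in> cspan (exterior_algebra n q) ?U" by blast
  moreover have "form_of n q p = form_of n q (graded_part k p) \<oplus>\<^bsub>exterior_algebra n q\<^esub> form_of n q (p - graded_part k p)"
    using p by (simp add: form_of_hom)
  moreover have "form_of n q (graded_part k p) \<in> exterior_power n q k"
    using p by (auto simp: exterior_power_eq intro: graded_part_homogeneous)
  ultimately show ?thesis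
    unfolding degree_part_def using unique by (intro the_equality) blast+
qed

section \<open>The commutation relations of the basic forms\<close>

context
  fixes n :: nat and q :: real
  assumes q: "q \<noteq> 0" "q \<noteq> 1" "q \<noteq> -1"
begin

definition basic_form :: "nat \<times> nat \<Rightarrow> one_form ncpoly" where
  "basic_form \<alpha> = indet (one_form_class n q (coord n q \<alpha>))"

lemmas relations = free_ideal_closed[OF ideal_relation_ideal[of n q]]

lemma relations_scalar: "p \<in> relation_ideal n q \<Longrightarrow> scalar c * p \<in> relation_ideal n q"
  by (rule relations(5)) auto

lemma basic_form_polys: "\<alpha> \<in> roots n \<Longrightarrow> basic_form \<alpha> \<in> form_polys n q"
  unfolding basic_form_def by (intro polys_closed one_forms.coset_in_quot coord_in[OF q])

text \<open>
  The difference between \<open>a\<close> and the combination of coordinate functions with the same values at the root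
  vectors lies in the calculus ideal.  The tensor ideal makes passing from one-forms to polynomials
  linear.
\<close>
lemma one_form_expansion:
  assumes a: "a \<in> carrier (Oq_aug n q)"
  shows "indet (one_form_class n q a) - (\<Sum>\<alpha>\<in>roots n. scalar (a (root_elem n q \<alpha>)) * basic_form \<alpha>)
    \<in> relation_ideal n q"
proof -
  interpret A: Module.module "class_ring :: complex ring" "Oq_aug n q" by (rule one_forms.module_M)
  \<comment> \<open>For the set of all roots, \<open>b\<close> is the combination of coordinate functions that agrees with \<open>a\<close> at the
    root vectors.\<close>
  define b where "b A = (\<lambda>X. \<Sum>\<alpha>\<in>A. a (root_elem n q \<alpha>) * coord n q \<alpha> X)" for A
  have add: "indet (one_form_class n q (\<lambda>X. f X + g X)) - indet (one_form_class n q f) - indet (one_form_class n q g)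
      \<in> relation_ideal n q"
    if "f \<in> carrier (Oq_aug n q)" "g \<in> carrier (Oq_aug n q)" for f g
    using subsetD[OF tensor_ideal_subset_relations tensor_ideal_facts(2)[OF module_one_forms
        one_forms.coset_in_quot[OF that(1)] one_forms.coset_in_quot[OF that(2)]]]
      one_forms.quot_add[OF that] by simp
  have smult: "indet (one_form_class n q (\<lambda>X. c * f X)) - scalar c * indet (one_form_class n q f)
      \<in> relation_ideal n q"
    if "f \<in> carrier (Oq_aug n q)" for f c
    using subsetD[OF tensor_ideal_subset_relations tensor_ideal_facts(3)[OF module_one_forms
        one_forms.coset_in_quot[OF that]], of c]
      one_forms.quot_smult[OF that, of c] by simp
  have "b A \<in> carrier (Oq_aug n q) \<and> indet (one_form_class n q (b A))
      - (\<Sum>\<alpha>\<in>A. scalar (a (root_elem n q \<alpha>)) * basic_form \<alpha>) \<in> relation_ideal n q"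
    if "A \<subseteq> roots n" for A
    using finite_subset[OF that finite_roots] that
  proof (induction A rule: finite_induct)
    case empty
    then show ?case using smult[OF a, of 0] a by (simp add: b_def Oq_zero_in)
  next
    case (insert \<alpha> A)
    let ?c = "a (root_elem n q \<alpha>)"
    let ?f = "\<lambda>X. ?c * coord n q \<alpha> X"
    have \<alpha>: "coord n q \<alpha> \<in> carrier (Oq_aug n q)" using insert.prems by (intro coord_in[OF q]) simp
    have f: "?f \<in> carrier (Oq_aug n q)" using one_forms.smult_carrier[OF \<alpha>, of ?c] by simp
    have bA: "b A \<in> carrier (Oq_aug n q)" using insert by blast
    have eq: "b (insert \<alpha> A) = (\<lambda>X. ?f X + b A X)" using insert.hyps by (simp add: b_def)
    have 1: "b (insert \<alpha> A) \<in> carrier (Oq_aug n q)"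
      using A.M.add.m_closed[OF f bA] by (simp add: eq)
    have IH: "indet (one_form_class n q (b A)) - (\<Sum>\<alpha>\<in>A. scalar (a (root_elem n q \<alpha>)) * basic_form \<alpha>)
        \<in> relation_ideal n q" using insert by blast
    have "indet (one_form_class n q (b (insert \<alpha> A))) - (\<Sum>\<alpha>\<in>insert \<alpha> A. scalar (a (root_elem n q \<alpha>)) * basic_form \<alpha>)
      = (indet (one_form_class n q (\<lambda>X. ?f X + b A X)) - indet (one_form_class n q ?f) - indet (one_form_class n q (b A)))
      + (indet (one_form_class n q ?f) - scalar ?c * indet (one_form_class n q (coord n q \<alpha>)))
      + (indet (one_form_class n q (b A)) - (\<Sum>\<alpha>\<in>A. scalar (a (root_elem n q \<alpha>)) * basic_form \<alpha>))"
      using insert.hyps by (simp add: eq basic_form_def)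
    also have "\<dots> \<in> relation_ideal n q"
      by (intro relations(3) add smult f bA \<alpha> IH)
    finally show ?case using 1 by blast
  qed
  from this[of "roots n"] have b: "b (roots n) \<in> carrier (Oq_aug n q)"
    and *: "indet (one_form_class n q (b (roots n)))
      - (\<Sum>\<alpha>\<in>roots n. scalar (a (root_elem n q \<alpha>)) * basic_form \<alpha>) \<in> relation_ideal n q"
    by auto
  have "b (roots n) (root_elem n q \<beta>) = a (root_elem n q \<beta>)" if "\<beta> \<in> roots n" for \<beta>
  proof -
    have "b (roots n) (root_elem n q \<beta>) = (\<Sum>\<alpha>\<in>roots n. if \<alpha> = \<beta> then a (root_elem n q \<alpha>) else 0)"
      unfolding b_def using that by (intro sum.cong) (auto simp: coord_root[OF q])
    then show ?thesis using that by simp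
  qed
  moreover have diff: "a \<ominus>\<^bsub>Oq_aug n q\<^esub> b (roots n) = (\<lambda>X. a X - b (roots n) X)"
  proof -
    have m: "(\<lambda>X. - b (roots n) X) \<in> carrier (Oq_aug n q)"
      using one_forms.smult_carrier[OF b, of "- 1"] by simp
    have "\<ominus>\<^bsub>Oq_aug n q\<^esub> b (roots n) = (\<lambda>X. - b (roots n) X)"
      using m b by (intro A.M.minus_equality) auto
    then show ?thesis by (simp add: a_minus_def)
  qed
  moreover have "a \<ominus>\<^bsub>Oq_aug n q\<^esub> b (roots n) \<in> carrier (Oq_aug n q)"
    using a b by (rule A.M.minus_closed)
  ultimately have "a \<ominus>\<^bsub>Oq_aug n q\<^esub> b (roots n) \<in> calculus_ideal n q"
    by (simp add: calculus_ideal_iff)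
  then have "one_form_class n q a = one_form_class n q (b (roots n))"
    using a b by (simp add: one_forms.coset_eq_iff)
  with * show ?thesis by simp
qed

text \<open>
  Expanding both factors of each term of the coproduct of \<open>x\<close> produces the coefficients
  \<open>\<Sum> a k (E \<alpha>) * b k (E \<beta>)\<close>, which by definition of the coproduct are the values of \<open>x\<close> at products.
\<close>
lemma quadratic_relation:
  assumes x: "x \<in> calculus_ideal n q"
  shows "(\<Sum>\<alpha>\<in>roots n. \<Sum>\<beta>\<in>roots n.
     scalar (x (root_elem n q \<alpha> \<otimes>\<^bsub>Uq n q\<^esub> root_elem n q \<beta>)) * (basic_form \<alpha> * basic_form \<beta>)) \<in> relation_ideal n q"
proof -
  have "x \<in> Oq_carrier n q" using x by (simp add: calculus_ideal_iff)
  then obtain m a b where c: "is_Oq_coprod n q x m a b" by (rule Oq_coprod_exists)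
  let ?E = "root_elem n q"
  let ?A = "\<lambda>k. indet (one_form_class n q (Oq_plus n q (a k)))"
  let ?B = "\<lambda>k. indet (one_form_class n q (Oq_plus n q (b k)))"
  let ?SA = "\<lambda>k. \<Sum>\<alpha>\<in>roots n. scalar (a k (?E \<alpha>)) * basic_form \<alpha>"
  let ?SB = "\<lambda>k. \<Sum>\<alpha>\<in>roots n. scalar (b k (?E \<alpha>)) * basic_form \<alpha>"
  have ab: "a k \<in> Oq_carrier n q" "b k \<in> Oq_carrier n q" if "k < m" for k
    using c that by (auto simp: is_Oq_coprod_def)
  have exp: "?A k - ?SA k \<in> relation_ideal n q" "?B k - ?SB k \<in> relation_ideal n q" if "k < m" for k
    using one_form_expansion[OF Oq_plus_props(1)[OF ab(1)[OF that]]]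
      one_form_expansion[OF Oq_plus_props(1)[OF ab(2)[OF that]]]
    by (simp_all add: Oq_plus_props(2)[OF ab(1)[OF that]] Oq_plus_props(2)[OF ab(2)[OF that]])
  have S: "?SA k \<in> form_polys n q" for k
    by (intro polys_sum polys_closed basic_form_polys)
  have "?A k * ?B k - ?SA k * ?SB k \<in> relation_ideal n q" if "k < m" for k
  proof -
    have "?A k * ?B k - ?SA k * ?SB k = (?A k - ?SA k) * ?B k + ?SA k * (?B k - ?SB k)"
      by (simp add: left_diff_distrib right_diff_distrib)
    also have "\<dots> \<in> relation_ideal n q"
      using exp[OF that] S coprod_forms[OF c that] by (intro relations(3,5,6) polys_closed)
    finally show ?thesis .
  qed
  then have "(\<Sum>k<m. ?A k * ?B k - ?SA k * ?SB k) \<in> relation_ideal n q"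
    by (intro relations(7)) simp
  from relations(4)[OF quadratic_poly_relation[OF x c] this]
  have "(\<Sum>k<m. ?SA k * ?SB k) \<in> relation_ideal n q"
    by (simp add: quadratic_poly_def sum_subtractf)
  also have "(\<Sum>k<m. ?SA k * ?SB k) = (\<Sum>k<m. \<Sum>\<alpha>\<in>roots n. \<Sum>\<beta>\<in>roots n.
      scalar (a k (?E \<alpha>) * b k (?E \<beta>)) * (basic_form \<alpha> * basic_form \<beta>))"
  proof -
    have "(scalar x * A) * (scalar y * B) = scalar (x * y) * (A * B)" for x y and A B :: "one_form ncpoly"
      by (subst mult.assoc, subst mult_scalar_left_commute[of A]) simp
    then show ?thesis by (simp only: sum_product)
  qed
  also have "\<dots> = (\<Sum>\<alpha>\<in>roots n. \<Sum>\<beta>\<in>roots n. \<Sum>k<m.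
      scalar (a k (?E \<alpha>) * b k (?E \<beta>)) * (basic_form \<alpha> * basic_form \<beta>))"
    by (subst sum.swap, rule sum.cong[OF refl], rule sum.swap)
  also have "\<dots> = (\<Sum>\<alpha>\<in>roots n. \<Sum>\<beta>\<in>roots n.
     scalar (x (?E \<alpha> \<otimes>\<^bsub>Uq n q\<^esub> ?E \<beta>)) * (basic_form \<alpha> * basic_form \<beta>))"
  proof (intro sum.cong[OF refl])
    fix \<alpha> \<beta> assume "\<alpha> \<in> roots n" "\<beta> \<in> roots n"
    then have "x (?E \<alpha> \<otimes>\<^bsub>Uq n q\<^esub> ?E \<beta>) = (\<Sum>k<m. a k (?E \<alpha>) * b k (?E \<beta>))"
      using c root_elem_closed by (auto simp: is_Oq_coprod_def)
    moreover have "scalar (\<Sum>k<m. f k) = (\<Sum>k<m. scalar (f k) :: one_form ncpoly)" for f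
      by (induction m) auto
    ultimately show "(\<Sum>k<m. scalar (a k (?E \<alpha>) * b k (?E \<beta>)) * (basic_form \<alpha> * basic_form \<beta>))
      = scalar (x (?E \<alpha> \<otimes>\<^bsub>Uq n q\<^esub> ?E \<beta>)) * (basic_form \<alpha> * basic_form \<beta>)"
      by (simp add: sum_distrib_right)
  qed
  finally show ?thesis .
qed

lemma double_delta_sum:
  fixes F :: "nat \<times> nat \<Rightarrow> nat \<times> nat \<Rightarrow> one_form ncpoly"
  assumes "\<gamma> \<in> roots n" "\<delta> \<in> roots n"
  shows "(\<Sum>\<alpha>\<in>roots n. \<Sum>\<beta>\<in>roots n. scalar (if \<alpha> = \<gamma> \<and> \<beta> = \<delta> then c else 0) * F \<alpha> \<beta>) = scalar c * F \<gamma> \<delta>"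
proof -
  have "(\<Sum>\<alpha>\<in>roots n. \<Sum>\<beta>\<in>roots n. scalar (if \<alpha> = \<gamma> \<and> \<beta> = \<delta> then c else 0) * F \<alpha> \<beta>)
    = (\<Sum>\<alpha>\<in>roots n. \<Sum>\<beta>\<in>roots n. if \<beta> = \<delta> then (if \<alpha> = \<gamma> then scalar c * F \<alpha> \<beta> else 0) else 0)"
    by (intro sum.cong) auto
  then show ?thesis using assms by simp
qed

text \<open>
  The quadratic relation that belongs to the matrix coefficient leading from \<open>v b \<otimes> v d\<close> to \<open>v a \<otimes> v c\<close>.
\<close>
lemma commutation_relation:
  assumes ab: "(a, b) \<in> roots n" and cd: "(c, d) \<in> roots n" and "d \<le> b"
  shows "scalar (if c = a then of_real q else if c = b then inverse (of_real q) else 1) * (basic_form (a, b) * basic_form (c, d))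
    + scalar (if d = b then inverse (of_real q) else 1) * (basic_form (c, d) * basic_form (a, b))
    + (if a < c then scalar (of_real (q - inverse q)) * (basic_form (c, b) * basic_form (a, d)) else 0) \<in> relation_ideal n q"
    (is "scalar ?u * _ + scalar ?v * _ + _ \<in> _")
proof -
  let ?F = "\<lambda>\<alpha> \<beta>. basic_form \<alpha> * basic_form \<beta>"
  let ?e = "if a < c then of_real (q - inverse q) else 0 :: complex"
  have "square_coeff n q (a, c) (b, d) (root_elem n q \<alpha> \<otimes>\<^bsub>Uq n q\<^esub> root_elem n q \<beta>)
     = (if \<alpha> = (a, b) \<and> \<beta> = (c, d) then ?u else 0) + (if \<alpha> = (c, d) \<and> \<beta> = (a, b) then ?v else 0)
      + (if \<alpha> = (c, b) \<and> \<beta> = (a, d) then ?e else 0)"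
    if "\<alpha> \<in> roots n" "\<beta> \<in> roots n" for \<alpha> \<beta>
  proof -
    obtain j i j' i' where \<alpha>\<beta>: "\<alpha> = (j, i)" "\<beta> = (j', i')" by (cases \<alpha>, cases \<beta>)
    have "i < j" "i' < j'" "b < a" "d < c" using that ab cd by (auto simp: \<alpha>\<beta> roots_def)
    from root_operator_pair[OF this \<open>d \<le> b\<close>, of q] square_coeff_root_root[OF q that]
    show ?thesis unfolding \<alpha>\<beta> by (auto simp del: root_operator.simps)
  qed
  then have "(\<Sum>\<alpha>\<in>roots n. \<Sum>\<beta>\<in>roots n.
      scalar (square_coeff n q (a, c) (b, d) (root_elem n q \<alpha> \<otimes>\<^bsub>Uq n q\<^esub> root_elem n q \<beta>)) * ?F \<alpha> \<beta>)
    = (\<Sum>\<alpha>\<in>roots n. \<Sum>\<beta>\<in>roots n. scalar (if \<alpha> = (a, b) \<and> \<beta> = (c, d) then ?u else 0) * ?F \<alpha> \<beta>)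
    + (\<Sum>\<alpha>\<in>roots n. \<Sum>\<beta>\<in>roots n. scalar (if \<alpha> = (c, d) \<and> \<beta> = (a, b) then ?v else 0) * ?F \<alpha> \<beta>)
    + (\<Sum>\<alpha>\<in>roots n. \<Sum>\<beta>\<in>roots n. scalar (if \<alpha> = (c, b) \<and> \<beta> = (a, d) then ?e else 0) * ?F \<alpha> \<beta>)"
    by (simp only: scalar_simps distrib_right sum.distrib cong: sum.cong)
  also have "(\<Sum>\<alpha>\<in>roots n. \<Sum>\<beta>\<in>roots n. scalar (if \<alpha> = (c, b) \<and> \<beta> = (a, d) then ?e else 0) * ?F \<alpha> \<beta>)
    = (if a < c then scalar (of_real (q - inverse q)) * ?F (c, b) (a, d) else 0)"
  proof (cases "a < c")
    case True
    then have "(c, b) \<in> roots n" "(a, d) \<in> roots n" using assms by (auto simp: roots_def)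
    then show ?thesis using True by (subst double_delta_sum) auto
  qed simp
  also note double_delta_sum[OF ab cd]
  also note double_delta_sum[OF cd ab]
  finally show ?thesis
    using quadratic_relation[OF square_coeff_in_ideal[OF q assms]] by (simp only:)
qed

text \<open>
  Any strictly convex function of the length would do: it decreases in total when two nested
  intervals are replaced by the two crossing intervals with the same end points.
\<close>
definition root_weight :: "nat \<times> nat \<Rightarrow> nat" where
  "root_weight \<alpha> = (fst \<alpha> - snd \<alpha>)\<^sup>2"

text \<open>
  In contrast to the form in which \<open>straightening\<close> requires the exchange of two generators, this
  one is symmetric in \<open>\<alpha>\<close> and \<open>\<beta>\<close>, so that only one order of the two roots has to be considered.
\<close>
definition exchangeable :: "nat \<times> nat \<Rightarrow> nat \<times> nat \<Rightarrow> bool" where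
  "exchangeable \<alpha> \<beta> \<longleftrightarrow> (\<exists>u v. u \<noteq> 0 \<and> v \<noteq> 0 \<and>
    (scalar u * (basic_form \<alpha> * basic_form \<beta>) + scalar v * (basic_form \<beta> * basic_form \<alpha>) \<in> relation_ideal n q \<or>
     (\<exists>e. \<exists>\<gamma>\<in>roots n. \<exists>\<delta>\<in>roots n. root_weight \<gamma> + root_weight \<delta> < root_weight \<alpha> + root_weight \<beta> \<and>
       scalar u * (basic_form \<alpha> * basic_form \<beta>) + scalar v * (basic_form \<beta> * basic_form \<alpha>)
       + scalar e * (basic_form \<gamma> * basic_form \<delta>) \<in> relation_ideal n q)))"

lemma exchangeable_sym:
  assumes "exchangeable \<alpha> \<beta>" shows "exchangeable \<beta> \<alpha>"
proof -
  have eq: "scalar v * (basic_form \<beta> * basic_form \<alpha>) + scalar u * (basic_form \<alpha> * basic_form \<beta>)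
       = scalar u * (basic_form \<alpha> * basic_form \<beta>) + scalar v * (basic_form \<beta> * basic_form \<alpha>)"
      "root_weight \<beta> + root_weight \<alpha> = root_weight \<alpha> + root_weight \<beta>" for u v
    by (rule add.commute)+
  show ?thesis
    using assms unfolding exchangeable_def
    by (elim exE conjE) (rule exI, rule exI, intro conjI, assumption, assumption, subst (1 2) eq(1), subst eq(2), assumption)
qed

text \<open>
  For \<open>d = b\<close> and \<open>a < c\<close> the correction in the commutation relation would be the product in reversed order
  and not be of lower weight; this is why the case \<open>d = b\<close> is restricted to \<open>c \<le> a\<close>.
\<close>
lemma exchangeable_pair:
  assumes ab: "(a, b) \<in> roots n" and cd: "(c, d) \<in> roots n" and le: "d \<le> b" "d = b \<longrightarrow> c \<le> a"
  shows "exchangeable (a, b) (c, d)"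
proof -
  let ?u = "if c = a then of_real q else if c = b then inverse (of_real q) else 1 :: complex"
  let ?v = "if d = b then inverse (of_real q) else 1 :: complex"
  have uv: "?u \<noteq> 0" "?v \<noteq> 0" using q by auto
  note rel = commutation_relation[OF ab cd le(1)]
  show ?thesis
  proof (cases "a < c")
    case False
    then have "scalar ?u * (basic_form (a, b) * basic_form (c, d)) + scalar ?v * (basic_form (c, d) * basic_form (a, b))
        \<in> relation_ideal n q"
      using rel by (simp only: if_False add_0_right)
    then show ?thesis
      unfolding exchangeable_def by (intro exI[of _ ?u] exI[of _ ?v] conjI disjI1 uv)
  next
    case True
    then have "d < b" using le by auto
    then obtain s where s: "b = d + s" "0 < s" by (metis less_imp_add_positive)
    have "b < a" using ab by (simp add: roots_def)
    then obtain t where t: "a = b + t" "0 < t" by (metis less_imp_add_positive)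
    obtain r where r: "c = a + r" "0 < r" using True by (metis less_imp_add_positive)
    \<comment> \<open>In terms of the gaps between the end points, the two sides differ by twice the product of the outer gaps.\<close>
    have "0 < s * r" using s r by simp
    then have "root_weight (c, b) + root_weight (a, d) < root_weight (a, b) + root_weight (c, d)"
      by (simp add: root_weight_def s t r power2_eq_square algebra_simps)
    moreover have "(c, b) \<in> roots n" "(a, d) \<in> roots n" using assms True by (auto simp: roots_def)
    moreover have "scalar ?u * (basic_form (a, b) * basic_form (c, d)) + scalar ?v * (basic_form (c, d) * basic_form (a, b))
        + scalar (of_real (q - inverse q)) * (basic_form (c, b) * basic_form (a, d)) \<in> relation_ideal n q"
      using rel True by (simp only: if_True)
    ultimately show ?thesis
      unfolding exchangeable_def
      by (intro exI[of _ ?u] exI[of _ ?v] conjI[OF uv(1)] conjI[OF uv(2)] disjI2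
          exI[of _ "of_real (q - inverse q)"] bexI[of _ "(c, b)"] bexI[of _ "(a, d)"] conjI)
  qed
qed

lemma commutation_solve:
  fixes x y z :: "one_form ncpoly"
  assumes "u \<noteq> 0"
  shows "scalar u * x + scalar v * y \<in> relation_ideal n q \<Longrightarrow>
      x - scalar (- v / u) * y \<in> relation_ideal n q"
    and "scalar u * x + scalar v * y + scalar e * z \<in> relation_ideal n q \<Longrightarrow>
      x - scalar (- v / u) * y - scalar (- e / u) * z \<in> relation_ideal n q"
proof -
  have "scalar (inverse u) * (scalar u * x + scalar v * y) = x - scalar (- v / u) * y"
    "scalar (inverse u) * (scalar u * x + scalar v * y + scalar e * z)
      = x - scalar (- v / u) * y - scalar (- e / u) * z"
    using assms by (simp_all add: distrib_left divide_inverse mult.commute)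
  then show "scalar u * x + scalar v * y \<in> relation_ideal n q \<Longrightarrow>
      x - scalar (- v / u) * y \<in> relation_ideal n q"
    and "scalar u * x + scalar v * y + scalar e * z \<in> relation_ideal n q \<Longrightarrow>
      x - scalar (- v / u) * y - scalar (- e / u) * z \<in> relation_ideal n q"
    using relations_scalar by metis+
qed

lemma basic_form_swap:
  assumes "\<alpha> \<in> roots n" "\<beta> \<in> roots n"
  shows "\<exists>c. c \<noteq> 0 \<and>
      (basic_form \<alpha> * basic_form \<beta> - scalar c * (basic_form \<beta> * basic_form \<alpha>) \<in> relation_ideal n q \<or>
       (\<exists>d. \<exists>\<gamma>\<in>roots n. \<exists>\<delta>\<in>roots n. root_weight \<gamma> + root_weight \<delta> < root_weight \<alpha> + root_weight \<beta> \<and>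
          basic_form \<alpha> * basic_form \<beta> - scalar c * (basic_form \<beta> * basic_form \<alpha>)
          - scalar d * (basic_form \<gamma> * basic_form \<delta>) \<in> relation_ideal n q))"
proof -
  obtain a b c d where \<alpha>\<beta>: "\<alpha> = (a, b)" "\<beta> = (c, d)" by (cases \<alpha>, cases \<beta>)
  have "exchangeable \<alpha> \<beta>"
  proof (cases "d < b \<or> d = b \<and> c \<le> a")
    case True
    then show ?thesis unfolding \<alpha>\<beta> using assms by (intro exchangeable_pair) (auto simp: \<alpha>\<beta>)
  next
    case False
    then show ?thesis unfolding \<alpha>\<beta> using assms
      by (intro exchangeable_sym[OF exchangeable_pair]) (auto simp: \<alpha>\<beta>)
  qed
  then show ?thesis
    unfolding exchangeable_def
  proof (elim exE conjE disjE bexE)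
    fix u v :: complex assume "u \<noteq> 0" "v \<noteq> 0"
      "scalar u * (basic_form \<alpha> * basic_form \<beta>) + scalar v * (basic_form \<beta> * basic_form \<alpha>) \<in> relation_ideal n q"
    then show ?thesis
      using commutation_solve(1)[of u] by (intro exI[of _ "- v / u"] conjI disjI1) auto
  next
    fix u v e \<gamma> \<delta> assume "u \<noteq> 0" "v \<noteq> 0"
      and lower: "\<gamma> \<in> roots n" "\<delta> \<in> roots n" "root_weight \<gamma> + root_weight \<delta> < root_weight \<alpha> + root_weight \<beta>"
      and rel: "scalar u * (basic_form \<alpha> * basic_form \<beta>) + scalar v * (basic_form \<beta> * basic_form \<alpha>)
        + scalar e * (basic_form \<gamma> * basic_form \<delta>) \<in> relation_ideal n q"
    show ?thesis
      by (rule exI[of _ "- v / u"], rule conjI, use \<open>u \<noteq> 0\<close> \<open>v \<noteq> 0\<close> in simp, rule disjI2,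
          rule exI[of _ "- e / u"], rule bexI[OF _ lower(1)], rule bexI[OF _ lower(2)], rule conjI[OF lower(3)],
          rule commutation_solve(2)[OF \<open>u \<noteq> 0\<close> rel])
  qed
qed

text \<open>
  For equal roots the relation reads \<open>(q + inverse q) \<omega> \<omega> = 0\<close>, and \<open>q + inverse q\<close> is nonzero since \<open>q\<close> is
  real.
\<close>
lemma basic_form_square:
  assumes "\<alpha> \<in> roots n"
  shows "basic_form \<alpha> * basic_form \<alpha> \<in> relation_ideal n q"
proof -
  obtain a b where ab: "\<alpha> = (a, b)" by (cases \<alpha>)
  let ?x = "basic_form \<alpha> * basic_form \<alpha>"
  have "scalar (of_real q) * ?x + scalar (inverse (of_real q)) * ?x \<in> relation_ideal n q"
    using commutation_relation[of a b a b] assms by (simp add: ab)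
  then have *: "scalar (of_real (q + inverse q)) * ?x \<in> relation_ideal n q"
    by (simp add: distrib_right)
  have "q * (q + inverse q) = q * q + 1" using q by (simp add: distrib_left)
  moreover have "0 < q * q + 1" by (simp add: add_nonneg_pos)
  ultimately have "q + inverse q \<noteq> 0" by auto
  then have "inverse (of_real (q + inverse q)) * of_real (q + inverse q) = (1 :: complex)"
    by (intro left_inverse) (simp only: of_real_eq_0_iff not_False_eq_True)
  with relations_scalar[OF *, of "inverse (of_real (q + inverse q))"] show ?thesis
    by (simp only: poly_space.scale_scale scalar_simps mult_1_left)
qed

lemma basic_forms_straightening:
  "straightening (carrier (one_forms n q)) (relation_ideal n q) (roots n) basic_form root_weight"
proof unfold_locales
  fix g assume "g \<in> carrier (one_forms n q)"
  then obtain a where a: "a \<in> carrier (Oq_aug n q)" "g = one_form_class n q a"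
    by (auto simp only: one_forms.quot_carrier)
  show "\<exists>c. indet g - (\<Sum>\<alpha>\<in>roots n. scalar (c \<alpha>) * basic_form \<alpha>) \<in> relation_ideal n q"
    unfolding a(2) by (rule exI, rule one_form_expansion[OF a(1)])
qed (auto intro: basic_form_polys relations basic_form_square basic_form_swap)

end

section \<open>The Frobenius form\<close>

lemma card_pos_roots: "card (pos_roots n) = card (roots n)"
proof -
  let ?f = "\<lambda>(j, i). (\<lambda>k. of_bool (k = i) - of_bool (k = j)) :: nat \<Rightarrow> int"
  have "inj_on ?f (roots n)"
  proof (rule inj_onI, clarsimp simp: roots_def)
    fix j i j' i' :: nat
    assume lt: "i < j" "i' < j'"
      and eq: "(\<lambda>k. of_bool (k = i) - of_bool (k = j) :: int) = (\<lambda>k. of_bool (k = i') - of_bool (k = j'))"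
    from fun_cong[OF eq, of i] fun_cong[OF eq, of j] lt show "j = j' \<and> i = i'"
      by (auto simp: of_bool_def split: if_splits)
  qed
  moreover have "pos_roots n = ?f ` roots n"
    unfolding pos_roots_def roots_def by (auto simp: image_iff)
  ultimately show ?thesis by (simp add: card_image)
qed

context
  fixes n :: nat and q :: real and \<iota> :: "form \<Rightarrow> complex"
  assumes q: "q \<noteq> 0" "q \<noteq> 1" "q \<noteq> -1"
    and iso: "\<iota> \<in> linear_iso (exterior_power_space n q (card (roots n))) complex_line"
begin

lemma iota_properties:
  "\<lbrakk>x \<in> exterior_power n q (card (roots n)); y \<in> exterior_power n q (card (roots n))\<rbrakk> \<Longrightarrow>
      \<iota> (x \<oplus>\<^bsub>exterior_algebra n q\<^esub> y) = \<iota> x + \<iota> y"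
  "x \<in> exterior_power n q (card (roots n)) \<Longrightarrow> \<iota> (c \<odot>\<^bsub>exterior_algebra n q\<^esub> x) = c * \<iota> x"
  "\<exists>x\<in>exterior_power n q (card (roots n)). \<iota> x = 1"
proof -
  have h: "\<iota> \<in> LinearCombinations.module_hom class_ring (exterior_power_space n q (card (roots n))) complex_line"
    and b: "bij_betw \<iota> (carrier (exterior_power_space n q (card (roots n)))) (carrier complex_line)"
    using iso by (auto simp: linear_iso_def)
  show "\<lbrakk>x \<in> exterior_power n q (card (roots n)); y \<in> exterior_power n q (card (roots n))\<rbrakk> \<Longrightarrow>
      \<iota> (x \<oplus>\<^bsub>exterior_algebra n q\<^esub> y) = \<iota> x + \<iota> y"
    and "x \<in> exterior_power n q (card (roots n)) \<Longrightarrow> \<iota> (c \<odot>\<^bsub>exterior_algebra n q\<^esub> x) = c * \<iota> x"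
    using h by (auto simp: LinearCombinations.module_hom_def exterior_power_space_def complex_line_def)
  have "1 \<in> \<iota> ` exterior_power n q (card (roots n))"
    using bij_betw_imp_surj_on[OF b] by (simp add: exterior_power_space_def complex_line_def)
  then show "\<exists>x\<in>exterior_power n q (card (roots n)). \<iota> x = 1" by force
qed

text \<open>
  The value on a monomial of the functional on polynomials that \<open>\<iota>\<close> induces.
\<close>
definition word_value :: "one_form free_word \<Rightarrow> complex" where
  "word_value u = (if length (letters u) = card (roots n) \<and> set (letters u) \<subseteq> carrier (one_forms n q)
     then \<iota> (form_of n q (Poly_Mapping.single u 1)) else 0)"

lemma extend_by_zero_form_of:
  assumes "p \<in> form_polys n q"
  shows "extend_by_zero n q (card (roots n)) \<iota> (form_of n q p) = linear_extension word_value p"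
proof -
  let ?N = "card (roots n)"
  have power: "form_of n q (graded_part ?N p) \<in> exterior_power n q ?N" if "p \<in> form_polys n q" for p
    unfolding exterior_power_eq using graded_part_homogeneous[OF that] by blast
  have zero: "\<iota> (form_of n q 0) = 0"
    using iota_properties(2)[OF power[of 0], of 0] by (simp add: form_of_hom(3)[of 0 n q 0])
  have "p \<in> form_polys n q \<and> \<iota> (form_of n q (graded_part ?N p)) = linear_extension word_value p"
    using assms
  proof (induction p rule: polys_induct)
    case zero
    then show ?case using \<open>\<iota> (form_of n q 0) = 0\<close> by simp
  next
    case (single w c)
    note w = polys_single[OF single]
    show ?case
    proof (cases "length (letters w) = ?N")
      case True
      then have "form_of n q (Poly_Mapping.single w 1) \<in> exterior_power n q ?N"
        using power[OF w[of 1]] by simp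
      from iota_properties(2)[OF this, of c] show ?thesis
        using True single w[of 1] w[of c]
        by (simp add: form_of_hom(3)[OF w[of 1] w[of 1]] scalar_mult_single word_value_def)
    next
      case False
      then show ?thesis using \<open>\<iota> (form_of n q 0) = 0\<close> w[of c] by (simp add: word_value_def)
    qed
  next
    case (add p p')
    then show ?case
      using iota_properties(1)[OF power[of p] power[of p']] by (simp add: form_of_hom(1))
  qed
  then show ?thesis
    unfolding extend_by_zero_def degree_part_form_of[OF assms] by blast
qed

lemma forms_straightening_functional:
  "straightening_functional (carrier (one_forms n q)) (relation_ideal n q) (roots n) (basic_form n q)
     root_weight (linear_extension word_value)"
proof -
  interpret straightening "carrier (one_forms n q)" "relation_ideal n q" "roots n" "basic_form n q" root_weight
    by (rule basic_forms_straightening[OF q])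
  show ?thesis
  proof unfold_locales
    fix p assume p: "p \<in> relation_ideal n q"
    then have pp: "p \<in> form_polys n q" by (simp add: relation_ideal_def)
    have "form_of n q p = form_of n q 0"
      using p pp by (simp add: form_of_eq_iff)
    then have "linear_extension word_value p = linear_extension word_value 0"
      using extend_by_zero_form_of[OF pp] extend_by_zero_form_of[of 0] by simp
    then show "linear_extension word_value p = 0" by simp
  next
    fix xs assume "set xs \<subseteq> roots n" "length xs \<noteq> card (roots n)"
    moreover have "prod_list (map (basic_form n q) xs) =
        Poly_Mapping.single (Word (map (\<lambda>\<alpha>. one_form_class n q (coord n q \<alpha>)) xs)) 1"
      by (induction xs)
        (simp_all add: basic_form_def[OF q] indet_def mult_single plus_free_word_def flip: zero_free_word_def)
    ultimately show "linear_extension word_value (prod_list (map (basic_form n q) xs)) = 0"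
      by (simp add: word_value_def)
  next
    obtain p where p: "p \<in> homogeneous (carrier (one_forms n q)) (card (roots n))" "\<iota> (form_of n q p) = 1"
      using iota_properties(3) by (auto simp: exterior_power_eq)
    then have pp: "p \<in> form_polys n q" "graded_part (card (roots n)) p = p" by (auto simp: homogeneous_iff)
    then have "linear_extension word_value p = 1"
      using extend_by_zero_form_of[OF pp(1)] p(2)
      by (simp add: extend_by_zero_def degree_part_form_of)
    then show "\<exists>p\<in>form_polys n q. linear_extension word_value p \<noteq> 0" using pp by force
  qed simp_all
qed

text \<open>
  On polynomials the form is \<open>ev (p * p')\<close> for the linear functional \<open>ev\<close> induced by \<open>\<iota>\<close>.  Bilinearity and
  invariance are then immediate, and nondegeneracy is the result on straightening.
\<close>
lemma frobenius_exterior: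
  "frobenius_algebra (exterior_algebra n q)
    (\<lambda>v w. extend_by_zero n q (card (roots n)) \<iota> (v \<otimes>\<^bsub>exterior_algebra n q\<^esub> w))"
proof -
  interpret F: straightening_functional "carrier (one_forms n q)" "relation_ideal n q" "roots n"
      "basic_form n q" root_weight "linear_extension word_value"
    by (rule forms_straightening_functional)
  have ext: "extend_by_zero n q (card (roots n)) \<iota> (form_of n q p \<otimes>\<^bsub>exterior_algebra n q\<^esub> form_of n q p')
      = linear_extension word_value (p * p')"
    if "p \<in> form_polys n q" "p' \<in> form_polys n q" for p p'
    using that by (simp add: form_of_hom extend_by_zero_form_of)
  have zero: "form_of n q p = \<zero>\<^bsub>exterior_algebra n q\<^esub>" if "p \<in> relation_ideal n q" for p
    using that exterior.Q.coset_eq_zero_iff[of "tensor_of n q p" n q] tensor.Q.coset_in_quot[of p n q]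
    by (auto simp: relation_ideal_def exterior.Q.quot_zero form_of_def)
  show ?thesis
  proof (intro frobenius_algebra.intro frobenius_algebra_axioms.intro exterior.complex_algebra_quot)
    fix x assume x: "x \<in> carrier (exterior_algebra n q)"
      and 0: "\<And>y. y \<in> carrier (exterior_algebra n q) \<Longrightarrow>
        extend_by_zero n q (card (roots n)) \<iota> (x \<otimes>\<^bsub>exterior_algebra n q\<^esub> y) = 0"
    obtain p where p: "p \<in> form_polys n q" "x = form_of n q p" using x by (auto simp: exterior_carrier)
    have "linear_extension word_value (p * r) = 0" if "r \<in> form_polys n q" for r
      using 0[of "form_of n q r"] that p by (simp add: ext exterior_carrier)
    then show "x = \<zero>\<^bsub>exterior_algebra n q\<^esub>"
      using F.nondegenerate[OF p(1)] zero p(2) by blast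
  next
    fix x assume x: "x \<in> carrier (exterior_algebra n q)"
      and 0: "\<And>y. y \<in> carrier (exterior_algebra n q) \<Longrightarrow>
        extend_by_zero n q (card (roots n)) \<iota> (y \<otimes>\<^bsub>exterior_algebra n q\<^esub> x) = 0"
    obtain p where p: "p \<in> form_polys n q" "x = form_of n q p" using x by (auto simp: exterior_carrier)
    have "linear_extension word_value (r * p) = 0" if "r \<in> form_polys n q" for r
      using 0[of "form_of n q r"] that p by (simp add: ext exterior_carrier)
    then show "x = \<zero>\<^bsub>exterior_algebra n q\<^esub>"
      using F.nondegenerate[OF p(1)] zero p(2) by blast
  qed (auto simp: exterior_carrier extend_by_zero_form_of form_of_hom(1,2) form_of_hom(3)[OF _ polys_closed(1)]
      distrib_left distrib_right mult.assoc mult_scalar_left_commute)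
qed

end

theorem corollary3p20:
  fixes n :: nat and q :: real and \<iota> :: "form \<Rightarrow> complex"
  assumes "n \<ge> 1"
    and "q \<noteq> -1" and "q \<noteq> 0" and "q \<noteq> 1"
    and "\<iota> \<in> linear_iso (exterior_power_space n q (card (pos_roots n))) complex_line"
  shows "frobenius_algebra (exterior_algebra n q)
    (\<lambda>v w. extend_by_zero n q (card (pos_roots n)) \<iota> (v \<otimes>\<^bsub>exterior_algebra n q\<^esub> w))"
  using frobenius_exterior[of q \<iota> n] assms by (simp only: card_pos_roots not_False_eq_True)

end
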